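(* Let $d,r,s$ be positive integers, let $b_0,\tilde b_0\in (l_0(\mathbb{Z}^d))^{r\times r}$ and $b_1,\dots,b_s,\tilde b_1,\dots,\tilde b_s\in (l_0(\mathbb{Z}^d))^{1\times r}$ be finitely supported filters and let $\mathsf M_0,\dots,\mathsf M_s$ be $d\times d$ dilation matrices. The following statements (i)–(iv) are equivalent. (i) $(\{b_l!\mathsf M_l\}_{l=0}^s,\{\tilde b_l!\mathsf M_l\}_{l=0}^s)$ is a dual framelet filter bank with mixed dilation factors. (ii) For all $v,w\in(l_2(\mathbb{Z}^d))^{1\times r}$: $\ \langle v,w\rangle=\sum_{l=0}^s\sum_{k\in\mathbb{Z}^d}\langle v,b_{l,1;k}\rangle\langle\tilde b_{l,1;k},w\rangle.$ (iii) For all $J\in\mathbb N$ and $v,w\in(l_2(\mathbb{Z}^d))^{1\times r}$: $$\langle v,w\rangle=\sum_{k\in\mathbb{Z}^d}\langle v,b_{0,J;k}\rangle\langle\tilde b_{0,J;k},w\rangle+\sum_{j=1}^J\sum_{l=1}^s\sum_{k\in\mathbb{Z}^d}\langle v,b_{l,j;k}\rangle\langle\tilde b_{l,j;k},w\rangle.$$ (iv) (Cascade structure) For all $j\in\mathbb N$ and $v,w\in(l_2(\mathbb{Z}^d))^{1\times r}$: $$\sum_{k\in\mathbb{Z}^d}\langle v,b_{0,j-1;k}\rangle\langle\tilde b_{0,j-1;k},w\rangle=\sum_{l=0}^s\sum_{k\in\mathbb{Z}^d}\langle v,b_{l,j;k}\rangle\langle\tilde b_{l,j;k},w\rangle,$$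 with the convention $b_{0,0;k}=\tilde b_{0,0;k}:=\boldsymbol\delta(\cdot-k)I_r$. If it is further assumed that $\{b_l!\mathsf M_l\}_{l=0}^s$ and $\{\tilde b_l!\mathsf M_l\}_{l=0}^s$ have stability in $l_2(\mathbb{Z}^d)$, then each of the statements (i), (ii), (iii), (iv) is equivalent to: (v) For all $J\in\mathbb N$ and $v\in(l_2(\mathbb{Z}^d))^{1\times r}$, $$v=\sum_{k\in\mathbb{Z}^d}\langle v,b_{0,J;k}\rangle\tilde b_{0,J;k}+\sum_{j=1}^J\sum_{l=1}^s\sum_{k\in\mathbb{Z}^d}\langle v,b_{l,j;k}\rangle\tilde b_{l,j;k},$$ and moreover there exist $C_1,C_2>0$ such that $$C_1\|v\|^2\le\sum_{k\in\mathbb{Z}^d}\|\langle v,b_{0,J;k}\rangle\|^2+\sum_{j=1}^J\sum_{l=1}^s\sum_{k\in\mathbb{Z}^d}|\langle v,b_{l,j;k}\rangle|^2\le C_2\|v\|^2,$$ $$C_2^{-1}\|v\|^2\le\sum_{k\in\mathbb{Z}^d}\|\langle v,\tilde b_{0,J;k}\rangle\|^2+\sum_{j=1}^J\sum_{l=1}^s\sum_{k\in\mathbb{Z}^d}|\langle v,\tilde b_{l,j;k}\rangle|^2\le C_1^{-1}\|v\|^2$$ hold for all $J\in\mathbb N$ and $v\in(l_2(\mathbb{Z}^d))^{1\times r}$.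
   Context: A $d\times d$ dilation matrix is an integer matrix all of whose eigenvalues have modulus greater than $1$. $(l_0(\mathbb{Z}^d))^{p\times q}$: finitely supported sequences $\mathbb{Z}^d\to\mathbb{C}^{p\times q}$; $(l_2(\mathbb{Z}^d))^{p\times q}$: square-summable ones, with $\|u\|^2$ the sum of squared moduli of all entries. $\widehat u(\xi):=\sum_{k}u(k)e^{-ik\cdot\xi}$; $\overline A^{\mathsf T}$ is the conjugate transpose; $\boldsymbol\delta(0)=1$, $\boldsymbol\delta(x)=0$ for $x\neq0$. For $u$ with values in $\mathbb{C}^{t\times r}$ and $v$ with values in $\mathbb{C}^{p\times r}$, $\langle u,v\rangle:=\sum_{k\in\mathbb{Z}^d}u(k)\overline{v(k)}^{\mathsf T}\in\mathbb{C}^{t\times p}$. Dual framelet filter bank with mixed dilation factors: with $\Omega_l:=[\mathsf M_l^{-\mathsf T}\mathbb{Z}^d]\cap[0,1)^d$ and $\chi_E$ the indicator function of $E$, $\sum_{l=0}^s\chi_{\Omega_l}(\omega)\overline{\widehat{b_l}(\xi)}^{\mathsf T}\widehat{\tilde b_l}(\xi+2\pi\omega)=\boldsymbol\delta(\omega)I_r$ for a.e. $\xi\in\mathbb{R}^d$ and all $\omega\in\bigcup_{l=0}^s\Omega_l$. For $j\in\mathbb N$ and $l=0,\dots,s$, the filter $b_{l,j}$ is defined by $\widehat{b_{l,j}}(\xi):=\widehat{b_l}((\mathsf M_0^{\mathsf T})^{j-1}\xi)\widehat{b_0}((\mathsf M_0^{\mathsf T})^{j-2}\xi)\cdots\widehat{b_0}(\mathsf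 M_0^{\mathsf T}\xi)\widehat{b_0}(\xi)$ (so $b_{l,1}=b_l$), and for $k\in\mathbb{Z}^d$, $b_{l,j;k}:=|\det(\mathsf M_0)|^{\frac{j-1}2}|\det(\mathsf M_l)|^{\frac12}b_{l,j}(\cdot-\mathsf M_0^{j-1}\mathsf M_lk)$. $\tilde b_{l,j}$ and $\tilde b_{l,j;k}$ are defined in the same way from the $\tilde b_l$. Stability in $l_2(\mathbb{Z}^d)$: with $[\mathcal T_{b,\mathsf M}u](n):=|\det(\mathsf M)|^{1/2}\sum_{k\in\mathbb{Z}^d}u(k)\overline{b(k-\mathsf Mn)}^{\mathsf T}$, $v_{0,0}:=v$, $v_{l,j}:=\mathcal T_{b_l,\mathsf M_l}v_{0,j-1}$ and $\mathcal W_Jv:=(v_{1,1},\dots,v_{s,1},\dots,v_{1,J},\dots,v_{s,J},v_{0,J})$, the filter bank $\{b_l!\mathsf M_l\}_{l=0}^s$ has stability in $l_2(\mathbb{Z}^d)$ if there are positive constants $c_1,c_2$ with $c_1\|v\|^2\le\|\mathcal W_Jv\|^2\le c_2\|v\|^2$ for all $J\in\mathbb N$ and $v\in(l_2(\mathbb{Z}^d))^{1\times r}$; similarly for $\{\tilde b_l!\mathsf M_l\}_{l=0}^s$. *)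

theory Defs
  imports "HOL-Analysis.Analysis"
begin

text \<open>
  The lattice $\mathbb{Z}^d$ is \<^typ>\<open>int ^ 'd\<close>, and sequences of $p \times q$ matrices are functions
  of type \<^typ>\<open>int ^ 'd \<Rightarrow> complex ^ 'q ^ 'p\<close>. Row vectors are $1 \times r$ matrices, of type
  \<^typ>\<open>complex ^ 'r ^ 1\<close>. The library norm on these matrix types is the Frobenius norm, so
  the square of the norm is the sum of the squared moduli of all entries.
\<close>

definition real_vec :: "int ^ 'd \<Rightarrow> real ^ 'd" where
  "real_vec k = (\<chi> i. real_of_int (k $ i))"

definition conj_transpose :: "complex ^ 'q ^ 'p \<Rightarrow> complex ^ 'p ^ 'q" where
  "conj_transpose A = transpose (map_matrix cnj A)"

text \<open>
  The library operation \<open>^\<close> on vectors and matrices is componentwise; this is the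
  power with respect to the matrix product.
\<close>

primrec matpow :: "'a::semiring_1 ^ 'd ^ 'd \<Rightarrow> nat \<Rightarrow> 'a ^ 'd ^ 'd" where
  "matpow A 0 = mat 1"
| "matpow A (Suc n) = A ** matpow A n"

definition delta :: "'a::zero \<Rightarrow> complex" where
  "delta x = (if x = 0 then 1 else 0)"

definition dilation_matrix :: "int ^ 'd ^ 'd \<Rightarrow> bool" where
  "dilation_matrix M \<longleftrightarrow>
     (\<forall>z x. x \<noteq> 0 \<and> map_matrix complex_of_int M *v x = z *s x \<longrightarrow> 1 < norm z)"


subsection \<open>Sequence spaces\<close>

definition l0_seqs :: "(int ^ 'd \<Rightarrow> complex ^ 'q ^ 'p) set" where
  "l0_seqs = {u. finite {k. u k \<noteq> 0}}"

definition l2_seqs :: "(int ^ 'd \<Rightarrow> complex ^ 'q ^ 'p) set" where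
  "l2_seqs = {u. (\<lambda>k. (norm (u k))\<^sup>2) summable_on UNIV}"

abbreviation l2_rows :: "(int ^ 'd \<Rightarrow> complex ^ 'r ^ 1) set" where
  "l2_rows \<equiv> l2_seqs"

definition l2_normsq :: "(int ^ 'd \<Rightarrow> complex ^ 'q ^ 'p) \<Rightarrow> real" where
  "l2_normsq u = (\<Sum>\<^sub>\<infinity>k. (norm (u k))\<^sup>2)"

text \<open>
  Below, \<^const>\<open>infsum\<close> is applied only to series that converge absolutely: the sequences are
  square-summable or finitely supported. Its default value for divergent series plays no role.
\<close>

definition seq_inner ::
    "(int ^ 'd \<Rightarrow> complex ^ 'r ^ 't) \<Rightarrow> (int ^ 'd \<Rightarrow> complex ^ 'r ^ 'p) \<Rightarrow> complex ^ 'p ^ 't" where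
  "seq_inner u v = (\<Sum>\<^sub>\<infinity>k. u k ** conj_transpose (v k))"

text \<open>Unconditional convergence of the series $\sum_k f_k = u$ in the norm of $l_2(\mathbb{Z}^d)$.\<close>

definition l2_has_sum ::
    "('k \<Rightarrow> int ^ 'd \<Rightarrow> complex ^ 'q ^ 'p) \<Rightarrow> (int ^ 'd \<Rightarrow> complex ^ 'q ^ 'p) \<Rightarrow> bool" where
  "l2_has_sum f u \<longleftrightarrow> (\<forall>k. f k \<in> l2_seqs) \<and> u \<in> l2_seqs \<and>
     ((\<lambda>K. l2_normsq (\<lambda>n. u n - (\<Sum>k\<in>K. f k n))) \<longlongrightarrow> 0) (finite_subsets_at_top UNIV)"

definition fourier :: "(int ^ 'd \<Rightarrow> complex ^ 'q ^ 'p) \<Rightarrow> real ^ 'd \<Rightarrow> complex ^ 'q ^ 'p" where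
  "fourier u \<xi> = (\<Sum>\<^sub>\<infinity>k. map_matrix (\<lambda>z. z * exp (- \<i> * complex_of_real (real_vec k \<bullet> \<xi>))) (u k))"


subsection \<open>Dual framelet filter banks with mixed dilation factors\<close>

text \<open>
  In a filter bank the low-pass filter \<open>b0\<close> ($r \times r$) is kept apart from the high-pass
  filters \<open>b 1, \<dots>, b s\<close> ($1 \times r$) because their types differ; only the values of
  \<open>b\<close> at the indices \<open>1, \<dots>, s\<close> matter. The dilation matrices are \<open>M 0, \<dots>, M s\<close>.
\<close>

definition freq_set :: "int ^ 'd ^ 'd \<Rightarrow> (real ^ 'd) set" where
  "freq_set M = range (\<lambda>k. matrix_inv (transpose (map_matrix real_of_int M)) *v real_vec k)
                \<inter> {\<omega>. \<forall>i. 0 \<le> \<omega> $ i \<and> \<omega> $ i < 1}"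

definition dual_framelet_filter_bank ::
    "nat \<Rightarrow> (nat \<Rightarrow> int ^ 'd ^ 'd)
     \<Rightarrow> (int ^ 'd \<Rightarrow> complex ^ 'r ^ 'r) \<Rightarrow> (nat \<Rightarrow> int ^ 'd \<Rightarrow> complex ^ 'r ^ 1)
     \<Rightarrow> (int ^ 'd \<Rightarrow> complex ^ 'r ^ 'r) \<Rightarrow> (nat \<Rightarrow> int ^ 'd \<Rightarrow> complex ^ 'r ^ 1) \<Rightarrow> bool" where
  "dual_framelet_filter_bank s M b0 b tb0 tb \<longleftrightarrow>
     (AE \<xi> in lborel. \<forall>\<omega> \<in> (\<Union>l\<in>{0..s}. freq_set (M l)).
        indicat_real (freq_set (M 0)) \<omega> *\<^sub>R
          (conj_transpose (fourier b0 \<xi>) ** fourier tb0 (\<xi> + (2 * pi) *\<^sub>R \<omega>))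
        + (\<Sum>l=1..s. indicat_real (freq_set (M l)) \<omega> *\<^sub>R
            (conj_transpose (fourier (b l) \<xi>) ** fourier (tb l) (\<xi> + (2 * pi) *\<^sub>R \<omega>)))
        = mat (delta \<omega>))"


subsection \<open>Multilevel filters\<close>

text \<open>The product of the factors $\widehat{b_0}((M_0^T)^i \xi)$ for $i = n - 1, \dots, 0$, in this order.\<close>

primrec low_pass_product ::
    "(int ^ 'd \<Rightarrow> complex ^ 'r ^ 'r) \<Rightarrow> int ^ 'd ^ 'd \<Rightarrow> nat \<Rightarrow> real ^ 'd \<Rightarrow> complex ^ 'r ^ 'r" where
  "low_pass_product b0 M0 0 \<xi> = mat 1"
| "low_pass_product b0 M0 (Suc n) \<xi> =
     fourier b0 (matpow (transpose (map_matrix real_of_int M0)) n *v \<xi>) ** low_pass_product b0 M0 n \<xi>"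

text \<open>
  The filter $b_{l,j}$ for $j \ge 1$, where \<open>bl\<close> is $b_l$ (and \<open>bl = b0\<close> if $l = 0$). As the
  matrix is integer, the right-hand side is a trigonometric polynomial, so there is exactly one
  such finitely supported filter.
\<close>

definition level_filter ::
    "(int ^ 'd \<Rightarrow> complex ^ 'r ^ 'r) \<Rightarrow> int ^ 'd ^ 'd \<Rightarrow> (int ^ 'd \<Rightarrow> complex ^ 'r ^ 'p)
     \<Rightarrow> nat \<Rightarrow> int ^ 'd \<Rightarrow> complex ^ 'r ^ 'p" where
  "level_filter b0 M0 bl j = (THE u. u \<in> l0_seqs \<and>
     (\<forall>\<xi>. fourier u \<xi> =
        fourier bl (matpow (transpose (map_matrix real_of_int M0)) (j - 1) *v \<xi>)
        ** low_pass_product b0 M0 (j - 1) \<xi>))"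

text \<open>The elements $b_{l,j;k}$ for $j \ge 1$, where \<open>bl\<close> and \<open>Ml\<close> are $b_l$ and $M_l$.\<close>

definition level_elem ::
    "(int ^ 'd \<Rightarrow> complex ^ 'r ^ 'r) \<Rightarrow> int ^ 'd ^ 'd
     \<Rightarrow> (int ^ 'd \<Rightarrow> complex ^ 'r ^ 'p) \<Rightarrow> int ^ 'd ^ 'd
     \<Rightarrow> nat \<Rightarrow> int ^ 'd \<Rightarrow> int ^ 'd \<Rightarrow> complex ^ 'r ^ 'p" where
  "level_elem b0 M0 bl Ml j k = (\<lambda>n.
     (real_of_int \<bar>det M0\<bar> powr ((real j - 1) / 2) * real_of_int \<bar>det Ml\<bar> powr (1 / 2)) *\<^sub>R
     level_filter b0 M0 bl j (n - matpow M0 (j - 1) *v (Ml *v k)))"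

text \<open>The elements $b_{0,j;k}$ for $j \ge 0$, with the convention for $j = 0$.\<close>

definition low_elem ::
    "(int ^ 'd \<Rightarrow> complex ^ 'r ^ 'r) \<Rightarrow> int ^ 'd ^ 'd \<Rightarrow> nat \<Rightarrow> int ^ 'd
     \<Rightarrow> int ^ 'd \<Rightarrow> complex ^ 'r ^ 'r" where
  "low_elem b0 M0 j k =
     (if j = 0 then (\<lambda>n. mat (delta (n - k))) else level_elem b0 M0 b0 M0 j k)"


subsection \<open>Stability\<close>

definition transition_op ::
    "(int ^ 'd \<Rightarrow> complex ^ 'r ^ 'p) \<Rightarrow> int ^ 'd ^ 'd
     \<Rightarrow> (int ^ 'd \<Rightarrow> complex ^ 'r ^ 't) \<Rightarrow> int ^ 'd \<Rightarrow> complex ^ 'p ^ 't" where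
  "transition_op b M u n =
     (real_of_int \<bar>det M\<bar> powr (1 / 2)) *\<^sub>R (\<Sum>\<^sub>\<infinity>k. u k ** conj_transpose (b (k - M *v n)))"

primrec low_coeffs ::
    "(int ^ 'd \<Rightarrow> complex ^ 'r ^ 'r) \<Rightarrow> int ^ 'd ^ 'd \<Rightarrow> (int ^ 'd \<Rightarrow> complex ^ 'r ^ 't)
     \<Rightarrow> nat \<Rightarrow> int ^ 'd \<Rightarrow> complex ^ 'r ^ 't" where
  "low_coeffs b0 M0 v 0 = v"
| "low_coeffs b0 M0 v (Suc j) = transition_op b0 M0 (low_coeffs b0 M0 v j)"

text \<open>$\|\mathcal{W}_J v\|^2$, with $v_{l,j} = \mathcal{T}_{b_l,M_l} v_{0,j-1}$.\<close>

definition decomposition_normsq ::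
    "nat \<Rightarrow> (nat \<Rightarrow> int ^ 'd ^ 'd) \<Rightarrow> (int ^ 'd \<Rightarrow> complex ^ 'r ^ 'r)
     \<Rightarrow> (nat \<Rightarrow> int ^ 'd \<Rightarrow> complex ^ 'r ^ 1) \<Rightarrow> nat \<Rightarrow> (int ^ 'd \<Rightarrow> complex ^ 'r ^ 1) \<Rightarrow> real" where
  "decomposition_normsq s M b0 b J v =
     (\<Sum>j=1..J. \<Sum>l=1..s. l2_normsq (transition_op (b l) (M l) (low_coeffs b0 (M 0) v (j - 1))))
     + l2_normsq (low_coeffs b0 (M 0) v J)"

definition l2_stable ::
    "nat \<Rightarrow> (nat \<Rightarrow> int ^ 'd ^ 'd) \<Rightarrow> (int ^ 'd \<Rightarrow> complex ^ 'r ^ 'r)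
     \<Rightarrow> (nat \<Rightarrow> int ^ 'd \<Rightarrow> complex ^ 'r ^ 1) \<Rightarrow> bool" where
  "l2_stable s M b0 b \<longleftrightarrow> (\<exists>c1>0. \<exists>c2>0. \<forall>J\<ge>1. \<forall>v\<in>l2_rows.
     c1 * l2_normsq v \<le> decomposition_normsq s M b0 b J v \<and>
     decomposition_normsq s M b0 b J v \<le> c2 * l2_normsq v)"

end

theory Submission
  imports Defs
begin

text \<open>
  Write $T_l = \mathcal{T}_{b_l,M_l}$ and $\tilde T_l = \mathcal{T}_{\tilde b_l,M_l}$. Since $b_{l,j}$
  arises from $b_l$ by iterated refinement, the numbers $\langle v, b_{l,j;k}\rangle$ are the entries
  of $T_l T_0^{j-1} v$, and every sum over $k$ in (ii)--(iv) is an inner product of such a sequence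
  with its dual counterpart. Thus (ii) reads
  $\langle v,w\rangle = \sum_l \langle T_l v, \tilde T_l w\rangle$; applied to $T_0^{j-1}v$ and
  $\tilde T_0^{j-1}w$ it is (iv), which telescopes to (iii).

  By adjunction (ii) says that $R = \sum_l \tilde T_l^* T_l$ is the identity. The kernel of $R$ along
  a fixed difference $p$ is a combination of the characters $n \mapsto e^{2\pi i n\cdot\omega}$ with
  $\omega \in \bigcup_l \Omega_l$, because
  $\sum_{\omega\in\Omega_l} e^{2\pi i n\cdot\omega}$ is $|\det M_l|$ on $M_l\mathbb{Z}^d$ and $0$ off it;
  its coefficients are the Fourier coefficients in $\xi$ of the left-hand side of (i). Linear
  independence of characters, once in $n$ and once in $\xi$, makes (i) equivalent to $R = 1$.

  Under stability the sums in (v) are $\|\mathcal{W}_J v\|^2$ for the two banks, and the synthesis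
  operators are bounded, so (iii) upgrades to unconditional convergence in $l_2$.
\<close>

text \<open>The sublattices M_l Z^d may all differ, so the kernel of R is not compared coset by
  coset. Fixing the difference p and expanding in n puts all of them on one finite frequency set; an
  l with \<omega> outside \<Omega>_l simply contributes coefficient 0, which is the role of the
  indicator functions in (i). The weight |det M_l| has two sources that must agree: it is the
  product of the two normalising factors |det M_l|^(1/2) of the transition operators, and it is the
  number of points of \<Omega>_l. Hence (i) carries no weights. That number is a volume, which is
  why the proof starts with measure theory. "Almost every" in (i) costs nothing: both sides are
  trigonometric polynomials in \<xi>, hence continuous. Filters have finite support, so analysis,
  synthesis and kernels are finite sums at each point; convergence matters only in inner products
  and in the l_2 limits of (v). There the limits are existentially quantified, but l_2 convergence
  forces pointwise convergence, so they must be the syntheses. Every way back to (i) goes through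
  the first level, J = 1 or j = 1.\<close>

text \<open>The library version \<open>measure_linear_image\<close> needs a well-ordered index type.\<close>

lemma measure_linear_image_cart:
  fixes f :: "real^'n \<Rightarrow> real^'n"
  assumes "linear f" "S \<in> lmeasurable"
  shows "f ` S \<in> lmeasurable \<and> measure lebesgue (f ` S) = \<bar>det (matrix f)\<bar> * measure lebesgue S"
proof -
  \<comment> \<open>For a map of determinant 1 or -1 it is enough to test boxes:
    \<open>measure_linear_sufficient\<close> with factor 1 then covers all measurable sets.
    Coordinate swaps and shears are treated this way.\<close>
  have red: "\<forall>S \<in> lmeasurable. h ` S \<in> lmeasurable \<and> measure lebesgue (h ` S) = \<bar>det (matrix h)\<bar> * measure lebesgue S"
    if "linear h" "\<bar>det (matrix h)\<bar> = 1" "\<And>a b. measure lebesgue (h ` cbox a b) = measure lebesgue (cbox a b)"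
    for h :: "real^'n \<Rightarrow> real^'n"
  proof
    fix S :: "(real^'n) set" assume S: "S \<in> lmeasurable"
    have "h ` S \<in> lmeasurable \<and> 1 * measure lebesgue S = measure lebesgue (h ` S)"
      by (rule measure_linear_sufficient[OF that(1) S]) (simp add: that(3))
    then show "h ` S \<in> lmeasurable \<and> measure lebesgue (h ` S) = \<bar>det (matrix h)\<bar> * measure lebesgue S"
      using that(2) by (metis mult_1)
  qed
  have "\<forall>S \<in> lmeasurable. f ` S \<in> lmeasurable \<and> measure lebesgue (f ` S) = \<bar>det (matrix f)\<bar> * measure lebesgue S"
  proof (rule induct_linear_elementary[OF assms(1)])
    fix f g :: "real^'n \<Rightarrow> real^'n"
    assume lin: "linear f" "linear g"
      and f: "\<forall>S\<in>lmeasurable. f ` S \<in> lmeasurable \<and> measure lebesgue (f ` S) = \<bar>det (matrix f)\<bar> * measure lebesgue S"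
      and g: "\<forall>S\<in>lmeasurable. g ` S \<in> lmeasurable \<and> measure lebesgue (g ` S) = \<bar>det (matrix g)\<bar> * measure lebesgue S"
    show "\<forall>S\<in>lmeasurable. (f \<circ> g) ` S \<in> lmeasurable \<and> measure lebesgue ((f \<circ> g) ` S) = \<bar>det (matrix (f \<circ> g))\<bar> * measure lebesgue S"
      using f g unfolding image_comp[symmetric] matrix_compose[OF lin(2,1)] det_mul abs_mult
      by simp
  next
    fix f :: "real^'n \<Rightarrow> real^'n" and i assume lin: "linear f" and 0: "\<And>x. f x $ i = 0"
    have "\<not> surj f"
      using 0 by (metis one_neq_zero surjE vec_component)
    then have ninj: "\<not> inj f"
      using linear_injective_imp_surjective[OF lin] by blast
    then have "det (matrix f) = 0"
      using det_nz_iff_inj[OF lin] by blast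
    moreover have "negligible (f ` S)" for S
      by (rule negligible_linear_singular_image[OF lin ninj])
    ultimately show "\<forall>S\<in>lmeasurable. f ` S \<in> lmeasurable \<and> measure lebesgue (f ` S) = \<bar>det (matrix f)\<bar> * measure lebesgue S"
      by (simp add: negligible_iff_measure)
  next
    fix c
    have "matrix (\<lambda>x :: real^'n. \<chi> i. c i * x $ i) = (\<chi> i j. if i = j then c i else 0)"
      by (simp add: matrix_def vec_eq_iff axis_def)
    then have "det (matrix (\<lambda>x :: real^'n. \<chi> i. c i * x $ i)) = prod c UNIV"
      by (simp add: det_diagonal)
    then show "\<forall>S\<in>lmeasurable. (\<lambda>x :: real^'n. \<chi> i. c i * x $ i) ` S \<in> lmeasurable \<and>
        measure lebesgue ((\<lambda>x. \<chi> i. c i * x $ i) ` S) = \<bar>det (matrix (\<lambda>x :: real^'n. \<chi> i. c i * x $ i))\<bar> * measure lebesgue S"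
      by (simp add: measurable_stretch measure_stretch)
  next
    fix m n :: 'n assume "m \<noteq> n"
    let ?p = "Transposition.transpose m n" and ?h = "\<lambda>x :: real^'n. \<chi> i. x $ Transposition.transpose m n i"
    have lin: "linear ?h" by (rule linearI) (simp_all add: vec_eq_iff)
    have "matrix ?h = (\<chi> i. mat 1 $ ?p i)"
      by (simp add: matrix_def vec_eq_iff axis_def mat_def)
    then have "\<bar>det (matrix ?h)\<bar> = 1"
      using det_permute_rows[OF permutes_swap_id[of m UNIV n], of "mat 1 :: real^'n^'n"]
      by (simp add: sign_swap_id)
    moreover have "measure lebesgue (?h ` cbox a b) = measure lebesgue (cbox a b)" for a b
    proof (cases "cbox a b = {}")
      case False
      have bp: "bij ?p" by simp
      have "?h ` cbox a b = cbox (?h a) (?h b)"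
      proof (intro set_eqI iffI)
        fix x assume "x \<in> cbox (?h a) (?h b)"
        then have "?h x \<in> cbox a b" 
          unfolding mem_box_cart vec_lambda_beta by (metis transpose_involutory)
        moreover have "x = ?h (?h x)" by (simp add: vec_eq_iff)
        ultimately show "x \<in> ?h ` cbox a b" by blast
      qed (auto simp: mem_box_cart)
      moreover have "(\<Prod>i\<in>UNIV. b $ ?p i - a $ ?p i) = (\<Prod>i\<in>UNIV. b $ i - a $ i)"
        by (rule prod.reindex_bij_betw[OF bp])
      moreover have "cbox (?h a) (?h b) \<noteq> {}"
        using False calculation(1) by (metis image_is_empty)
      ultimately show ?thesis
        using False by (simp add: content_cbox_cart)
    qed simp
    ultimately show "\<forall>S\<in>lmeasurable. ?h ` S \<in> lmeasurable \<and> measure lebesgue (?h ` S) = \<bar>det (matrix ?h)\<bar> * measure lebesgue S"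
      by (rule red[OF lin])
  next
    fix m n :: 'n assume mn: "m \<noteq> n"
    let ?h = "\<lambda>x :: real^'n. \<chi> i. if i = m then x $ m + x $ n else x $ i"
    have lin: "linear ?h" by (rule linearI) (simp_all add: vec_eq_iff algebra_simps)
    have "matrix ?h = (\<chi> k. if k = m then row m (mat 1) + 1 *s row n (mat 1) else row k (mat 1))"
      by (simp add: matrix_def vec_eq_iff axis_def mat_def row_def)
    then have "\<bar>det (matrix ?h)\<bar> = 1"
      using det_row_operation[OF mn, where A = "mat 1 :: real^'n^'n" and c = 1] by simp
    moreover have "measure lebesgue (?h ` cbox a b) = measure lebesgue (cbox a b)" for a b
    proof (cases "cbox a b = {}")
      case False
      \<comment> \<open>\<open>measure_shear_interval\<close> wants nonnegative \<open>n\<close>-th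
        coordinates, so the box is first moved to have its lower corner at 0.\<close>
      have box: "cbox a b = (+) a ` cbox 0 (b - a)"
        by (simp add: cbox_translation[symmetric])
      have "?h ` cbox a b = (+) (?h a) ` ?h ` cbox 0 (b - a)"
        unfolding box image_image using linear_add[OF lin] by simp
      then have "measure lebesgue (?h ` cbox a b) = measure lebesgue (?h ` cbox 0 (b - a))"
        by (simp add: measure_translation)
      also have "\<dots> = measure lebesgue (cbox 0 (b - a))"
        using False mn by (intro measure_shear_interval) (auto simp: box)
      also have "\<dots> = measure lebesgue (cbox a b)"
        unfolding box by (simp add: measure_translation)
      finally show ?thesis .
    qed simp
    ultimately show "\<forall>S\<in>lmeasurable. ?h ` S \<in> lmeasurable \<and> measure lebesgue (?h ` S) = \<bar>det (matrix ?h)\<bar> * measure lebesgue S"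
      by (rule red[OF lin])
  qed
  then show ?thesis using assms(2) by blast
qed

subsection \<open>The frequency lattice\<close>

lemma real_vec_nth [simp]: "real_vec k $ i = real_of_int (k $ i)"
  by (simp add: real_vec_def)

lemma real_vec_0 [simp]: "real_vec 0 = 0"
  by (simp add: vec_eq_iff)

lemma real_vec_add: "real_vec (k + l) = real_vec k + real_vec l"
  by (simp add: vec_eq_iff)

lemma real_vec_diff: "real_vec (k - l) = real_vec k - real_vec l"
  by (simp add: vec_eq_iff)

lemma real_vec_eq_iff [simp]: "real_vec k = real_vec l \<longleftrightarrow> k = l"
  by (simp add: vec_eq_iff)

lemma real_vec_matrix_mult: "real_vec (M *v k) = map_matrix real_of_int M *v real_vec k"
  by (simp add: vec_eq_iff matrix_vector_mult_def map_matrix_def)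

lemma real_vec_axis: "real_vec (axis i 1) = axis i 1"
  by (simp add: vec_eq_iff axis_def)

lemma transpose_map_matrix: "transpose (map_matrix f M) = map_matrix f (transpose M)"
  by (simp add: vec_eq_iff transpose_def map_matrix_def)

lemma det_map_matrix_of_int:
  "det (map_matrix of_int M :: 'a::comm_ring_1^'n^'n) = of_int (det M)"
  by (simp add: det_def map_matrix_def)

lemma invertible_map_matrix_real_of_int:
  fixes M :: "int^'d^'d"
  assumes "det M \<noteq> 0" shows "invertible (map_matrix real_of_int M)"
  using assms by (simp add: invertible_det_nz det_map_matrix_of_int)

lemma matrix_inv_mult_vec:
  fixes B :: "real^'n^'n"
  assumes "invertible B"
  shows "matrix_inv B *v (B *v x) = x" "B *v (matrix_inv B *v x) = x"
proof -
  have "B ** matrix_inv B = mat 1 \<and> matrix_inv B ** B = mat 1"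
    unfolding matrix_inv_def using assms unfolding invertible_def by (rule someI_ex)
  then show "matrix_inv B *v (B *v x) = x" "B *v (matrix_inv B *v x) = x"
    by (simp_all add: matrix_vector_mul_assoc)
qed

section \<open>The half-open unit cube and the count of lattice points\<close>

definition unit_cube :: "(real^'n) set" where
  "unit_cube = {x. \<forall>i. 0 \<le> x $ i \<and> x $ i < 1}"

definition floor_vec :: "real^'n \<Rightarrow> int^'n" where
  "floor_vec x = (\<chi> i. \<lfloor>x $ i\<rfloor>)"

definition frac_vec :: "real^'n \<Rightarrow> real^'n" where
  "frac_vec x = (\<chi> i. frac (x $ i))"

lemma frac_vec_eq: "frac_vec x = x - real_vec (floor_vec x)"
  by (simp add: frac_vec_def floor_vec_def vec_eq_iff frac_def)

lemma frac_vec_in_unit_cube [simp]: "frac_vec x \<in> unit_cube"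
  by (simp add: frac_vec_def unit_cube_def frac_lt_1)

text \<open>The cube is half-open, so its integer translates are disjoint and the tile containing x
  is determined. This gives disjoint pieces in volume computations and inverts reductions modulo a
  lattice.\<close>

lemma frac_vec_unique:
  assumes "x - real_vec k \<in> unit_cube" shows "k = floor_vec x"
proof -
  have "k $ i = \<lfloor>x $ i\<rfloor>" for i
  proof -
    have "0 \<le> x $ i - real_of_int (k $ i)" "x $ i - real_of_int (k $ i) < 1"
      using assms by (simp_all add: unit_cube_def)
    then show ?thesis by linarith
  qed
  then show ?thesis by (simp add: vec_eq_iff floor_vec_def)
qed

lemma frac_vec_id: "x \<in> unit_cube \<Longrightarrow> frac_vec x = x"
  using frac_vec_unique[of x 0] by (simp add: frac_vec_eq)

lemma frac_vec_diff_real_vec [simp]: "frac_vec (x - real_vec k) = frac_vec x"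
  by (simp add: frac_vec_def vec_eq_iff frac_def)

lemma frac_vec_add_frac_vec: "frac_vec (frac_vec x + y) = frac_vec (x + y)"
proof -
  have "frac_vec x + y = (x + y) - real_vec (floor_vec x)" by (simp add: frac_vec_eq)
  then show ?thesis by (metis frac_vec_diff_real_vec)
qed

lemma unit_cube_borel [measurable]: "(unit_cube :: (real^'n) set) \<in> sets borel"
  unfolding unit_cube_def by measurable

text \<open>The cube lies between the open and the closed unit box, which have the same
  volume.\<close>

lemma unit_cube_measure:
  "(unit_cube :: (real^'n) set) \<in> lmeasurable" "measure lebesgue (unit_cube :: (real^'n) set) = 1"
proof -
  let ?one = "(\<chi> i. 1) :: real^'n"
  have sub: "box 0 ?one \<subseteq> unit_cube" "unit_cube \<subseteq> cbox 0 ?one"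
    by (auto simp: unit_cube_def mem_box_cart less_imp_le)
  have "bounded (unit_cube :: (real^'n) set)"
    using bounded_subset[OF bounded_cbox sub(2)] .
  then show lm: "(unit_cube :: (real^'n) set) \<in> lmeasurable"
    by (intro bounded_set_imp_lmeasurable) auto
  have "measure lebesgue (cbox 0 ?one) = 1"
    by (simp add: content_cbox_if_cart interval_eq_empty_cart)
  moreover have "measure lebesgue (box 0 ?one) = measure lebesgue (cbox 0 ?one)"
    by (simp add: measure_lborel_box_eq measure_lborel_cbox_eq measure_completion)
  moreover have "measure lebesgue (box 0 ?one) \<le> measure lebesgue (unit_cube :: (real^'n) set)"
    by (rule measure_mono_fmeasurable[OF sub(1) _ lm]) auto
  moreover have "measure lebesgue (unit_cube :: (real^'n) set) \<le> measure lebesgue (cbox 0 ?one)"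
    by (rule measure_mono_fmeasurable[OF sub(2)]) auto
  ultimately show "measure lebesgue (unit_cube :: (real^'n) set) = 1" by simp
qed

lemma finite_int_vec_bounded: "finite {k :: int^'n. \<forall>i. \<bar>k $ i\<bar> \<le> b}"
proof -
  have "{k :: int^'n. \<forall>i. \<bar>k $ i\<bar> \<le> b} \<subseteq> vec_lambda ` (UNIV \<rightarrow>\<^sub>E {-b..b})"
  proof
    fix k :: "int^'n" assume "k \<in> {k. \<forall>i. \<bar>k $ i\<bar> \<le> b}"
    then have "vec_nth k \<in> UNIV \<rightarrow>\<^sub>E {-b..b}" by (auto simp: abs_le_iff minus_le_iff)
    then show "k \<in> vec_lambda ` (UNIV \<rightarrow>\<^sub>E {-b..b})" by (metis image_eqI vec_nth_inverse)
  qed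
  then show ?thesis by (rule finite_subset) (intro finite_imageI finite_PiE; simp)
qed

lemma finite_real_vec_bounded: "bounded S \<Longrightarrow> finite {k. real_vec k \<in> S}"
proof -
  assume "bounded S"
  then obtain b where b: "\<And>x. x \<in> S \<Longrightarrow> norm x \<le> b" by (auto simp: bounded_iff)
  have "{k. real_vec k \<in> S} \<subseteq> {k. \<forall>i. \<bar>k $ i\<bar> \<le> \<lceil>b\<rceil>}"
  proof safe
    fix k i assume "real_vec k \<in> S"
    then have "\<bar>real_of_int (k $ i)\<bar> \<le> b" using b component_le_norm_cart[of "real_vec k" i] by fastforce
    then show "\<bar>k $ i\<bar> \<le> \<lceil>b\<rceil>" by linarith
  qed
  then show ?thesis using finite_int_vec_bounded finite_subset by blast
qed

text \<open>
  Both $[0,1)^d$ and $A[0,1)^d$ tile: the first under $\mathbb{Z}^d$, the second under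
  $A\mathbb{Z}^d$. So every translate of $A[0,1)^d$ contains equally many integer points, and
  integrating this number over $[0,1)^d$ gives the volume of $A[0,1)^d$.
\<close>

lemma card_lattice_points:
  fixes A :: "int^'d^'d"
  assumes "det A \<noteq> 0"
  defines "D \<equiv> {k. matrix_inv (map_matrix real_of_int A) *v real_vec k \<in> unit_cube}"
  shows "finite D" "card D = nat \<bar>det A\<bar>"
proof -
  define B where "B = map_matrix real_of_int A"
  define P where "P = (*v) B ` unit_cube"
  have invB: "invertible B" using assms invertible_map_matrix_real_of_int by (simp add: B_def)
  note inv = matrix_inv_mult_vec[OF invB]
  have P_iff: "y \<in> P \<longleftrightarrow> matrix_inv B *v y \<in> unit_cube" for y
    unfolding P_def using inv by (metis (no_types, lifting) image_iff)
  have D_def': "D = {k. real_vec k \<in> P}"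
    unfolding D_def P_iff B_def ..
  have lin: "linear ((*v) B)" by simp
  have Pm: "P \<in> lmeasurable" "measure lebesgue P = real_of_int \<bar>det A\<bar>"
    using measure_linear_image_cart[OF lin unit_cube_measure(1)]
    by (simp_all add: P_def unit_cube_measure B_def det_map_matrix_of_int)
  have ub: "bounded (unit_cube :: (real^'d) set)"
    by (rule bounded_subset[OF bounded_cbox[of 0 "\<chi> i. 1"]]) (auto simp: unit_cube_def mem_box_cart less_imp_le)
  have bP: "bounded P" unfolding P_def
    by (rule bounded_linear_image[OF ub]) (simp add: linear_linear)
  show "finite D" unfolding D_def' by (rule finite_real_vec_bounded[OF bP])
  \<comment> \<open>The finitely many shifts that can carry some point of the cube into
    \<open>P\<close>. Fixing them beforehand keeps all sums over k finite and independent of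
    x.\<close>
  define K where "K = {k. real_vec k \<in> {y - x |x y. x \<in> unit_cube \<and> y \<in> P}}"
  have "bounded {y - x |x y. x \<in> unit_cube \<and> y \<in> P}"
    using bounded_minus[OF bP ub] by (rule bounded_subset) auto
  then have finK: "finite K" unfolding K_def by (rule finite_real_vec_bounded)
  \<comment> \<open>The translates k + \<open>E k\<close> cut \<open>P\<close> along the integer
    tiles, while for fixed x the k with x in \<open>E k\<close> are the integer points of P - x. The
    volume of \<open>P\<close> is computed in both ways.\<close>
  define E where "E k = {x \<in> unit_cube. x + real_vec k \<in> P}" for k
  have Ek: "(+) (real_vec k) ` E k = P \<inter> (+) (real_vec k) ` unit_cube" for k
    by (auto simp: E_def add.commute)
  have Em': "P \<inter> (+) (real_vec k) ` unit_cube \<in> lmeasurable" for k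
    using Pm(1) unit_cube_measure(1) by (intro fmeasurable.Int measurable_translation)
  have Em: "E k \<in> lmeasurable" for k
  proof -
    have "E k = unit_cube \<inter> (+) (- real_vec k) ` P"
      by (force simp: E_def image_iff)
    then show ?thesis
      using fmeasurable.Int[OF unit_cube_measure(1) measurable_translation[OF Pm(1)]] by metis
  qed
  have count: "card {k \<in> K. x + real_vec k \<in> P} = card D" if x: "x \<in> unit_cube" for x
  proof (rule bij_betw_same_card)
    \<comment> \<open>\<open>?f y\<close> reduces k modulo A Z^d to the representative with y + k in
      \<open>P\<close>. Representatives are unique, so \<open>?f 0\<close> and \<open>?f x\<close>
      are inverse to each other and the count does not depend on x.\<close>
    let ?f = "\<lambda>y k. k - A *v floor_vec (matrix_inv B *v (y + real_vec k))"
    have shift: "matrix_inv B *v (y + real_vec (k - A *v l)) = matrix_inv B *v (y + real_vec k) - real_vec l" for y k l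
      by (simp add: real_vec_diff real_vec_matrix_mult algebra_simps inv B_def[symmetric])
    have mem: "y + real_vec (?f y k) \<in> P" for y k
      unfolding P_iff shift frac_vec_eq[symmetric] by simp
    have K_iff: "k \<in> K" if "x + real_vec k \<in> P" for k
      using that x unfolding K_def by force
    have shift_back: "?f y (k - A *v l) = k" if "y + real_vec k \<in> P" for k l y
    proof -
      have "(matrix_inv B *v (y + real_vec k) - real_vec l) - real_vec (- l) = matrix_inv B *v (y + real_vec k)"
        by (simp add: vec_eq_iff)
      then have "floor_vec (matrix_inv B *v (y + real_vec (k - A *v l))) = - l"
        unfolding shift using that P_iff frac_vec_unique by metis
      then show ?thesis by (simp add: vec_eq_iff matrix_vector_mult_def sum_negf)
    qed
    show "bij_betw (?f 0) {k \<in> K. x + real_vec k \<in> P} D"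
    proof (rule bij_betw_byWitness[where f' = "?f x"])
      show "\<forall>k\<in>{k \<in> K. x + real_vec k \<in> P}. ?f x (?f 0 k) = k" using shift_back by blast
      show "\<forall>k\<in>D. ?f 0 (?f x k) = k"
      proof
        fix k assume "k \<in> D"
        then have "0 + real_vec k \<in> P" by (simp add: D_def')
        then show "?f 0 (?f x k) = k" by (rule shift_back)
      qed
      show "?f 0 ` {k \<in> K. x + real_vec k \<in> P} \<subseteq> D" using mem[of 0] by (auto simp: D_def')
      show "?f x ` D \<subseteq> {k \<in> K. x + real_vec k \<in> P}" using mem[of x] K_iff by blast
    qed
  qed
  have Pun: "P = (\<Union>k\<in>K. P \<inter> (+) (real_vec k) ` unit_cube)"
  proof
    show "P \<subseteq> (\<Union>k\<in>K. P \<inter> (+) (real_vec k) ` unit_cube)"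
    proof
      fix y assume y: "y \<in> P"
      have eq: "y = real_vec (floor_vec y) + frac_vec y" by (simp add: frac_vec_eq)
      have "real_vec (floor_vec y) = y - frac_vec y" by (simp add: frac_vec_eq)
      then have "floor_vec y \<in> K" unfolding K_def using y frac_vec_in_unit_cube by blast
      moreover have "y \<in> (+) (real_vec (floor_vec y)) ` unit_cube"
        using eq frac_vec_in_unit_cube by (rule image_eqI)
      ultimately show "y \<in> (\<Union>k\<in>K. P \<inter> (+) (real_vec k) ` unit_cube)" using y by blast
    qed
  qed auto
  have "measure lebesgue P = (\<Sum>k\<in>K. measure lebesgue (P \<inter> (+) (real_vec k) ` unit_cube))"
  proof (subst Pun, rule measure_finite_Union[OF finK])
    have "k = floor_vec y" if "y \<in> (+) (real_vec k) ` unit_cube" for y :: "real^'d" and k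
    proof (rule frac_vec_unique)
      show "y - real_vec k \<in> unit_cube" using that by auto
    qed
    then show "disjoint_family_on (\<lambda>k. P \<inter> (+) (real_vec k) ` unit_cube) K"
      unfolding disjoint_family_on_def by blast
    show "(\<lambda>k. P \<inter> (+) (real_vec k) ` unit_cube) ` K \<subseteq> sets lebesgue"
      using Em' by blast
    show "emeasure lebesgue (P \<inter> (+) (real_vec k) ` unit_cube) \<noteq> \<infinity>" for k
      using Em'[of k] by (auto simp: fmeasurable_def simp del: emeasure_completion)
  qed
  also have "\<dots> = (\<Sum>k\<in>K. measure lebesgue (E k))"
    unfolding Ek[symmetric] measure_translation ..
  also have "\<dots> = (\<Sum>k\<in>K. \<integral>x. indicat_real (E k) x \<partial>lebesgue)"
    by simp
  also have "\<dots> = (\<integral>x. (\<Sum>k\<in>K. indicat_real (E k) x) \<partial>lebesgue)"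
    using Em by (intro Bochner_Integration.integral_sum[symmetric] integrable_real_indicator)
      (auto simp: fmeasurable_def simp del: emeasure_completion)
  \<comment> \<open>The constant count enters here: on the cube the integrand is
    \<open>card D\<close>, and off the cube every \<open>E k\<close> is empty.\<close>
  also have "(\<lambda>x. \<Sum>k\<in>K. indicat_real (E k) x) = (\<lambda>x. real (card D) * indicat_real unit_cube x)"
  proof
    fix x
    show "(\<Sum>k\<in>K. indicat_real (E k) x) = real (card D) * indicat_real unit_cube x"
    proof (cases "x \<in> unit_cube")
      case True
      have "(\<Sum>k\<in>K. indicat_real (E k) x) = (\<Sum>k\<in>K. if x + real_vec k \<in> P then 1 else 0)"
        using True by (intro sum.cong) (auto simp: E_def)
      also have "\<dots> = real (card {k \<in> K. x + real_vec k \<in> P})"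
        using finK by (simp flip: sum.inter_filter)
      finally show ?thesis using True count by simp
    qed (auto simp: E_def)
  qed
  also have "(\<integral>x. real (card D) * indicat_real unit_cube x \<partial>lebesgue) = real (card D)"
    by (simp add: unit_cube_measure)
  finally have "real (card D) = real_of_int \<bar>det A\<bar>" using Pm(2) by simp
  then show "card D = nat \<bar>det A\<bar>" by linarith
qed

section \<open>Characters of Z^d with frequencies in the dual lattice\<close>

lemma inner_matrix_vector_mult: "(A *v x) \<bullet> y = x \<bullet> (transpose A *v y)"
  for A :: "real^'n^'m"
  by (metis dot_lmul_matrix inner_commute transpose_matrix_vector)

lemma inner_real_vec_real_vec_Ints: "real_vec k \<bullet> real_vec l \<in> \<int>"
  unfolding inner_vec_def by (rule Ints_sum) simp

text \<open>The frequency comes first, so that \<open>unit_char \<omega>\<close> is a whole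
  character of Z^d, the object to which \<open>characters_independent\<close> applies.\<close>

definition unit_char :: "real^'d \<Rightarrow> int^'d \<Rightarrow> complex" where
  "unit_char \<omega> n = cis (2 * pi * (real_vec n \<bullet> \<omega>))"

lemma unit_char_add: "unit_char \<omega> (m + n) = unit_char \<omega> m * unit_char \<omega> n"
  by (simp add: unit_char_def real_vec_add inner_left_distrib distrib_left cis_mult)

lemma unit_char_0 [simp]: "unit_char \<omega> 0 = 1"
  by (simp add: unit_char_def)

lemma unit_char_add_left: "unit_char (\<omega> + \<eta>) n = unit_char \<omega> n * unit_char \<eta> n"
  by (simp add: unit_char_def inner_right_distrib distrib_left cis_mult)

lemma unit_char_real_vec [simp]: "unit_char (real_vec k) n = 1"
  unfolding unit_char_def by (rule cis_multiple_2pi) (rule inner_real_vec_real_vec_Ints)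

lemma unit_char_frac_vec [simp]: "unit_char (frac_vec x) n = unit_char x n"
  by (metis diff_add_cancel frac_vec_eq mult.right_neutral unit_char_add_left unit_char_real_vec)

lemma unit_char_eq_1_imp_Ints:
  assumes "unit_char \<omega> n = 1" shows "real_vec n \<bullet> \<omega> \<in> \<int>"
proof -
  have "cos (2 * pi * (real_vec n \<bullet> \<omega>)) = 1"
    using assms by (metis cis.sel(1) one_complex.sel(1) unit_char_def)
  then obtain k :: int where "2 * pi * (real_vec n \<bullet> \<omega>) = real_of_int k * (2 * pi)"
    using cos_one_2pi_int by (metis mult.assoc)
  then show ?thesis by simp
qed

text \<open>Evaluation at the unit vectors shows that each coordinate of the difference of the
  frequencies is an integer, and it lies strictly between -1 and 1.\<close>

lemma unit_char_inject:
  assumes "\<omega> \<in> unit_cube" "\<eta> \<in> unit_cube" "unit_char \<omega> = unit_char \<eta>"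
  shows "\<omega> = \<eta>"
proof -
  have "\<omega> $ i = \<eta> $ i" for i
  proof -
    have "unit_char (\<omega> - \<eta>) n = 1" for n
    proof -
      have "unit_char \<omega> n = unit_char (\<omega> - \<eta>) n * unit_char \<eta> n"
        using unit_char_add_left[of "\<omega> - \<eta>" \<eta> n] by simp
      moreover have "unit_char \<eta> n \<noteq> 0" by (simp add: unit_char_def)
      ultimately show ?thesis using assms(3) by simp
    qed
    then have "real_vec (axis i 1) \<bullet> (\<omega> - \<eta>) \<in> \<int>" by (rule unit_char_eq_1_imp_Ints)
    then obtain k :: int where k: "\<omega> $ i - \<eta> $ i = real_of_int k"
      by (auto simp: real_vec_axis inner_axis' elim: Ints_cases)
    note k
    moreover have "0 \<le> \<omega> $ i" "\<omega> $ i < 1" "0 \<le> \<eta> $ i" "\<eta> $ i < 1"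
      using assms(1,2) by (auto simp: unit_cube_def)
    ultimately have "real_of_int k < 1" "-1 < real_of_int k" by linarith+
    then have "k = 0" by linarith
    then show ?thesis using k by simp
  qed
  then show ?thesis by (simp add: vec_eq_iff)
qed

text \<open>Integrality of M^T \<omega> replaces the image under the inverse matrix. In this form it
  is visible that the set is closed under addition modulo Z^d.\<close>

lemma freq_set_iff:
  assumes "det M \<noteq> 0"
  shows "\<omega> \<in> freq_set M \<longleftrightarrow>
    \<omega> \<in> unit_cube \<and> (\<exists>q. transpose (map_matrix real_of_int M) *v \<omega> = real_vec q)"
proof -
  have "invertible (map_matrix real_of_int (transpose M))"
    by (rule invertible_map_matrix_real_of_int) (simp add: det_transpose assms)
  note inv = matrix_inv_mult_vec[OF this]
  have eq: "freq_set M = range (\<lambda>k. matrix_inv (map_matrix real_of_int (transpose M)) *v real_vec k) \<inter> unit_cube"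
    by (simp add: freq_set_def unit_cube_def transpose_map_matrix)
  show ?thesis
    unfolding eq transpose_map_matrix
  proof (intro iffI; elim conjE exE IntE)
    fix q assume "\<omega> \<in> unit_cube" and q: "map_matrix real_of_int (transpose M) *v \<omega> = real_vec q"
    then show "\<omega> \<in> range (\<lambda>k. matrix_inv (map_matrix real_of_int (transpose M)) *v real_vec k) \<inter> unit_cube"
      using inv(1)[of \<omega>] by (auto simp: image_iff q intro!: exI[of _ q])
  next
    assume "\<omega> \<in> unit_cube" "\<omega> \<in> range (\<lambda>k. matrix_inv (map_matrix real_of_int (transpose M)) *v real_vec k)"
    then show "\<omega> \<in> unit_cube \<and> (\<exists>q. map_matrix real_of_int (transpose M) *v \<omega> = real_vec q)"
      by (auto simp: inv)
  qed
qed

lemma zero_in_freq_set: "0 \<in> freq_set M"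
  unfolding freq_set_def by (auto intro!: image_eqI[of _ _ 0])

lemma freq_set_subset_unit_cube: "freq_set M \<subseteq> unit_cube"
  by (auto simp: freq_set_def unit_cube_def)

text \<open>The injective map k to M^(-T) k sends the integer points of M^T [0,1)^d onto the set,
  and \<open>card_lattice_points\<close> counts those for the transpose, which has the same
  determinant.\<close>

lemma freq_set_card:
  assumes "det M \<noteq> 0"
  shows "finite (freq_set M)" "card (freq_set M) = nat \<bar>det M\<bar>"
proof -
  let ?B = "map_matrix real_of_int (transpose M)"
  have det: "det (transpose M) \<noteq> 0" by (simp add: det_transpose assms)
  have eq: "freq_set M = (\<lambda>k. matrix_inv ?B *v real_vec k) ` {k. matrix_inv ?B *v real_vec k \<in> unit_cube}"
    by (auto simp: freq_set_def unit_cube_def transpose_map_matrix)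
  have "inj (\<lambda>k. matrix_inv ?B *v real_vec k)"
  proof (rule injI)
    fix k l assume "matrix_inv ?B *v real_vec k = matrix_inv ?B *v real_vec l"
    then have "?B *v (matrix_inv ?B *v real_vec k) = ?B *v (matrix_inv ?B *v real_vec l)" by simp
    then show "k = l"
      unfolding matrix_inv_mult_vec(2)[OF invertible_map_matrix_real_of_int[OF det]] by simp
  qed
  then have inj: "inj_on (\<lambda>k. matrix_inv ?B *v real_vec k) S" for S
    using inj_on_subset by blast
  show "finite (freq_set M)" "card (freq_set M) = nat \<bar>det M\<bar>"
    using card_lattice_points[OF det] by (simp_all add: eq card_image[OF inj] det_transpose)
qed

text \<open>Orthogonality of characters: the frequencies represent the character group of Z^d / M
  Z^d. On M Z^d every term is 1. Off it some frequency has a nontrivial value at n, and translating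
  the sum by that frequency forces it to vanish.\<close>

lemma sum_unit_char_freq_set:
  fixes M :: "int^'d^'d"
  assumes det: "det M \<noteq> 0"
  shows "(\<Sum>\<omega>\<in>freq_set M. unit_char \<omega> n) = (if n \<in> range ((*v) M) then of_int \<bar>det M\<bar> else 0)"
proof (cases "n \<in> range ((*v) M)")
  case True
  then obtain k where k: "n = M *v k" by blast
  have "unit_char \<omega> n = 1" if om: "\<omega> \<in> freq_set M" for \<omega>
  proof -
    obtain q where q: "transpose (map_matrix real_of_int M) *v \<omega> = real_vec q"
      using om unfolding freq_set_iff[OF det] by blast
    show ?thesis
      unfolding unit_char_def k real_vec_matrix_mult inner_matrix_vector_mult q
      by (rule cis_multiple_2pi) (rule inner_real_vec_real_vec_Ints)
  qed
  then show ?thesis using True freq_set_card[OF det] by simp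
next
  case False
  let ?R = "map_matrix real_of_int M"
  have inv: "invertible ?R" "invertible (transpose ?R)"
    using invertible_map_matrix_real_of_int[of M] invertible_map_matrix_real_of_int[of "transpose M"] det
    by (simp_all add: det_transpose transpose_map_matrix)
  note [simp del] = transpose_matrix_vector
  note [simp] = matrix_inv_mult_vec[OF inv(1)] matrix_inv_mult_vec[OF inv(2)]
  \<comment> \<open>If all dual frequencies paired integrally with n, then pairing with M^(-T) e_i
    would make every coordinate of M^(-1) n an integer, putting n into M Z^d.\<close>
  have "\<exists>\<eta> q. transpose ?R *v \<eta> = real_vec q \<and> real_vec n \<bullet> \<eta> \<notin> \<int>"
  proof (rule ccontr)
    assume none: "\<nexists>\<eta> q. transpose ?R *v \<eta> = real_vec q \<and> real_vec n \<bullet> \<eta> \<notin> \<int>"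
    then have int: "real_vec n \<bullet> \<eta> \<in> \<int>" if "transpose ?R *v \<eta> = real_vec q" for \<eta> q
      using that none by blast
    define y where "y = matrix_inv ?R *v real_vec n"
    have "y $ i \<in> \<int>" for i
    proof -
      have "y $ i = (?R *v y) \<bullet> (matrix_inv (transpose ?R) *v axis i 1)"
        unfolding inner_matrix_vector_mult by (simp add: inner_axis)
      also have "\<dots> \<in> \<int>" unfolding y_def
        by simp (rule int[of _ "axis i 1"], simp add: real_vec_axis)
      finally show ?thesis .
    qed
    then have "real_vec (floor_vec y) = y"
      by (simp add: vec_eq_iff floor_vec_def)
    then have "real_vec n = real_vec (M *v floor_vec y)"
      unfolding real_vec_matrix_mult by (simp add: y_def)
    then show False using False by simp
  qed
  then obtain \<eta> q where q: "transpose ?R *v \<eta> = real_vec q" and nInt: "real_vec n \<bullet> \<eta> \<notin> \<int>"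
    by blast
  have mem: "frac_vec (\<omega> + \<zeta>) \<in> freq_set M"
    if \<omega>: "\<omega> \<in> freq_set M" and l: "transpose ?R *v \<zeta> = real_vec l" for \<omega> \<zeta> l
  proof -
    obtain p where p: "transpose ?R *v \<omega> = real_vec p" using \<omega> unfolding freq_set_iff[OF det] by blast
    have "transpose ?R *v frac_vec (\<omega> + \<zeta>) = real_vec (p + l - transpose M *v floor_vec (\<omega> + \<zeta>))"
      unfolding frac_vec_eq
      by (simp add: matrix_vector_mult_diff_distrib matrix_vector_right_distrib p l real_vec_add real_vec_diff real_vec_matrix_mult transpose_map_matrix[symmetric])
    then show ?thesis unfolding freq_set_iff[OF det] using frac_vec_in_unit_cube by blast
  qed
  have undo: "frac_vec (frac_vec (\<omega> + \<zeta>) - \<zeta>) = \<omega>" if "\<omega> \<in> freq_set M" for \<omega> \<zeta>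
  proof -
    have "frac_vec \<omega> = \<omega>" using that freq_set_subset_unit_cube[of M] by (intro frac_vec_id) blast
    then show ?thesis using frac_vec_add_frac_vec[of "\<omega> + \<zeta>" "- \<zeta>"] by simp
  qed
  have q': "transpose ?R *v (- \<eta>) = real_vec (- q)"
    using matrix_vector_mult_diff_distrib[of "transpose ?R" 0 \<eta>] q real_vec_diff[of 0 q] by simp
  \<comment> \<open>Translation by \<open>\<eta>\<close>, reduced modulo Z^d, permutes the
    frequencies and multiplies the sum by \<open>unit_char \<eta> n\<close>, which is not 1.\<close>
  have bij: "bij_betw (\<lambda>\<omega>. frac_vec (\<omega> + \<eta>)) (freq_set M) (freq_set M)"
  proof (rule bij_betw_byWitness[where f' = "\<lambda>\<omega>. frac_vec (\<omega> - \<eta>)"])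
    show "\<forall>\<omega>\<in>freq_set M. frac_vec (frac_vec (\<omega> + \<eta>) - \<eta>) = \<omega>" using undo by blast
    show "\<forall>\<omega>\<in>freq_set M. frac_vec (frac_vec (\<omega> - \<eta>) + \<eta>) = \<omega>" using undo[of _ "- \<eta>"] by simp
    show "(\<lambda>\<omega>. frac_vec (\<omega> + \<eta>)) ` freq_set M \<subseteq> freq_set M" using mem[OF _ q] by blast
    show "(\<lambda>\<omega>. frac_vec (\<omega> - \<eta>)) ` freq_set M \<subseteq> freq_set M" using mem[OF _ q'] by auto
  qed
  have "(\<Sum>\<omega>\<in>freq_set M. unit_char \<omega> n) = (\<Sum>\<omega>\<in>freq_set M. unit_char (frac_vec (\<omega> + \<eta>)) n)"
    by (rule sum.reindex_bij_betw[OF bij, symmetric])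
  also have "\<dots> = (\<Sum>\<omega>\<in>freq_set M. unit_char \<omega> n) * unit_char \<eta> n"
    by (simp add: unit_char_add_left sum_distrib_right)
  finally have "(\<Sum>\<omega>\<in>freq_set M. unit_char \<omega> n) * (1 - unit_char \<eta> n) = 0"
    by (simp add: algebra_simps)
  moreover have "unit_char \<eta> n \<noteq> 1" using nInt unit_char_eq_1_imp_Ints by blast
  ultimately show ?thesis using False by simp
qed

subsection \<open>Matrix algebra\<close>

lemma bounded_bilinear_matrix_mult:
  "bounded_bilinear ((**) :: complex^'b^'a \<Rightarrow> complex^'c^'b \<Rightarrow> complex^'c^'a)"
  unfolding bilinear_conv_bounded_bilinear[symmetric] bilinear_def
  by (auto intro!: linearI simp: vec_eq_iff matrix_matrix_mult_def sum.distrib scaleR_sum_right algebra_simps)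

interpretation mm: bounded_bilinear "(**) :: complex^'b^'a \<Rightarrow> complex^'c^'b \<Rightarrow> complex^'c^'a"
  by (rule bounded_bilinear_matrix_mult)

lemma bounded_linear_conj_transpose:
  "bounded_linear (conj_transpose :: complex^'q^'p \<Rightarrow> complex^'p^'q)"
  unfolding linear_conv_bounded_linear[symmetric]
  by (rule linearI) (auto simp: vec_eq_iff conj_transpose_def transpose_def map_matrix_def)

lemmas conj_transpose_0 [simp] = linear_0[OF bounded_linear.linear[OF bounded_linear_conj_transpose]]
  and conj_transpose_add = linear_add[OF bounded_linear.linear[OF bounded_linear_conj_transpose]]
  and conj_transpose_sum = linear_sum[OF bounded_linear.linear[OF bounded_linear_conj_transpose]]
  and conj_transpose_scaleR = linear_scale[OF bounded_linear.linear[OF bounded_linear_conj_transpose]]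

lemma conj_transpose_nth [simp]: "conj_transpose A $ i $ j = cnj (A $ j $ i)"
  by (simp add: conj_transpose_def transpose_def map_matrix_def)

lemma conj_transpose_conj_transpose [simp]: "conj_transpose (conj_transpose A) = A"
  by (simp add: vec_eq_iff)

lemma conj_transpose_mult: "conj_transpose (A ** B) = conj_transpose B ** conj_transpose A"
  by (simp add: vec_eq_iff matrix_matrix_mult_def mult.commute)

lemma conj_transpose_mat_1 [simp]: "conj_transpose (mat 1) = mat 1"
  by (simp add: vec_eq_iff mat_def)

text \<open>The bridge from the matrix-valued inner product to the Frobenius norm: definiteness of
  \<open>seq_inner\<close> is read off from the trace.\<close>

lemma trace_mult_conj_transpose:
  "trace (A ** conj_transpose A) = complex_of_real ((norm A)\<^sup>2)" for A :: "complex^'q^'p"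
  by (simp add: trace_def matrix_matrix_mult_def norm_vec_def L2_set_def sum_nonneg complex_norm_square
      del: of_real_power)

subsection \<open>Square-summable sequences\<close>

lemma l2_seqsI_bounded_linear:
  assumes "u \<in> l2_seqs" "bounded_linear T"
  shows "(\<lambda>k. T (u k)) \<in> l2_seqs"
proof -
  obtain K where K: "\<And>x. norm (T x) \<le> norm x * K"
    using bounded_linear.bounded[OF assms(2)] by blast
  have "(\<lambda>k. (norm (u k))\<^sup>2 * K\<^sup>2) summable_on UNIV"
    using assms(1) by (intro summable_on_cmult_left) (simp add: l2_seqs_def)
  moreover have "(norm (T (u k)))\<^sup>2 \<le> (norm (u k))\<^sup>2 * K\<^sup>2" for k
    using power_mono[OF K[of "u k"], where n = 2] by (simp add: power_mult_distrib)
  ultimately show ?thesis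
    unfolding l2_seqs_def by (auto intro: summable_on_comparison_test)
qed

lemma l2_normsq_bounded_linear_le:
  assumes "u \<in> l2_seqs" "\<And>x. norm (T x) \<le> norm x * K" "bounded_linear T"
  shows "l2_normsq (\<lambda>k. T (u k)) \<le> K\<^sup>2 * l2_normsq u"
proof -
  have le: "(norm (T (u k)))\<^sup>2 \<le> K\<^sup>2 * (norm (u k))\<^sup>2" for k
    using power_mono[OF assms(2)[of "u k"], where n = 2] by (simp add: power_mult_distrib mult.commute)
  have "l2_normsq (\<lambda>k. T (u k)) \<le> (\<Sum>\<^sub>\<infinity>k. K\<^sup>2 * (norm (u k))\<^sup>2)"
    unfolding l2_normsq_def using l2_seqsI_bounded_linear[OF assms(1,3)] assms(1) le
    by (intro infsum_mono summable_on_cmult_right) (auto simp: l2_seqs_def)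
  also have "\<dots> = K\<^sup>2 * l2_normsq u"
    unfolding l2_normsq_def by (rule infsum_cmult_right')
  finally show ?thesis .
qed

lemma norm_add_sq_le: "(norm (x + y))\<^sup>2 \<le> 2 * (norm x)\<^sup>2 + 2 * (norm y)\<^sup>2"
  for x y :: "'a::real_normed_vector"
proof -
  have "(norm (x + y))\<^sup>2 \<le> (norm x + norm y)\<^sup>2" by (intro power_mono norm_triangle_ineq) simp
  also have "\<dots> \<le> 2 * (norm x)\<^sup>2 + 2 * (norm y)\<^sup>2"
    using sum_squares_bound[of "norm x" "norm y"] by (simp add: power2_sum)
  finally show ?thesis .
qed

lemma l2_add:
  assumes "u \<in> l2_seqs" "v \<in> l2_seqs"
  shows "(\<lambda>k. u k + v k) \<in> l2_seqs" "l2_normsq (\<lambda>k. u k + v k) \<le> 2 * l2_normsq u + 2 * l2_normsq v"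
proof -
  have s: "(\<lambda>k. 2 * (norm (u k))\<^sup>2) summable_on UNIV" "(\<lambda>k. 2 * (norm (v k))\<^sup>2) summable_on UNIV"
    using assms by (auto simp: l2_seqs_def intro: summable_on_cmult_right)
  show l2: "(\<lambda>k. u k + v k) \<in> l2_seqs"
    unfolding l2_seqs_def mem_Collect_eq
    by (rule summable_on_comparison_test[OF summable_on_add[OF s]]) (auto simp: norm_add_sq_le)
  have "l2_normsq (\<lambda>k. u k + v k) \<le> (\<Sum>\<^sub>\<infinity>k. 2 * (norm (u k))\<^sup>2 + 2 * (norm (v k))\<^sup>2)"
    unfolding l2_normsq_def using l2 norm_add_sq_le
    by (intro infsum_mono summable_on_add s) (auto simp: l2_seqs_def)
  also have "\<dots> = 2 * l2_normsq u + 2 * l2_normsq v"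
    by (simp add: infsum_add[OF s] l2_normsq_def infsum_cmult_right')
  finally show "l2_normsq (\<lambda>k. u k + v k) \<le> 2 * l2_normsq u + 2 * l2_normsq v" .
qed

lemma l2_normsq_nonneg [simp]: "0 \<le> l2_normsq u"
  unfolding l2_normsq_def by (rule infsum_nonneg) simp

lemma l0_subset_l2: "u \<in> l0_seqs \<Longrightarrow> u \<in> l2_seqs"
  unfolding l0_seqs_def l2_seqs_def
  by (auto intro: finite_nonzero_values_imp_summable_on)

lemma l0_zero [simp]: "(\<lambda>k. 0) \<in> l0_seqs"
  by (simp add: l0_seqs_def)

lemma l2_zero [simp]: "(\<lambda>k. 0) \<in> l2_seqs"
  by (simp add: l0_subset_l2)

lemma l2_sum: "(\<And>j. j \<in> F \<Longrightarrow> u j \<in> l2_seqs) \<Longrightarrow> (\<lambda>k. \<Sum>j\<in>F. u j k) \<in> l2_seqs"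
proof (induction F rule: infinite_finite_induct)
  case (insert x F)
  then show ?case using l2_add(1)[of "u x" "\<lambda>k. \<Sum>j\<in>F. u j k"] by simp
qed simp_all

lemma l2_diff: "u \<in> l2_seqs \<Longrightarrow> v \<in> l2_seqs \<Longrightarrow> (\<lambda>k. u k - v k) \<in> l2_seqs"
  using l2_add(1)[of u "\<lambda>k. - v k"] l2_seqsI_bounded_linear[of v uminus]
  by (simp add: bounded_linear_minus[OF bounded_linear_ident])

lemma l2_scaleR: "u \<in> l2_seqs \<Longrightarrow> (\<lambda>k. c *\<^sub>R u k) \<in> l2_seqs"
  by (rule l2_seqsI_bounded_linear[where T = "\<lambda>x. c *\<^sub>R x"]) (auto intro: bounded_linear_scaleR_right)

lemma l2_reindex: "u \<in> l2_seqs \<Longrightarrow> inj h \<Longrightarrow> (\<lambda>k. u (h k)) \<in> l2_seqs"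
  unfolding l2_seqs_def
  using summable_on_reindex[of h UNIV "\<lambda>k. (norm (u k))\<^sup>2"] summable_on_subset_banach[of _ UNIV "range h"]
  by (auto simp: o_def)

text \<open>Absolute convergence comes from |ab| \<le> |a|^2 + |b|^2. It is what makes
  \<open>seq_inner\<close> additive, as \<open>infsum\<close> would otherwise fall back on its
  default value.\<close>

lemma l2_product_summable:
  fixes u :: "int^'d \<Rightarrow> complex^'r^'t" and v :: "int^'d \<Rightarrow> complex^'r^'p"
  assumes "u \<in> l2_seqs" "v \<in> l2_seqs"
  shows "(\<lambda>k. u k ** conj_transpose (v k)) summable_on UNIV"
proof (rule abs_summable_summable)
  obtain K where K: "0 < K"
    and le: "\<And>a b. norm ((a::complex^'r^'t) ** (b::complex^'p^'r)) \<le> norm a * norm b * K"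
    using mm.pos_bounded by blast
  have v': "(\<lambda>k. conj_transpose (v k)) \<in> l2_seqs"
    by (rule l2_seqsI_bounded_linear[OF assms(2) bounded_linear_conj_transpose])
  have "(\<lambda>k. ((norm (u k))\<^sup>2 + (norm (conj_transpose (v k)))\<^sup>2) * K) summable_on UNIV"
    using assms(1) v' by (intro summable_on_cmult_left summable_on_add) (auto simp: l2_seqs_def)
  then show "(\<lambda>k. norm (u k ** conj_transpose (v k))) summable_on UNIV"
  proof (rule summable_on_comparison_test)
    fix k
    let ?a = "norm (u k)" and ?b = "norm (conj_transpose (v k))"
    have "?a * ?b \<le> ?a\<^sup>2 + ?b\<^sup>2"
      using sum_squares_bound[of ?a ?b] mult_nonneg_nonneg[OF norm_ge_zero[of "u k"] norm_ge_zero[of "conj_transpose (v k)"]]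
      by linarith
    then have "?a * ?b * K \<le> (?a\<^sup>2 + ?b\<^sup>2) * K" using K by simp
    then show "norm (u k ** conj_transpose (v k)) \<le> (?a\<^sup>2 + ?b\<^sup>2) * K"
      using le order_trans by blast
  qed simp
qed

lemma seq_inner_add_left:
  "u \<in> l2_seqs \<Longrightarrow> v \<in> l2_seqs \<Longrightarrow> w \<in> l2_seqs \<Longrightarrow>
    seq_inner (\<lambda>k. u k + v k) w = seq_inner u w + seq_inner v w"
  unfolding seq_inner_def mm.add_left by (rule infsum_add; rule l2_product_summable)

lemma seq_inner_zero_left [simp]: "seq_inner (\<lambda>k. 0) w = 0"
  by (simp add: seq_inner_def)

lemma seq_inner_zero_right [simp]: "seq_inner w (\<lambda>k. 0) = 0"
  by (simp add: seq_inner_def)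

lemma seq_inner_add_right:
  "u \<in> l2_seqs \<Longrightarrow> v \<in> l2_seqs \<Longrightarrow> w \<in> l2_seqs \<Longrightarrow>
    seq_inner w (\<lambda>k. u k + v k) = seq_inner w u + seq_inner w v"
  unfolding seq_inner_def conj_transpose_add mm.add_right by (rule infsum_add; rule l2_product_summable)

lemma seq_inner_sum_left:
  "(\<And>j. j \<in> F \<Longrightarrow> u j \<in> l2_seqs) \<Longrightarrow> w \<in> l2_seqs \<Longrightarrow>
    seq_inner (\<lambda>k. \<Sum>j\<in>F. u j k) w = (\<Sum>j\<in>F. seq_inner (u j) w)"
  by (induction F rule: infinite_finite_induct) (simp_all add: seq_inner_add_left l2_sum)

lemma seq_inner_sum_right:
  "(\<And>j. j \<in> F \<Longrightarrow> u j \<in> l2_seqs) \<Longrightarrow> w \<in> l2_seqs \<Longrightarrow>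
    seq_inner w (\<lambda>k. \<Sum>j\<in>F. u j k) = (\<Sum>j\<in>F. seq_inner w (u j))"
  by (induction F rule: infinite_finite_induct) (simp_all add: seq_inner_add_right l2_sum)

lemma seq_inner_diff_left:
  "u \<in> l2_seqs \<Longrightarrow> v \<in> l2_seqs \<Longrightarrow> w \<in> l2_seqs \<Longrightarrow>
    seq_inner (\<lambda>k. u k - v k) w = seq_inner u w - seq_inner v w"
  using seq_inner_add_left[of "\<lambda>k. u k - v k" v w] l2_diff[of u v] by simp

lemma seq_inner_scaleR:
  "seq_inner (\<lambda>k. a *\<^sub>R u k) (\<lambda>k. b *\<^sub>R v k) = (a * b) *\<^sub>R seq_inner u v"
  by (simp add: seq_inner_def conj_transpose_scaleR mm.scaleR_left mm.scaleR_right infsum_scaleR_right)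

lemma seq_inner_scaleR_left: "seq_inner (\<lambda>k. a *\<^sub>R u k) v = a *\<^sub>R seq_inner u v"
  using seq_inner_scaleR[of a u 1 v] by simp

lemma seq_inner_scaleR_right: "seq_inner u (\<lambda>k. a *\<^sub>R v k) = a *\<^sub>R seq_inner u v"
  using seq_inner_scaleR[of 1 u a v] by simp

lemma l2_normsq_eq_trace:
  fixes u :: "int^'d \<Rightarrow> complex^'r^'t"
  assumes "u \<in> l2_seqs"
  shows "trace (seq_inner u u) = complex_of_real (l2_normsq u)"
proof -
  have bl: "bounded_linear (trace :: complex^'t^'t \<Rightarrow> complex)"
    unfolding linear_conv_bounded_linear[symmetric]
    by (rule linearI) (auto simp: trace_def sum.distrib scaleR_sum_right)
  have "trace (seq_inner u u) = (\<Sum>\<^sub>\<infinity>k. trace (u k ** conj_transpose (u k)))"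
    unfolding seq_inner_def
    by (rule infsumI[symmetric])
      (rule has_sum_bounded_linear[OF bl has_sum_infsum[OF l2_product_summable[OF assms assms]]])
  also have "\<dots> = complex_of_real (l2_normsq u)"
    unfolding trace_mult_conj_transpose l2_normsq_def 
    by (rule infsumI, rule has_sum_bounded_linear[OF bounded_linear_of_real has_sum_infsum])
      (use assms in \<open>simp add: l2_seqs_def\<close>)
  finally show ?thesis .
qed

lemma norm_sq_le_l2_normsq: "u \<in> l2_seqs \<Longrightarrow> (norm (u k))\<^sup>2 \<le> l2_normsq u"
  unfolding l2_normsq_def using infsum_mono2[of "\<lambda>k. (norm (u k))\<^sup>2" "{k}" UNIV]
  by (simp add: l2_seqs_def)

lemma l2_normsq_eq_0_imp:
  assumes "u \<in> l2_seqs" "l2_normsq u = 0" shows "u k = 0"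
proof -
  show ?thesis using norm_sq_le_l2_normsq[OF assms(1), of k] assms(2) by simp
qed

text \<open>Testing with the difference u - v itself gives norm 0. This turns inner product
  identities such as (ii) and (iii) into equalities of sequences.\<close>

lemma l2_eqI:
  fixes u v :: "int^'d \<Rightarrow> complex^'r^'t"
  assumes "u \<in> l2_seqs" "v \<in> l2_seqs"
    and "\<And>w :: int^'d \<Rightarrow> complex^'r^'t. w \<in> l2_seqs \<Longrightarrow> seq_inner u w = seq_inner v w"
  shows "u = v"
proof
  fix k
  let ?w = "\<lambda>k. u k - v k"
  have w: "?w \<in> l2_seqs" using assms l2_diff by blast
  have "seq_inner ?w ?w = 0"
    using assms w by (subst seq_inner_diff_left) auto
  then have "l2_normsq ?w = 0"
    using l2_normsq_eq_trace[OF w] by (simp add: trace_def)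
  then show "u k = v k" using l2_normsq_eq_0_imp[OF w] by simp
qed

text \<open>\<open>conj_transpose\<close> is its own bounded linear inverse, so the two series
  converge together; if they diverge, both \<open>infsum\<close> values are 0.\<close>

lemma conj_transpose_seq_inner: "conj_transpose (seq_inner u v) = seq_inner v u"
proof -
  have "conj_transpose (seq_inner u v) = (\<Sum>\<^sub>\<infinity>k. conj_transpose (u k ** conj_transpose (v k)))"
    unfolding seq_inner_def
    by (rule infsum_bounded_linear_strong[OF _ bounded_linear_conj_transpose, symmetric])
      (rule summable_on_bounded_linear_iff[OF bounded_linear_conj_transpose bounded_linear_conj_transpose], simp)
  then show ?thesis by (simp add: seq_inner_def conj_transpose_mult)
qed

text \<open>The common form of upsampling and of cutting off finitely many terms: v repeats values
  of u, each at most once, and is 0 elsewhere.\<close>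

lemma l2_normsq_reindex_le:
  fixes u :: "int^'d \<Rightarrow> complex^'r^'t" and h :: "int^'d \<Rightarrow> int^'d"
  assumes u: "u \<in> l2_seqs" and h: "inj_on h A" and 0: "\<And>k. k \<notin> A \<Longrightarrow> v k = 0" and v: "\<And>k. k \<in> A \<Longrightarrow> v k = u (h k)"
  shows "v \<in> l2_seqs" "l2_normsq v \<le> l2_normsq u"
proof -
  have s: "(\<lambda>k. (norm (u k))\<^sup>2) summable_on h ` A"
    by (rule summable_on_subset_banach[of _ UNIV]) (use u in \<open>auto simp: l2_seqs_def\<close>)
  then have "(\<lambda>k. (norm (u (h k)))\<^sup>2) summable_on A"
    using summable_on_reindex[OF h, of "\<lambda>k. (norm (u k))\<^sup>2"] by (simp add: o_def)
  then show "v \<in> l2_seqs"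
    unfolding l2_seqs_def mem_Collect_eq using v 0
    by (subst summable_on_cong_neutral[where T = A and g = "\<lambda>k. (norm (u (h k)))\<^sup>2"]) auto
  have "l2_normsq v = (\<Sum>\<^sub>\<infinity>k\<in>A. (norm (u (h k)))\<^sup>2)"
    unfolding l2_normsq_def using v 0 by (intro infsum_cong_neutral) auto
  also have "\<dots> = (\<Sum>\<^sub>\<infinity>k\<in>h ` A. (norm (u k))\<^sup>2)"
    by (subst infsum_reindex[OF h]) (simp add: o_def)
  also have "\<dots> \<le> l2_normsq u"
    unfolding l2_normsq_def using u s by (intro infsum_mono2) (auto simp: l2_seqs_def)
  finally show "l2_normsq v \<le> l2_normsq u" .
qed

subsection \<open>Analysis and synthesis with a finitely supported filter\<close>

definition seq_support :: "(int^'d \<Rightarrow> complex^'q^'p) \<Rightarrow> (int^'d) set" where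
  "seq_support g = {k. g k \<noteq> 0}"

lemma finite_seq_support [simp]: "g \<in> l0_seqs \<Longrightarrow> finite (seq_support g)"
  by (simp add: l0_seqs_def seq_support_def)

lemma not_in_seq_support: "k \<notin> seq_support g \<Longrightarrow> g k = 0"
  by (simp add: seq_support_def)

text \<open>\<open>transition_op\<close> without its normalising factor, after the substitution n =
  N k + j, so that the sum is finite for any v.\<close>

definition analysis ::
    "(int^'d \<Rightarrow> complex^'r^'p) \<Rightarrow> int^'d^'d \<Rightarrow> (int^'d \<Rightarrow> complex^'r^'t) \<Rightarrow> int^'d \<Rightarrow> complex^'p^'t" where
  "analysis g N v k = (\<Sum>j\<in>seq_support g. v (N *v k + j) ** conj_transpose (g j))"

definition upsample :: "int^'d^'d \<Rightarrow> (int^'d \<Rightarrow> complex^'r^'t) \<Rightarrow> int^'d \<Rightarrow> complex^'r^'t" where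
  "upsample N c n = (if n \<in> range ((*v) N) then c (inv ((*v) N) n) else 0)"

text \<open>The adjoint of \<open>analysis\<close>, that is, the sum over k of c(k) g(n - N k).
  Indexing by the support of g makes it a finite sum with an index set independent of n.\<close>

definition synthesis ::
    "(int^'d \<Rightarrow> complex^'r^'p) \<Rightarrow> int^'d^'d \<Rightarrow> (int^'d \<Rightarrow> complex^'p^'t) \<Rightarrow> int^'d \<Rightarrow> complex^'r^'t" where
  "synthesis g N c n = (\<Sum>j\<in>seq_support g. upsample N c (n - j) ** g j)"

lemma analysis_superset:
  assumes "finite F" "seq_support g \<subseteq> F"
  shows "analysis g N v k = (\<Sum>j\<in>F. v (N *v k + j) ** conj_transpose (g j))"
  unfolding analysis_def using assms
  by (intro sum.mono_neutral_left) (auto simp: not_in_seq_support)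

lemma seq_inner_shift:
  assumes "g \<in> l0_seqs"
  shows "seq_inner v (\<lambda>n. g (n - N *v k)) = analysis g N v k"
proof -
  have "seq_inner v (\<lambda>n. g (n - N *v k)) = (\<Sum>\<^sub>\<infinity>n\<in>(+) (N *v k) ` seq_support g. v n ** conj_transpose (g (n - N *v k)))"
    unfolding seq_inner_def
  proof (rule infsum_cong_neutral)
    fix n assume "n \<in> UNIV - (+) (N *v k) ` seq_support g"
    then have "n - N *v k \<notin> seq_support g" by (force simp: image_iff)
    then show "v n ** conj_transpose (g (n - N *v k)) = 0" by (simp add: not_in_seq_support)
  qed auto
  also have "\<dots> = analysis g N v k"
    using assms by (simp add: analysis_def sum.reindex)
  finally show ?thesis .
qed

lemma transition_op_eq_analysis:
  assumes "b \<in> l0_seqs"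
  shows "transition_op b M u n = sqrt (real_of_int \<bar>det M\<bar>) *\<^sub>R analysis b M u n"
  using seq_inner_shift[OF assms, of u M n]
  by (simp add: transition_op_def seq_inner_def powr_half_sqrt)

lemma upsample_image: "inj ((*v) N) \<Longrightarrow> upsample N c (N *v k) = c k"
  by (simp add: upsample_def)

lemma inj_mult_int_matrix:
  fixes N :: "int^'d^'d"
  assumes "det N \<noteq> 0" shows "inj ((*v) N)"
proof (rule injI)
  fix k l assume "N *v k = N *v l"
  then have "map_matrix real_of_int N *v real_vec k = map_matrix real_of_int N *v real_vec l"
    by (simp flip: real_vec_matrix_mult)
  then show "k = l"
    using matrix_inv_mult_vec(1)[OF invertible_map_matrix_real_of_int[OF assms]] by (metis real_vec_eq_iff)
qed

lemma upsample_l2: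
  fixes c :: "int^'d \<Rightarrow> complex^'r^'t"
  assumes "c \<in> l2_seqs" "inj ((*v) N)"
  shows "(\<lambda>n. upsample N c (n - j)) \<in> l2_seqs" "l2_normsq (\<lambda>n. upsample N c (n - j)) \<le> l2_normsq c"
proof -
  let ?A = "{n. n - j \<in> range ((*v) N)}"
  have inj: "inj_on (\<lambda>n. inv ((*v) N) (n - j)) ?A"
    by (rule inj_onI) (metis (mono_tags, lifting) add_diff_cancel_left' diff_add_cancel f_inv_into_f mem_Collect_eq)
  show "(\<lambda>n. upsample N c (n - j)) \<in> l2_seqs" "l2_normsq (\<lambda>n. upsample N c (n - j)) \<le> l2_normsq c"
    by (rule l2_normsq_reindex_le[OF assms(1) inj]; simp add: upsample_def)+
qed

lemma analysis_l2:
  fixes v :: "int^'d \<Rightarrow> complex^'r^'t"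
  assumes "v \<in> l2_seqs" "inj ((*v) N)" shows "analysis g N v \<in> l2_seqs"
proof -
  have "(\<lambda>k. v (N *v k + j) ** conj_transpose (g j)) \<in> l2_seqs" for j
  proof (rule l2_seqsI_bounded_linear[OF _ mm.bounded_linear_left])
    have "inj (\<lambda>k. N *v k + j)" using assms(2) by (simp add: inj_def)
    then show "(\<lambda>k. v (N *v k + j)) \<in> l2_seqs" by (rule l2_reindex[OF assms(1)])
  qed
  then show ?thesis unfolding analysis_def[abs_def] by (intro l2_sum)
qed

lemma synthesis_l2:
  fixes c :: "int^'d \<Rightarrow> complex^'p^'t"
  assumes "c \<in> l2_seqs" "inj ((*v) N)" shows "synthesis g N c \<in> l2_seqs"
  unfolding synthesis_def[abs_def]
  by (intro l2_sum l2_seqsI_bounded_linear[OF _ mm.bounded_linear_left] upsample_l2 assms)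

text \<open>Each tap of the filter relocates the entries of c injectively and multiplies them by a
  fixed matrix. Adding the taps one by one gives a constant that depends on g and N alone, so it can
  be applied uniformly to all tails of c.\<close>

lemma synthesis_bound:
  fixes g :: "int^'d \<Rightarrow> complex^'r^'p" and N
  assumes "g \<in> l0_seqs" "inj ((*v) N)"
  shows "\<exists>C. \<forall>c :: int^'d \<Rightarrow> complex^'p^'t. c \<in> l2_seqs \<longrightarrow> l2_normsq (synthesis g N c) \<le> C * l2_normsq c"
proof -
  have "\<exists>C. \<forall>c :: int^'d \<Rightarrow> complex^'p^'t. c \<in> l2_seqs \<longrightarrow>
      l2_normsq (\<lambda>n. \<Sum>j\<in>F. upsample N c (n - j) ** g j) \<le> C * l2_normsq c" if "finite F" for F
    using that
  proof induction
    case empty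
    show ?case by (rule exI[of _ 0]) (simp add: l2_normsq_def)
  next
    case (insert x F)
    then obtain C where C: "\<And>c :: int^'d \<Rightarrow> complex^'p^'t. c \<in> l2_seqs \<Longrightarrow>
      l2_normsq (\<lambda>n. \<Sum>j\<in>F. upsample N c (n - j) ** g j) \<le> C * l2_normsq c" by blast
    obtain K where K: "\<And>y :: complex^'p^'t. norm (y ** g x) \<le> norm y * K"
      using bounded_linear.bounded[OF mm.bounded_linear_left] by blast
    show ?case
    proof (intro exI[of _ "2 * K\<^sup>2 + 2 * C"] allI impI)
      fix c :: "int^'d \<Rightarrow> complex^'p^'t" assume c: "c \<in> l2_seqs"
      have up: "(\<lambda>n. upsample N c (n - j)) \<in> l2_seqs" for j by (rule upsample_l2[OF c assms(2)])
      have each: "(\<lambda>n. upsample N c (n - j) ** g j) \<in> l2_seqs" for j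
        by (rule l2_seqsI_bounded_linear[OF up mm.bounded_linear_left])
      have "l2_normsq (\<lambda>n. upsample N c (n - x) ** g x) \<le> K\<^sup>2 * l2_normsq (\<lambda>n. upsample N c (n - x))"
        by (rule l2_normsq_bounded_linear_le[OF up K mm.bounded_linear_left])
      also have "\<dots> \<le> K\<^sup>2 * l2_normsq c"
        by (intro mult_left_mono upsample_l2 c assms(2)) simp
      finally have 1: "l2_normsq (\<lambda>n. upsample N c (n - x) ** g x) \<le> K\<^sup>2 * l2_normsq c" .
      have "l2_normsq (\<lambda>n. \<Sum>j\<in>insert x F. upsample N c (n - j) ** g j)
          \<le> 2 * l2_normsq (\<lambda>n. upsample N c (n - x) ** g x) + 2 * l2_normsq (\<lambda>n. \<Sum>j\<in>F. upsample N c (n - j) ** g j)"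
        using l2_add(2)[OF each[of x] l2_sum[of F, OF each]] insert.hyps by simp
      also have "\<dots> \<le> 2 * (K\<^sup>2 * l2_normsq c) + 2 * (C * l2_normsq c)"
        using 1 C[OF c] by simp
      finally show "l2_normsq (\<lambda>n. \<Sum>j\<in>insert x F. upsample N c (n - j) ** g j) \<le> (2 * K\<^sup>2 + 2 * C) * l2_normsq c"
        by (simp add: algebra_simps)
    qed
  qed
  from this[OF finite_seq_support[OF assms(1)]] show ?thesis
    by (simp add: synthesis_def[abs_def])
qed

text \<open>Substitution j = n - N k. Any finite K that contains the relevant shifts is allowed, so
  that two sums can be compared over one index set.\<close>

lemma synthesis_eq_sum:
  assumes "inj ((*v) N)" "finite K" "\<And>k. n - N *v k \<in> seq_support g \<Longrightarrow> k \<in> K" and g: "g \<in> l0_seqs"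
  shows "synthesis g N c n = (\<Sum>k\<in>K. c k ** g (n - N *v k))"
proof -
  let ?J = "{j \<in> seq_support g. n - j \<in> range ((*v) N)}" and ?K = "{k \<in> K. n - N *v k \<in> seq_support g}"
  have "synthesis g N c n = (\<Sum>j\<in>?J. upsample N c (n - j) ** g j)"
    unfolding synthesis_def using g
    by (intro sum.mono_neutral_right) (auto simp: upsample_def)
  also have "\<dots> = (\<Sum>k\<in>?K. c k ** g (n - N *v k))"
  proof (rule sum.reindex_bij_witness[where i = "\<lambda>k. n - N *v k" and j = "\<lambda>j. inv ((*v) N) (n - j)"])
    fix j assume j: "j \<in> ?J"
    then obtain k where k: "n - j = N *v k" by blast
    then have inv: "inv ((*v) N) (n - j) = k" using assms(1) by simp
    have nk: "n - N *v k = j" using k by (simp add: algebra_simps)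
    show "n - N *v inv ((*v) N) (n - j) = j" by (simp add: inv nk)
    show "inv ((*v) N) (n - j) \<in> ?K" using j assms(3)[of k] by (simp add: inv nk)
    show "c (inv ((*v) N) (n - j)) ** g (n - N *v inv ((*v) N) (n - j)) = upsample N c (n - j) ** g j"
      by (simp add: k nk inv_f_f[OF assms(1)] upsample_image[OF assms(1)])
  qed (use assms(1) in auto)
  also have "\<dots> = (\<Sum>k\<in>K. c k ** g (n - N *v k))"
    using assms(2) by (intro sum.mono_neutral_left) (auto simp: not_in_seq_support)
  finally show ?thesis .
qed

lemma finite_synthesis_index:
  assumes "inj ((*v) N)" "g \<in> l0_seqs"
  shows "finite {k. n - N *v k \<in> seq_support g}"
proof (rule inj_on_finite)
  show "inj_on (\<lambda>k. n - N *v k) {k. n - N *v k \<in> seq_support g}"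
    using assms(1) by (auto simp: inj_on_def inj_def)
  show "(\<lambda>k. n - N *v k) ` {k. n - N *v k \<in> seq_support g} \<subseteq> seq_support g" by blast
qed (simp add: assms)

lemma synthesis_has_sum:
  assumes "inj ((*v) N)" "g \<in> l0_seqs"
  shows "((\<lambda>k. c k ** g (n - N *v k)) has_sum synthesis g N c n) UNIV"
proof (rule has_sum_finite_neutralI)
  let ?K = "{k. n - N *v k \<in> seq_support g}"
  show "finite ?K" by (rule finite_synthesis_index[OF assms])
  then show "synthesis g N c n = (\<Sum>k\<in>?K. c k ** g (n - N *v k))"
    using assms by (intro synthesis_eq_sum) auto
qed (auto simp: not_in_seq_support)

text \<open>Adjointness is checked tap by tap: upsampling kills the positions outside N Z^d + j, and
  n = N k + j reindexes the rest.\<close>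

lemma seq_inner_analysis:
  fixes c :: "int^'d \<Rightarrow> complex^'p^'t" and w :: "int^'d \<Rightarrow> complex^'r^'q"
  assumes "inj ((*v) N)" "g \<in> l0_seqs" "c \<in> l2_seqs" "w \<in> l2_seqs"
  shows "seq_inner c (analysis g N w) = seq_inner (synthesis g N c) w"
proof -
  have injj: "inj (\<lambda>k. N *v k + j)" for j using assms(1) by (simp add: inj_def)
  have l2a: "(\<lambda>k. w (N *v k + j) ** conj_transpose (g j)) \<in> l2_seqs" for j
    by (intro l2_seqsI_bounded_linear[OF _ mm.bounded_linear_left] l2_reindex[OF assms(4) injj])
  have l2s: "(\<lambda>n. upsample N c (n - j) ** g j) \<in> l2_seqs" for j
    by (intro l2_seqsI_bounded_linear[OF _ mm.bounded_linear_left] upsample_l2 assms)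
  have each: "seq_inner c (\<lambda>k. w (N *v k + j) ** conj_transpose (g j)) = seq_inner (\<lambda>n. upsample N c (n - j) ** g j) w" for j
  proof -
    have "seq_inner (\<lambda>n. upsample N c (n - j) ** g j) w
        = (\<Sum>\<^sub>\<infinity>n\<in>range (\<lambda>k. N *v k + j). upsample N c (n - j) ** g j ** conj_transpose (w n))"
      unfolding seq_inner_def
    proof (rule infsum_cong_neutral)
      fix n assume "n \<in> UNIV - range (\<lambda>k. N *v k + j)"
      then have "n - j \<notin> range ((*v) N)" by (force simp: image_iff algebra_simps)
      then show "upsample N c (n - j) ** g j ** conj_transpose (w n) = 0"
        by (simp add: upsample_def)
    qed auto
    also have "\<dots> = (\<Sum>\<^sub>\<infinity>k. c k ** g j ** conj_transpose (w (N *v k + j)))"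
      using assms(1) by (subst infsum_reindex[OF injj]) (simp add: o_def upsample_image)
    also have "\<dots> = seq_inner c (\<lambda>k. w (N *v k + j) ** conj_transpose (g j))"
      by (simp add: seq_inner_def conj_transpose_mult matrix_mul_assoc)
    finally show ?thesis ..
  qed
  show ?thesis
    unfolding analysis_def[abs_def] synthesis_def[abs_def]
    by (simp add: seq_inner_sum_left seq_inner_sum_right l2a l2s assms each)
qed

subsection \<open>Refinement of filters\<close>

text \<open>The time domain form of the product of the symbol of c at N^T \<xi> and the symbol of a
  at \<xi>, in this order; see \<open>fourier_refine\<close>.\<close>

definition refine ::
    "(int^'d \<Rightarrow> complex^'r^'q) \<Rightarrow> int^'d^'d \<Rightarrow> (int^'d \<Rightarrow> complex^'q^'p) \<Rightarrow> int^'d \<Rightarrow> complex^'r^'p" where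
  "refine a N c n = (\<Sum>m\<in>seq_support c. c m ** a (n - N *v m))"

lemma refine_support:
  "seq_support (refine a N c) \<subseteq> (\<lambda>(m, j). N *v m + j) ` (seq_support c \<times> seq_support a)"
proof
  fix n assume "n \<in> seq_support (refine a N c)"
  then obtain m where m: "m \<in> seq_support c" "c m ** a (n - N *v m) \<noteq> 0"
    unfolding seq_support_def refine_def by (metis (mono_tags, lifting) mem_Collect_eq sum.not_neutral_contains_not_neutral)
  then have "n - N *v m \<in> seq_support a" by (auto simp: seq_support_def)
  then show "n \<in> (\<lambda>(m, j). N *v m + j) ` (seq_support c \<times> seq_support a)"
    using m(1) by (force simp: image_iff)
qed

lemma refine_l0: "a \<in> l0_seqs \<Longrightarrow> c \<in> l0_seqs \<Longrightarrow> refine a N c \<in> l0_seqs"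
  using finite_subset[OF refine_support[of a N c]] by (simp add: l0_seqs_def seq_support_def)

text \<open>The reindexing n = N m + j is done once for an arbitrary family h of real-linear maps.
  Real linearity admits conjugation, so the lemma serves \<open>analysis_refine\<close> as well as
  \<open>fourier_refine\<close>.\<close>

lemma sum_refine:
  assumes a: "a \<in> l0_seqs" and c: "c \<in> l0_seqs" and lin: "\<And>n. linear (h n)"
    and F: "finite F" "(\<lambda>(m, j). N *v m + j) ` (seq_support c \<times> seq_support a) \<subseteq> F"
  shows "(\<Sum>n\<in>F. h n (refine a N c n)) = (\<Sum>m\<in>seq_support c. \<Sum>j\<in>seq_support a. h (N *v m + j) (c m ** a j))"
proof -
  have "(\<Sum>n\<in>F. h n (refine a N c n)) = (\<Sum>n\<in>F. \<Sum>m\<in>seq_support c. h n (c m ** a (n - N *v m)))"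
    unfolding refine_def by (simp add: linear_sum[OF lin])
  also have "\<dots> = (\<Sum>m\<in>seq_support c. \<Sum>n\<in>F. h n (c m ** a (n - N *v m)))"
    by (rule sum.swap)
  also have "\<dots> = (\<Sum>m\<in>seq_support c. \<Sum>j\<in>seq_support a. h (N *v m + j) (c m ** a j))"
  proof (rule sum.cong[OF refl])
    fix m assume m: "m \<in> seq_support c"
    let ?h = "\<lambda>n. h n (c m ** a (n - N *v m))"
    have "(\<Sum>n\<in>F. ?h n) = (\<Sum>n\<in>(+) (N *v m) ` seq_support a. ?h n)"
    proof (rule sum.mono_neutral_right[OF F(1)])
      show "(+) (N *v m) ` seq_support a \<subseteq> F" using m F(2) by force
      show "\<forall>n\<in>F - (+) (N *v m) ` seq_support a. ?h n = 0"
      proof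
        fix n assume "n \<in> F - (+) (N *v m) ` seq_support a"
        then have "n - N *v m \<notin> seq_support a" by (force simp: image_iff)
        then show "?h n = 0" by (simp add: not_in_seq_support linear_0[OF lin])
      qed
    qed
    also have "\<dots> = (\<Sum>j\<in>seq_support a. h (N *v m + j) (c m ** a j))"
      by (subst sum.reindex) (auto simp: o_def)
    finally show "(\<Sum>n\<in>F. ?h n) = \<dots>" .
  qed
  finally show ?thesis .
qed

text \<open>Conjugate transposition reverses the product c(m) a(j), so \<open>a\<close> acts on v
  first and \<open>c\<close> afterwards. This is the reason why iterated filters compute iterated
  transition operators.\<close>

lemma analysis_refine:
  assumes a: "a \<in> l0_seqs" and c: "c \<in> l0_seqs"
  shows "analysis (refine a N c) (N ** L) v k = analysis c L (analysis a N v) k"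
proof -
  let ?F = "(\<lambda>(m, j). N *v m + j) ` (seq_support c \<times> seq_support a)"
  have fin: "finite ?F" using a c by simp
  have lin: "linear (\<lambda>X. v ((N ** L) *v k + n) ** conj_transpose X)" for n
    by (rule linearI) (simp_all add: conj_transpose_add conj_transpose_scaleR mm.add_right mm.scaleR_right)
  have "analysis (refine a N c) (N ** L) v k
      = (\<Sum>n\<in>?F. v ((N ** L) *v k + n) ** conj_transpose (refine a N c n))"
    by (rule analysis_superset[OF fin refine_support])
  also have "\<dots> = (\<Sum>m\<in>seq_support c. \<Sum>j\<in>seq_support a.
      v ((N ** L) *v k + (N *v m + j)) ** conj_transpose (c m ** a j))"
    by (rule sum_refine[OF a c lin fin order_refl])
  also have "\<dots> = analysis c L (analysis a N v) k"
    unfolding analysis_def mm.sum_left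
    by (simp add: conj_transpose_mult matrix_mul_assoc matrix_vector_right_distrib add.assoc matrix_vector_mul_assoc)
  finally show ?thesis .
qed

subsection \<open>Linear independence of characters\<close>

text \<open>
  Dedekind's argument: from a relation at \<open>x + y\<close> subtract \<open>ch a y\<close> times the relation at \<open>x\<close>
  to obtain a shorter one.
\<close>

lemma characters_independent:
  fixes ch :: "'a \<Rightarrow> 'g::monoid_add \<Rightarrow> complex"
  assumes "finite F" "inj_on ch F"
    and "\<And>a x y. a \<in> F \<Longrightarrow> ch a (x + y) = ch a x * ch a y" "\<And>a. a \<in> F \<Longrightarrow> ch a 0 = 1"
    and "\<And>x. (\<Sum>a\<in>F. c a * ch a x) = 0" "a \<in> F"
  shows "c a = 0"
  using assms
proof (induction F arbitrary: c a rule: finite_induct)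
  case (insert b F)
  note add = insert.prems(2) and one = insert.prems(3) and rel = insert.prems(4)
  have zero: "c d = 0" if d: "d \<in> F" for d
  proof -
    have "ch d \<noteq> ch b" using insert.prems(1) insert.hyps(2) d by (auto simp: inj_on_def)
    then obtain y where y: "ch d y \<noteq> ch b y" by blast
    have "(\<Sum>e\<in>F. c e * (ch e y - ch b y) * ch e x) = 0" for x
    proof -
      have "(\<Sum>e\<in>F. c e * (ch e y - ch b y) * ch e x) = (\<Sum>e\<in>insert b F. c e * (ch e y - ch b y) * ch e x)"
        using insert.hyps by simp
      also have "\<dots> = (\<Sum>e\<in>insert b F. c e * ch e (x + y)) - ch b y * (\<Sum>e\<in>insert b F. c e * ch e x)"
        unfolding sum_distrib_left sum_subtractf[symmetric] by (intro sum.cong) (simp_all add: add algebra_simps)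
      finally show ?thesis using rel by simp
    qed
    then have "c d * (ch d y - ch b y) = 0"
      using insert.prems(1) add one d by (intro insert.IH[where c = "\<lambda>e. c e * (ch e y - ch b y)"]) auto
    then show ?thesis using y by simp
  qed
  then have "c b * ch b 0 = 0" using rel[of 0] insert.hyps by simp
  then show ?case using one[of b] zero insert.prems(5) by auto
qed simp

subsection \<open>Fourier series of finitely supported sequences\<close>

definition fourier_char :: "int^'d \<Rightarrow> real^'d \<Rightarrow> complex" where
  "fourier_char k \<xi> = cis (- (real_vec k \<bullet> \<xi>))"

lemma fourier_char_add: "fourier_char k (\<xi> + \<eta>) = fourier_char k \<xi> * fourier_char k \<eta>"
  by (simp add: fourier_char_def inner_right_distrib cis_mult)

lemma fourier_char_add_left: "fourier_char (k + l) \<xi> = fourier_char k \<xi> * fourier_char l \<xi>"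
  by (simp add: fourier_char_def inner_left_distrib real_vec_add cis_mult)

lemma fourier_char_0 [simp]: "fourier_char k 0 = 1" "fourier_char 0 \<xi> = 1"
  by (simp_all add: fourier_char_def)

lemma fourier_char_matrix:
  "fourier_char (N *v m) \<xi> = fourier_char m (transpose (map_matrix real_of_int N) *v \<xi>)"
  by (simp only: fourier_char_def real_vec_matrix_mult inner_matrix_vector_mult)

lemma fourier_char_two_pi: "fourier_char k ((2 * pi) *\<^sub>R \<omega>) = cnj (unit_char \<omega> k)"
  by (simp add: fourier_char_def unit_char_def cis_cnj)

lemma inj_fourier_char: "inj fourier_char"
proof (rule injI)
  fix k l :: "int^'d" assume eq: "fourier_char k = fourier_char l"
  have "k $ i = l $ i" for i
  proof (rule ccontr)
    assume ne: "k $ i \<noteq> l $ i"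
    \<comment> \<open>Along this multiple of the i-th unit vector the two phases differ by exactly
      pi, so the characters take opposite values.\<close>
    let ?t = "pi / (real_of_int (l $ i) - real_of_int (k $ i))"
    have "fourier_char k (?t *\<^sub>R axis i 1) = fourier_char l (?t *\<^sub>R axis i 1)" using eq by simp
    then have "cis (- (?t * real_of_int (k $ i))) = cis (- (?t * real_of_int (l $ i)))"
      by (simp add: fourier_char_def inner_axis)
    then have "cis (- (?t * real_of_int (k $ i))) * cis (?t * real_of_int (l $ i)) = 1"
      by (simp add: cis_mult)
    moreover have "- (?t * real_of_int (k $ i)) + ?t * real_of_int (l $ i)
        = ?t * (real_of_int (l $ i) - real_of_int (k $ i))"
      by (simp only: right_diff_distrib)
    moreover have "\<dots> = pi" using ne by simp
    ultimately show False by (simp add: cis_mult)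
  qed
  then show "k = l" by (simp add: vec_eq_iff)
qed

definition cscale :: "complex \<Rightarrow> complex^'q^'p \<Rightarrow> complex^'q^'p" where
  "cscale z = map_matrix (\<lambda>x. x * z)"

lemma cscale_nth [simp]: "cscale z A $ i $ j = A $ i $ j * z"
  by (simp add: cscale_def map_matrix_def)

lemma linear_cscale: "linear (cscale z)"
  by (rule linearI) (simp_all add: vec_eq_iff algebra_simps)

lemmas cscale_0 [simp] = linear_0[OF linear_cscale]
  and cscale_sum = linear_sum[OF linear_cscale]

lemma cscale_cscale: "cscale z (cscale w A) = cscale (z * w) A"
  by (simp add: vec_eq_iff algebra_simps)

lemma cscale_1 [simp]: "cscale 1 A = A"
  by (simp add: vec_eq_iff)

lemma cscale_mult_cscale: "cscale z A ** cscale w B = cscale (z * w) (A ** B)"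
  by (simp add: vec_eq_iff matrix_matrix_mult_def sum_distrib_right sum_distrib_left algebra_simps)

lemma conj_transpose_cscale: "conj_transpose (cscale z A) = cscale (cnj z) (conj_transpose A)"
  by (simp add: vec_eq_iff)

lemma fourier_superset:
  assumes "finite F" "seq_support u \<subseteq> F"
  shows "fourier u \<xi> = (\<Sum>k\<in>F. cscale (fourier_char k \<xi>) (u k))"
proof -
  have "fourier u \<xi> = (\<Sum>\<^sub>\<infinity>k. cscale (fourier_char k \<xi>) (u k))"
    by (simp add: fourier_def cscale_def fourier_char_def cis_conv_exp)
  also have "\<dots> = (\<Sum>\<^sub>\<infinity>k\<in>F. cscale (fourier_char k \<xi>) (u k))"
  proof (rule infsum_cong_neutral)
    fix k assume "k \<in> UNIV - F"
    then have "u k = 0" using assms(2) by (intro not_in_seq_support) blast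
    then show "cscale (fourier_char k \<xi>) (u k) = 0" by simp
  qed auto
  finally show ?thesis using assms(1) by simp
qed

lemma fourier_l0:
  "u \<in> l0_seqs \<Longrightarrow> fourier u \<xi> = (\<Sum>k\<in>seq_support u. cscale (fourier_char k \<xi>) (u k))"
  by (rule fourier_superset) simp_all

text \<open>Linear independence of the characters of R^d, applied to each matrix entry.\<close>

lemma trig_polynomial_eq_0:
  assumes "finite F" "\<And>\<xi>. (\<Sum>k\<in>F. cscale (fourier_char k \<xi>) (C k)) = 0" "k \<in> F"
  shows "C k = 0"
proof -
  have "C k $ i $ j = 0" for i j
  proof (rule characters_independent[OF assms(1), where ch = fourier_char and c = "\<lambda>k. C k $ i $ j"])
    show "(\<Sum>a\<in>F. C a $ i $ j * fourier_char a \<xi>) = 0" for \<xi>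
      using assms(2)[of \<xi>] by (simp add: vec_eq_iff)
  qed (use assms inj_fourier_char in \<open>auto simp: fourier_char_add intro: inj_on_subset\<close>)
  then show ?thesis by (simp add: vec_eq_iff)
qed

text \<open>Supplies the uniqueness that the definite description in \<open>level_filter\<close>
  requires.\<close>

lemma fourier_inject:
  assumes "u \<in> l0_seqs" "v \<in> l0_seqs" "\<And>\<xi>. fourier u \<xi> = fourier v \<xi>"
  shows "u = v"
proof
  fix k
  let ?F = "insert k (seq_support u \<union> seq_support v)"
  have fin: "finite ?F" using assms by simp
  have "u k - v k = 0"
  proof (rule trig_polynomial_eq_0[OF fin])
    fix \<xi>
    have "(\<Sum>k\<in>?F. cscale (fourier_char k \<xi>) (u k - v k)) = fourier u \<xi> - fourier v \<xi>"
      by (subst (1 2) fourier_superset[OF fin])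
        (auto simp: linear_diff[OF linear_cscale] sum_subtractf)
    then show "(\<Sum>k\<in>?F. cscale (fourier_char k \<xi>) (u k - v k)) = 0" using assms(3) by simp
  qed simp
  then show "u k = v k" by simp
qed

lemma fourier_refine:
  assumes a: "a \<in> l0_seqs" and c: "c \<in> l0_seqs"
  shows "fourier (refine a N c) \<xi> = fourier c (transpose (map_matrix real_of_int N) *v \<xi>) ** fourier a \<xi>"
proof -
  let ?F = "(\<lambda>(m, j). N *v m + j) ` (seq_support c \<times> seq_support a)"
  have fin: "finite ?F" using a c by simp
  have "fourier (refine a N c) \<xi> = (\<Sum>n\<in>?F. cscale (fourier_char n \<xi>) (refine a N c n))"
    by (rule fourier_superset[OF fin refine_support])
  also have "\<dots> = (\<Sum>m\<in>seq_support c. \<Sum>j\<in>seq_support a. cscale (fourier_char (N *v m + j) \<xi>) (c m ** a j))"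
    by (rule sum_refine[OF a c linear_cscale fin order_refl])
  also have "\<dots> = fourier c (transpose (map_matrix real_of_int N) *v \<xi>) ** fourier a \<xi>"
    unfolding fourier_l0[OF a] fourier_l0[OF c] mm.sum_left mm.sum_right cscale_mult_cscale
      fourier_char_add_left fourier_char_matrix by (rule sum.swap)
  finally show ?thesis .
qed

subsection \<open>Multilevel filters\<close>

lemma matpow_Suc2: "matpow A (Suc n) = matpow A n ** A"
  by (induction n) (simp_all add: matrix_mul_assoc)

lemma matpow_transpose_map_matrix:
  fixes M :: "int^'d^'d"
  shows
  "matpow (transpose (map_matrix real_of_int M)) n = transpose (map_matrix real_of_int (matpow M n))"
proof (induction n)
  case 0
  show ?case by (simp add: vec_eq_iff mat_def transpose_def map_matrix_def)
next
  case (Suc n)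
  have "map_matrix real_of_int (A ** B) = map_matrix real_of_int A ** map_matrix real_of_int B" for A B :: "int^'d^'d"
    by (simp add: vec_eq_iff matrix_matrix_mult_def map_matrix_def)
  then show ?case
    unfolding matpow_Suc2[of "transpose (map_matrix real_of_int M)"] matpow.simps(2)[of M] Suc.IH
    by (simp add: matrix_transpose_mul)
qed

lemma det_matpow: "det (matpow M n) = det M ^ n" for M :: "int^'d^'d"
  by (induction n) (simp_all add: det_mul)

text \<open>The filter b_{0,n}, starting from the unit impulse. The new factor of
  \<open>low_pass_product\<close> stands on the left, so \<open>b0\<close> is the coarse argument of
  \<open>refine\<close> and the previous filter the fine one.\<close>

primrec low_pass :: "(int^'d \<Rightarrow> complex^'r^'r) \<Rightarrow> int^'d^'d \<Rightarrow> nat \<Rightarrow> int^'d \<Rightarrow> complex^'r^'r" where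
  "low_pass b0 M0 0 = (\<lambda>n. mat (delta n))"
| "low_pass b0 M0 (Suc n) = refine (low_pass b0 M0 n) (matpow M0 n) b0"

lemma mat_1_neq_0: "mat 1 \<noteq> (0 :: complex^'r^'r)"
  by (simp add: vec_eq_iff mat_def)

lemma seq_support_delta: "seq_support (\<lambda>n :: int^'d. mat (delta n) :: complex^'r^'r) = {0}"
  by (auto simp: seq_support_def delta_def mat_1_neq_0)

lemma low_pass_l0: "b0 \<in> l0_seqs \<Longrightarrow> low_pass b0 M0 n \<in> l0_seqs"
proof (induction n)
  case 0
  have "finite (seq_support (\<lambda>n :: int^'a. mat (delta n) :: complex^'b^'b))"
    by (simp add: seq_support_delta)
  then show ?case by (simp add: l0_seqs_def seq_support_def)
qed (simp add: refine_l0)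

lemma fourier_low_pass:
  "b0 \<in> l0_seqs \<Longrightarrow> fourier (low_pass b0 M0 n) \<xi> = low_pass_product b0 M0 n \<xi>"
proof (induction n)
  case 0
  show ?case
    using fourier_superset[of "{0}" "\<lambda>n. mat (delta n)" \<xi>] by (simp add: seq_support_delta) (simp add: delta_def)
qed (simp add: fourier_refine low_pass_l0 matpow_transpose_map_matrix)

text \<open>Resolves the definite description: \<open>refine\<close> provides a finitely supported
  filter with the required symbol, and Fourier series determine such filters.\<close>

lemma level_filter_eq:
  assumes "b0 \<in> l0_seqs" "bl \<in> l0_seqs"
  shows "level_filter b0 M0 bl j = refine (low_pass b0 M0 (j - 1)) (matpow M0 (j - 1)) bl"
  unfolding level_filter_def
proof (rule the_equality)
  let ?u = "refine (low_pass b0 M0 (j - 1)) (matpow M0 (j - 1)) bl"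
  have l0: "?u \<in> l0_seqs" using assms by (intro refine_l0 low_pass_l0)
  have fou: "fourier ?u \<xi> = fourier bl (matpow (transpose (map_matrix real_of_int M0)) (j - 1) *v \<xi>)
        ** low_pass_product b0 M0 (j - 1) \<xi>" for \<xi>
    using assms by (simp add: fourier_refine low_pass_l0 matpow_transpose_map_matrix fourier_low_pass)
  show "?u \<in> l0_seqs \<and> (\<forall>\<xi>. fourier ?u \<xi> =
        fourier bl (matpow (transpose (map_matrix real_of_int M0)) (j - 1) *v \<xi>)
        ** low_pass_product b0 M0 (j - 1) \<xi>)"
    using l0 fou by blast
  show "u = ?u" if "u \<in> l0_seqs \<and> (\<forall>\<xi>. fourier u \<xi> =
        fourier bl (matpow (transpose (map_matrix real_of_int M0)) (j - 1) *v \<xi>)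
        ** low_pass_product b0 M0 (j - 1) \<xi>)" for u
    using that l0 fou by (intro fourier_inject) auto
qed

lemma analysis_scaleR: "analysis g N (\<lambda>k. a *\<^sub>R v k) k = a *\<^sub>R analysis g N v k"
  by (simp add: analysis_def mm.scaleR_left scaleR_sum_right)

text \<open>By \<open>analysis_refine\<close>, n transition steps are a single analysis with b_{0,n}
  along M0^n Z^d, while the square roots multiply up. \<open>matpow_Suc2\<close> puts the new factor
  M0 on the right, where that lemma expects it.\<close>

lemma low_coeffs_eq_analysis:
  assumes "b0 \<in> l0_seqs"
  shows "low_coeffs b0 M0 v n = (\<lambda>k. sqrt (real_of_int \<bar>det M0\<bar>) ^ n *\<^sub>R analysis (low_pass b0 M0 n) (matpow M0 n) v k)"
proof (induction n)
  case 0
  show ?case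
    by (simp add: analysis_def seq_support_delta) (simp add: delta_def)
next
  case (Suc n)
  have "low_coeffs b0 M0 v (Suc n) k
      = sqrt (real_of_int \<bar>det M0\<bar>) ^ Suc n *\<^sub>R analysis (refine (low_pass b0 M0 n) (matpow M0 n) b0) (matpow M0 n ** M0) v k" for k
    using assms by (simp add: transition_op_eq_analysis Suc.IH analysis_scaleR analysis_refine low_pass_l0)
  then show ?case by (auto simp: matpow_Suc2 simp del: low_coeffs.simps matpow.simps)
qed

text \<open>The definition has the real exponent (j - 1)/2, the recursion a natural one; j \<ge> 1
  keeps the natural subtraction from truncating.\<close>

lemma sqrt_power_powr:
  assumes "j \<ge> 1" "0 < x" shows "x powr ((real j - 1) / 2) = sqrt x ^ (j - 1)"
proof -
  have "x powr ((real j - 1) / 2) = (x powr (1 / 2)) powr real (j - 1)"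
    using assms by (simp add: powr_powr of_nat_diff)
  then show ?thesis using assms by (simp add: powr_half_sqrt flip: powr_realpow)
qed

text \<open>The element b_{l,j;0} with its normalisation. The other elements are its shifts along
  the lattice M0^(j-1) M_l Z^d.\<close>

definition level_generator where
  "level_generator b0 M0 bl Ml j = (\<lambda>n.
     (real_of_int \<bar>det M0\<bar> powr ((real j - 1) / 2) * real_of_int \<bar>det Ml\<bar> powr (1 / 2)) *\<^sub>R
     refine (low_pass b0 M0 (j - 1)) (matpow M0 (j - 1)) bl n)"

lemma level_generator_l0:
  assumes "b0 \<in> l0_seqs" "bl \<in> l0_seqs" shows "level_generator b0 M0 bl Ml j \<in> l0_seqs"
proof -
  have "refine (low_pass b0 M0 (j - 1)) (matpow M0 (j - 1)) bl \<in> l0_seqs"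
    using assms by (intro refine_l0 low_pass_l0)
  then show ?thesis unfolding l0_seqs_def level_generator_def mem_Collect_eq
    by (rule rev_finite_subset) auto
qed

lemma level_elem_eq:
  assumes "b0 \<in> l0_seqs" "bl \<in> l0_seqs"
  shows "level_elem b0 M0 bl Ml j k =
    (\<lambda>n. level_generator b0 M0 bl Ml j (n - (matpow M0 (j - 1) ** Ml) *v k))"
  by (simp add: level_elem_def level_generator_def level_filter_eq[OF assms] matrix_vector_mul_assoc)

text \<open>The normalisations match: |det M0|^((j-1)/2) accumulates over j - 1 low-pass steps, and
  |det M_l|^(1/2) comes from the last step.\<close>

lemma seq_inner_level_elem:
  assumes "b0 \<in> l0_seqs" "bl \<in> l0_seqs" "det M0 \<noteq> 0" "j \<ge> 1"
  shows "seq_inner v (level_elem b0 M0 bl Ml j k) = transition_op bl Ml (low_coeffs b0 M0 v (j - 1)) k"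
proof -
  let ?c = "real_of_int \<bar>det M0\<bar> powr ((real j - 1) / 2)" and ?u = "refine (low_pass b0 M0 (j - 1)) (matpow M0 (j - 1)) bl"
  have u: "?u \<in> l0_seqs" using assms by (intro refine_l0 low_pass_l0)
  have c: "?c = sqrt (real_of_int \<bar>det M0\<bar>) ^ (j - 1)" using assms by (intro sqrt_power_powr) auto
  have "seq_inner v (level_elem b0 M0 bl Ml j k)
     = (?c * sqrt (real_of_int \<bar>det Ml\<bar>)) *\<^sub>R seq_inner v (\<lambda>n. ?u (n - (matpow M0 (j - 1) ** Ml) *v k))"
    unfolding level_elem_eq[OF assms(1,2)] level_generator_def seq_inner_scaleR_right
    by (simp add: powr_half_sqrt)
  also have "\<dots> = (?c * sqrt (real_of_int \<bar>det Ml\<bar>)) *\<^sub>R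
      analysis bl Ml (analysis (low_pass b0 M0 (j - 1)) (matpow M0 (j - 1)) v) k"
    using assms by (simp only: seq_inner_shift[OF u] analysis_refine low_pass_l0)
  also have "\<dots> = transition_op bl Ml (low_coeffs b0 M0 v (j - 1)) k"
    unfolding c using assms
    by (simp add: transition_op_eq_analysis low_coeffs_eq_analysis analysis_scaleR mult.commute)
  finally show ?thesis .
qed

lemma seq_inner_low_elem:
  assumes "b0 \<in> l0_seqs" "det M0 \<noteq> 0"
  shows "seq_inner v (low_elem b0 M0 j k) = low_coeffs b0 M0 v j k"
proof (cases j)
  case 0
  \<comment> \<open>The convention at level 0 is a shift of \<open>low_pass b0 M0 0\<close> along
    the lattice of the identity matrix, so the general shift lemma applies.\<close>
  have "low_elem b0 M0 j k = (\<lambda>n. low_pass b0 M0 0 (n - mat 1 *v k))" using 0 by (simp add: low_elem_def)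
  then show ?thesis
    using seq_inner_shift[OF low_pass_l0[OF assms(1), of M0 0], of v "mat 1" k] fun_cong[OF low_coeffs_eq_analysis[OF assms(1), of M0 v 0], of k] 0
    by simp
next
  case (Suc i)
  then show ?thesis using seq_inner_level_elem[OF assms(1,1,2), of j v M0 k] by (simp add: low_elem_def)
qed

text \<open>A singular matrix has eigenvalue 0, whose modulus is not greater than 1.\<close>

lemma dilation_matrix_det:
  fixes M :: "int^'d^'d"
  assumes "dilation_matrix M" shows "det M \<noteq> 0"
proof
  assume "det M = 0"
  then have "det (map_matrix complex_of_int M) = 0" by (simp add: det_map_matrix_of_int)
  then have "\<not> invertible (map_matrix complex_of_int M)" by (simp add: invertible_det_nz)
  then obtain x where "x \<noteq> 0" "map_matrix complex_of_int M *v x = 0"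
    using matrix_left_invertible_ker invertible_left_inverse by metis
  then show False using assms unfolding dilation_matrix_def by (metis norm_zero not_one_less_zero vector_smult_lzero)
qed

subsection \<open>Perfect reconstruction in the time and the frequency domain\<close>

lemma unit_char_diff: "unit_char \<omega> (n - j) = unit_char \<omega> n * cnj (unit_char \<omega> j)"
  by (simp add: unit_char_def real_vec_diff inner_diff_left right_diff_distrib cis_mult cis_cnj)

lemma fourier_char_diff: "fourier_char (j - i) \<xi> = cnj (fourier_char i \<xi>) * fourier_char j \<xi>"
  by (simp add: fourier_char_def real_vec_diff inner_diff_left cis_mult cis_cnj)

lemma cscale_add_left: "cscale (z + w) A = cscale z A + cscale w A"
  by (simp add: vec_eq_iff algebra_simps)

lemma cscale_0_left [simp]: "cscale 0 A = 0"
  by (simp add: vec_eq_iff)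

lemma cscale_sum_left: "cscale (\<Sum>x\<in>F. f x) A = (\<Sum>x\<in>F. cscale (f x) A)"
  by (induction F rule: infinite_finite_induct) (simp_all add: cscale_add_left)

lemma cscale_of_int: "cscale (of_int a) A = real_of_int a *\<^sub>R A"
  by (simp add: vec_eq_iff scaleR_conv_of_real[where 'a = complex] mult.commute)

lemma cscale_scaleR: "cscale z (a *\<^sub>R A) = a *\<^sub>R cscale z A"
  by (rule linear_scale[OF linear_cscale])

text \<open>
  The kernel of synthesis after analysis, with \<open>p\<close> the difference of the two arguments, and the
  coefficient of $e^{-ip\cdot\xi}$ in the mixed products of the Fourier series.
\<close>

definition time_kernel ::
    "(int^'d \<Rightarrow> complex^'r^'p) \<Rightarrow> (int^'d \<Rightarrow> complex^'r^'p) \<Rightarrow> int^'d^'d \<Rightarrow> int^'d \<Rightarrow> int^'d \<Rightarrow> complex^'r^'r" where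
  "time_kernel b tb M p n =
    (\<Sum>j\<in>seq_support tb. if n - j \<in> range ((*v) M) then conj_transpose (b (j - p)) ** tb j else 0)"

definition freq_kernel ::
    "(int^'d \<Rightarrow> complex^'r^'p) \<Rightarrow> (int^'d \<Rightarrow> complex^'r^'p) \<Rightarrow> int^'d \<Rightarrow> real^'d \<Rightarrow> complex^'r^'r" where
  "freq_kernel b tb p \<omega> =
    (\<Sum>j\<in>seq_support tb. cscale (cnj (unit_char \<omega> j)) (conj_transpose (b (j - p)) ** tb j))"

text \<open>|det M| times the indicator of n - j in M Z^d is expanded into characters, and each
  character of n - j splits into a factor in n and a factor in j.\<close>

lemma time_kernel_eq_sum_freq_kernel:
  fixes M :: "int^'d^'d"
  assumes "det M \<noteq> 0"
  shows "real_of_int \<bar>det M\<bar> *\<^sub>R time_kernel b tb M p n =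
    (\<Sum>\<omega>\<in>freq_set M. cscale (unit_char \<omega> n) (freq_kernel b tb p \<omega>))"
proof -
  have "(\<Sum>\<omega>\<in>freq_set M. cscale (unit_char \<omega> n) (freq_kernel b tb p \<omega>))
     = (\<Sum>\<omega>\<in>freq_set M. \<Sum>j\<in>seq_support tb. cscale (unit_char \<omega> (n - j)) (conj_transpose (b (j - p)) ** tb j))"
    by (simp add: freq_kernel_def cscale_sum cscale_cscale unit_char_diff)
  also have "\<dots> = (\<Sum>j\<in>seq_support tb. cscale (\<Sum>\<omega>\<in>freq_set M. unit_char \<omega> (n - j)) (conj_transpose (b (j - p)) ** tb j))"
    unfolding cscale_sum_left by (rule sum.swap)
  also have "\<dots> = (\<Sum>j\<in>seq_support tb. real_of_int \<bar>det M\<bar> *\<^sub>R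
      (if n - j \<in> range ((*v) M) then conj_transpose (b (j - p)) ** tb j else 0))"
  proof (rule sum.cong[OF refl])
    fix j
    show "cscale (\<Sum>\<omega>\<in>freq_set M. unit_char \<omega> (n - j)) (conj_transpose (b (j - p)) ** tb j) =
      real_of_int \<bar>det M\<bar> *\<^sub>R (if n - j \<in> range ((*v) M) then conj_transpose (b (j - p)) ** tb j else 0)"
      unfolding sum_unit_char_freq_set[OF assms] by (simp add: cscale_of_int del: of_int_abs)
  qed
  finally show ?thesis by (simp add: time_kernel_def scaleR_sum_right)
qed

definition diff_set :: "(int^'d \<Rightarrow> complex^'r^'p) \<Rightarrow> (int^'d \<Rightarrow> complex^'r^'p) \<Rightarrow> (int^'d) set" where
  "diff_set b tb = (\<lambda>(i, j). j - i) ` (seq_support b \<times> seq_support tb)"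

lemma finite_diff_set: "b \<in> l0_seqs \<Longrightarrow> tb \<in> l0_seqs \<Longrightarrow> finite (diff_set b tb)"
  by (simp add: diff_set_def)

lemma freq_kernel_eq_0:
  assumes "p \<notin> diff_set b tb" shows "freq_kernel b tb p \<omega> = 0"
  unfolding freq_kernel_def
proof (rule sum.neutral, rule ballI)
  fix j assume j: "j \<in> seq_support tb"
  have "j - p \<notin> seq_support b"
  proof
    assume "j - p \<in> seq_support b"
    then have "(j - (j - p)) \<in> diff_set b tb" using j unfolding diff_set_def by (force simp: image_iff)
    then show False using assms by simp
  qed
  then show "cscale (cnj (unit_char \<omega> j)) (conj_transpose (b (j - p)) ** tb j) = 0"
    by (simp add: not_in_seq_support)
qed

text \<open>The double sum over taps i, j is collected by p = j - i. The shift by 2 pi \<omega>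
  attaches the conjugate character at j to the j-th tap, which is the weight in
  \<open>freq_kernel\<close>.\<close>

lemma fourier_mixed_product:
  assumes "b \<in> l0_seqs" "tb \<in> l0_seqs" "finite P" "diff_set b tb \<subseteq> P"
  shows "conj_transpose (fourier b \<xi>) ** fourier tb (\<xi> + (2 * pi) *\<^sub>R \<omega>) =
    (\<Sum>p\<in>P. cscale (fourier_char p \<xi>) (freq_kernel b tb p \<omega>))"
proof -
  let ?u = "\<lambda>i j. cscale (fourier_char (j - i) \<xi> * cnj (unit_char \<omega> j)) (conj_transpose (b i) ** tb j)"
  have inner: "(\<Sum>p\<in>P. ?u (j - p) j) = (\<Sum>i\<in>seq_support b. ?u i j)" if j: "j \<in> seq_support tb" for j
  proof -
    have sub: "(\<lambda>i. j - i) ` seq_support b \<subseteq> P" using assms(4) j by (force simp: diff_set_def)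
    have "(\<Sum>p\<in>P. ?u (j - p) j) = (\<Sum>p\<in>(\<lambda>i. j - i) ` seq_support b. ?u (j - p) j)"
    proof (rule sum.mono_neutral_right[OF assms(3) sub], rule ballI)
      fix p assume p: "p \<in> P - (\<lambda>i. j - i) ` seq_support b"
      have "j - p \<notin> seq_support b"
      proof
        assume "j - p \<in> seq_support b"
        then have "j - (j - p) \<in> (\<lambda>i. j - i) ` seq_support b" by (rule imageI)
        then show False using p by simp
      qed
      then show "?u (j - p) j = 0" by (simp add: not_in_seq_support)
    qed
    also have "\<dots> = (\<Sum>i\<in>seq_support b. ?u i j)"
      by (subst sum.reindex) (auto simp: inj_on_def)
    finally show ?thesis .
  qed
  have "(\<Sum>p\<in>P. cscale (fourier_char p \<xi>) (freq_kernel b tb p \<omega>)) = (\<Sum>p\<in>P. \<Sum>j\<in>seq_support tb. ?u (j - p) j)"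
    by (simp add: freq_kernel_def cscale_sum cscale_cscale)
  also have "\<dots> = (\<Sum>j\<in>seq_support tb. \<Sum>p\<in>P. ?u (j - p) j)" by (rule sum.swap)
  also have "\<dots> = (\<Sum>j\<in>seq_support tb. \<Sum>i\<in>seq_support b. ?u i j)"
    by (rule sum.cong[OF refl inner])
  also have "\<dots> = conj_transpose (fourier b \<xi>) ** fourier tb (\<xi> + (2 * pi) *\<^sub>R \<omega>)"
    by (simp add: fourier_l0[OF assms(1)] fourier_l0[OF assms(2)] conj_transpose_sum conj_transpose_cscale
        mm.sum_left mm.sum_right cscale_mult_cscale fourier_char_add fourier_char_two_pi fourier_char_diff mult.assoc)
  finally show ?thesis ..
qed

text \<open>The weight of the input position m in the output at n depends on more than n - m, since
  n - j has to lie in M Z^d. For this reason \<open>time_kernel\<close> takes both p = n - m and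
  n.\<close>

lemma synthesis_analysis:
  fixes b tb :: "int^'d \<Rightarrow> complex^'r^'p" and v :: "int^'d \<Rightarrow> complex^'r^'t"
  assumes "inj ((*v) M)" "finite F" "\<And>i j. i \<in> seq_support b \<Longrightarrow> j \<in> seq_support tb \<Longrightarrow> n - j + i \<in> F"
  shows "synthesis tb M (analysis b M v) n = (\<Sum>m\<in>F. v m ** time_kernel b tb M (n - m) n)"
proof -
  have "upsample M (analysis b M v) (n - j) ** tb j = (\<Sum>m\<in>F. v m **
      (if n - j \<in> range ((*v) M) then conj_transpose (b (j - (n - m))) ** tb j else 0))"
    if j: "j \<in> seq_support tb" for j
  proof (cases "n - j \<in> range ((*v) M)")
    case True
    then obtain k where k: "n - j = M *v k" by blast
    have sub: "(+) (n - j) ` seq_support b \<subseteq> F" using assms(3) j by auto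
    have "(\<Sum>m\<in>F. v m ** conj_transpose (b (j - (n - m)))) = (\<Sum>m\<in>(+) (n - j) ` seq_support b. v m ** conj_transpose (b (j - (n - m))))"
    proof (rule sum.mono_neutral_right[OF assms(2) sub], rule ballI)
      fix m assume "m \<in> F - (+) (n - j) ` seq_support b"
      then have "j - (n - m) \<notin> seq_support b" by (force simp: image_iff)
      then show "v m ** conj_transpose (b (j - (n - m))) = 0" by (simp add: not_in_seq_support)
    qed
    also have "\<dots> = (\<Sum>i\<in>seq_support b. v (n - j + i) ** conj_transpose (b i))"
      by (subst sum.reindex) auto
    also have "\<dots> = analysis b M v k" by (simp add: analysis_def k)
    also have "\<dots> = upsample M (analysis b M v) (n - j)" by (simp add: k upsample_image[OF assms(1)])
    finally show ?thesis using True by (simp add: matrix_mul_assoc flip: mm.sum_left)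
  qed (simp add: upsample_def)
  then have "synthesis tb M (analysis b M v) n = (\<Sum>j\<in>seq_support tb. \<Sum>m\<in>F. v m **
      (if n - j \<in> range ((*v) M) then conj_transpose (b (j - (n - m))) ** tb j else 0))"
    unfolding synthesis_def by (rule sum.cong[OF refl])
  also have "\<dots> = (\<Sum>m\<in>F. \<Sum>j\<in>seq_support tb. v m **
      (if n - j \<in> range ((*v) M) then conj_transpose (b (j - (n - m))) ** tb j else 0))"
    by (rule sum.swap)
  finally show ?thesis by (simp add: time_kernel_def mm.sum_right)
qed

text \<open>The points of disagreement form an open set, and a nonempty open set is not
  negligible.\<close>

lemma AE_lborel_continuous_imp_all:
  fixes f g :: "'a::euclidean_space \<Rightarrow> 'b::metric_space"
  assumes "AE x in lborel. f x = g x" "continuous_on UNIV f" "continuous_on UNIV g"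
  shows "f x = g x"
proof (rule ccontr)
  assume "f x \<noteq> g x"
  moreover have "open {x. f x \<noteq> g x}" by (rule open_Collect_neq[OF assms(2,3)])
  ultimately have "\<not> negligible {x. f x \<noteq> g x}" by (intro open_not_negligible) auto
  moreover obtain N where "N \<in> null_sets lborel" "{x. f x \<noteq> g x} \<subseteq> N"
    using assms(1) by (auto elim!: AE_E simp: null_sets_def)
  then have "negligible {x. f x \<noteq> g x}"
    by (meson negligible_iff_null_sets negligible_subset null_sets_completionI)
  ultimately show False by simp
qed

lemma continuous_on_trig_polynomial:
  "continuous_on UNIV (\<lambda>\<xi>. \<Sum>p\<in>P. cscale (fourier_char p \<xi>) (C p))"
proof -
  have "continuous_on UNIV (\<lambda>\<xi>. fourier_char p \<xi>)" for p :: "int^'a"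
    unfolding fourier_char_def by (intro continuous_intros)
  then show ?thesis
    unfolding cscale_def map_matrix_def by (intro continuous_intros continuous_on_vec_lambda)
qed

section \<open>Kernels of a whole filter bank and the reconstruction operator\<close>

locale filter_bank =
  fixes s :: nat
    and M :: "nat \<Rightarrow> int ^ 'd ^ 'd"
    and b0 tb0 :: "int ^ 'd \<Rightarrow> complex ^ 'r ^ 'r"
    and b tb :: "nat \<Rightarrow> int ^ 'd \<Rightarrow> complex ^ 'r ^ 1"
  assumes low_l0: "b0 \<in> l0_seqs" "tb0 \<in> l0_seqs"
    and high_l0: "\<And>l. l \<in> {1..s} \<Longrightarrow> b l \<in> l0_seqs" "\<And>l. l \<in> {1..s} \<Longrightarrow> tb l \<in> l0_seqs"
    and det: "\<And>l. l \<in> {0..s} \<Longrightarrow> det (M l) \<noteq> 0"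
begin

lemma det_M: "det (M 0) \<noteq> 0" "l \<in> {1..s} \<Longrightarrow> det (M l) \<noteq> 0"
  using det by auto

lemma inj_M: "inj ((*v) (M 0))" "l \<in> {1..s} \<Longrightarrow> inj ((*v) (M l))"
  using det_M inj_mult_int_matrix by blast+

definition \<Omega> :: "(real^'d) set" where
  "\<Omega> = (\<Union>l\<in>{0..s}. freq_set (M l))"

lemma finite_\<Omega>: "finite \<Omega>"
  unfolding \<Omega>_def using det freq_set_card(1) by blast

lemma \<Omega>_subset: "\<Omega> \<subseteq> unit_cube"
  unfolding \<Omega>_def using freq_set_subset_unit_cube by blast

lemma zero_in_\<Omega>: "0 \<in> \<Omega>"
  unfolding \<Omega>_def using zero_in_freq_set by fastforce

definition total_freq_kernel :: "int^'d \<Rightarrow> real^'d \<Rightarrow> complex^'r^'r" where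
  "total_freq_kernel p \<omega> = indicat_real (freq_set (M 0)) \<omega> *\<^sub>R freq_kernel b0 tb0 p \<omega>
     + (\<Sum>l=1..s. indicat_real (freq_set (M l)) \<omega> *\<^sub>R freq_kernel (b l) (tb l) p \<omega>)"

definition total_time_kernel :: "int^'d \<Rightarrow> int^'d \<Rightarrow> complex^'r^'r" where
  "total_time_kernel p n = real_of_int \<bar>det (M 0)\<bar> *\<^sub>R time_kernel b0 tb0 (M 0) p n
     + (\<Sum>l=1..s. real_of_int \<bar>det (M l)\<bar> *\<^sub>R time_kernel (b l) (tb l) (M l) p n)"

definition reconstruct :: "(int^'d \<Rightarrow> complex^'r^'t) \<Rightarrow> int^'d \<Rightarrow> complex^'r^'t" where
  "reconstruct v n = real_of_int \<bar>det (M 0)\<bar> *\<^sub>R synthesis tb0 (M 0) (analysis b0 (M 0) v) n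
     + (\<Sum>l=1..s. real_of_int \<bar>det (M l)\<bar> *\<^sub>R synthesis (tb l) (M l) (analysis (b l) (M l) v) n)"

lemma total_time_kernel_eq:
  "total_time_kernel p n = (\<Sum>\<omega>\<in>\<Omega>. cscale (unit_char \<omega> n) (total_freq_kernel p \<omega>))"
proof -
  \<comment> \<open>The indicator functions extend all sums to the common set
    \<open>\<Omega>\<close>, so that different dilations can be added coefficient by
    coefficient.\<close>
  have ext: "(\<Sum>\<omega>\<in>freq_set (M l). cscale (unit_char \<omega> n) (g \<omega>)) =
      (\<Sum>\<omega>\<in>\<Omega>. cscale (unit_char \<omega> n) (indicat_real (freq_set (M l)) \<omega> *\<^sub>R g \<omega>))"
    if "l \<in> {0..s}" for l and g :: "real^'d \<Rightarrow> complex^'r^'r"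
    using that finite_\<Omega> by (intro sum.mono_neutral_cong_left) (auto simp: \<Omega>_def)
  have low: "real_of_int \<bar>det (M 0)\<bar> *\<^sub>R time_kernel b0 tb0 (M 0) p n =
      (\<Sum>\<omega>\<in>\<Omega>. cscale (unit_char \<omega> n) (indicat_real (freq_set (M 0)) \<omega> *\<^sub>R freq_kernel b0 tb0 p \<omega>))"
    unfolding time_kernel_eq_sum_freq_kernel[OF det_M(1)] by (rule ext) simp
  have high: "real_of_int \<bar>det (M l)\<bar> *\<^sub>R time_kernel (b l) (tb l) (M l) p n =
      (\<Sum>\<omega>\<in>\<Omega>. cscale (unit_char \<omega> n) (indicat_real (freq_set (M l)) \<omega> *\<^sub>R freq_kernel (b l) (tb l) p \<omega>))"
    if l: "l \<in> {1..s}" for l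
    unfolding time_kernel_eq_sum_freq_kernel[OF det_M(2)[OF l]] by (rule ext) (use l in auto)
  have "total_time_kernel p n =
      (\<Sum>\<omega>\<in>\<Omega>. cscale (unit_char \<omega> n) (indicat_real (freq_set (M 0)) \<omega> *\<^sub>R freq_kernel b0 tb0 p \<omega>))
      + (\<Sum>l=1..s. \<Sum>\<omega>\<in>\<Omega>. cscale (unit_char \<omega> n) (indicat_real (freq_set (M l)) \<omega> *\<^sub>R freq_kernel (b l) (tb l) p \<omega>))"
    unfolding total_time_kernel_def
    by (intro arg_cong2[where f = "(+)"] low sum.cong[OF refl high])
  also have "\<dots> = (\<Sum>\<omega>\<in>\<Omega>. cscale (unit_char \<omega> n) (total_freq_kernel p \<omega>))"
    unfolding total_freq_kernel_def linear_add[OF linear_cscale] cscale_sum sum.distrib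
    by (rule arg_cong2[where f = "(+)", OF refl sum.swap])
  finally show ?thesis .
qed

text \<open>The target does not depend on n, so as a combination of characters it has a coefficient
  at \<omega> = 0 only. Distinct points of the unit cube give distinct characters, so independence
  permits comparing coefficients.\<close>

lemma time_iff_freq:
  "(\<forall>n. total_time_kernel p n = mat (delta p)) \<longleftrightarrow> (\<forall>\<omega>\<in>\<Omega>. total_freq_kernel p \<omega> = mat (delta p * delta \<omega>))"
proof -
  have mat: "(mat (delta p) :: complex^'r^'r) = (\<Sum>\<omega>\<in>\<Omega>. cscale (unit_char \<omega> n) (mat (delta p * delta \<omega>)))" for n
  proof -
    have "(\<Sum>\<omega>\<in>\<Omega>. cscale (unit_char \<omega> n) (mat (delta p * delta \<omega>) :: complex^'r^'r))
       = (\<Sum>\<omega>\<in>{0}. cscale (unit_char \<omega> n) (mat (delta p * delta \<omega>)))"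
      using zero_in_\<Omega> finite_\<Omega> by (intro sum.mono_neutral_right) (auto simp: delta_def)
    also have "\<dots> = mat (delta p)" by (simp add: delta_def unit_char_def)
    finally show ?thesis ..
  qed
  show ?thesis
  proof
    assume time: "\<forall>n. total_time_kernel p n = mat (delta p)"
    show "\<forall>\<omega>\<in>\<Omega>. total_freq_kernel p \<omega> = mat (delta p * delta \<omega>)"
    proof
      fix \<omega> assume \<omega>: "\<omega> \<in> \<Omega>"
      have "(total_freq_kernel p \<omega> - mat (delta p * delta \<omega>)) $ i $ j = 0" for i j
      proof (rule characters_independent[OF finite_\<Omega>, where ch = unit_char
            and c = "\<lambda>\<omega>. (total_freq_kernel p \<omega> - mat (delta p * delta \<omega>)) $ i $ j"])
        show "inj_on unit_char \<Omega>" using \<Omega>_subset unit_char_inject by (auto simp: inj_on_def)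
        fix n
        have "(\<Sum>\<omega>\<in>\<Omega>. cscale (unit_char \<omega> n) (total_freq_kernel p \<omega> - mat (delta p * delta \<omega>))) = 0"
          using time mat[of n] total_time_kernel_eq[of p n]
          by (simp add: linear_diff[OF linear_cscale] sum_subtractf)
        then show "(\<Sum>\<omega>\<in>\<Omega>. (total_freq_kernel p \<omega> - mat (delta p * delta \<omega>)) $ i $ j * unit_char \<omega> n) = 0"
          by (simp add: vec_eq_iff)
      qed (use \<omega> in \<open>auto simp: unit_char_add\<close>)
      then show "total_freq_kernel p \<omega> = mat (delta p * delta \<omega>)" by (simp add: vec_eq_iff)
    qed
  next
    assume "\<forall>\<omega>\<in>\<Omega>. total_freq_kernel p \<omega> = mat (delta p * delta \<omega>)"
    then show "\<forall>n. total_time_kernel p n = mat (delta p)"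
      unfolding total_time_kernel_eq by (simp add: mat[symmetric])
  qed
qed

text \<open>At each \<omega> the left-hand side of (i) is a trigonometric polynomial in \<xi> with
  coefficients \<open>total_freq_kernel p \<omega>\<close>; the right-hand side is constant, hence
  concentrated at p = 0.\<close>

lemma dual_iff_freq:
  "dual_framelet_filter_bank s M b0 b tb0 tb \<longleftrightarrow>
    (\<forall>p. \<forall>\<omega>\<in>\<Omega>. total_freq_kernel p \<omega> = mat (delta p * delta \<omega>))"
proof -
  \<comment> \<open>The index 0 is added so that the constant right-hand side is also a sum over
    \<open>P\<close>, even if no pair of taps has difference 0.\<close>
  define P where "P = insert 0 (diff_set b0 tb0 \<union> (\<Union>l\<in>{1..s}. diff_set (b l) (tb l)))"
  have finP: "finite P" unfolding P_def using low_l0 high_l0 by (simp add: finite_diff_set)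
  have out: "total_freq_kernel p \<omega> = 0" if "p \<notin> P" for p \<omega>
  proof -
    have "(\<Sum>l=1..s. indicat_real (freq_set (M l)) \<omega> *\<^sub>R freq_kernel (b l) (tb l) p \<omega>) = 0"
      using that by (intro sum.neutral) (auto simp: P_def freq_kernel_eq_0)
    then show ?thesis using that by (simp add: total_freq_kernel_def P_def freq_kernel_eq_0)
  qed
  have lhs: "indicat_real (freq_set (M 0)) \<omega> *\<^sub>R
          (conj_transpose (fourier b0 \<xi>) ** fourier tb0 (\<xi> + (2 * pi) *\<^sub>R \<omega>))
        + (\<Sum>l=1..s. indicat_real (freq_set (M l)) \<omega> *\<^sub>R
            (conj_transpose (fourier (b l) \<xi>) ** fourier (tb l) (\<xi> + (2 * pi) *\<^sub>R \<omega>)))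
      = (\<Sum>p\<in>P. cscale (fourier_char p \<xi>) (total_freq_kernel p \<omega>))" for \<xi> \<omega>
  proof -
    have "(\<Sum>l=1..s. indicat_real (freq_set (M l)) \<omega> *\<^sub>R
            (conj_transpose (fourier (b l) \<xi>) ** fourier (tb l) (\<xi> + (2 * pi) *\<^sub>R \<omega>)))
       = (\<Sum>l=1..s. \<Sum>p\<in>P. cscale (fourier_char p \<xi>) (indicat_real (freq_set (M l)) \<omega> *\<^sub>R freq_kernel (b l) (tb l) p \<omega>))"
    proof (rule sum.cong[OF refl])
      fix l assume l: "l \<in> {1..s}"
      then have sub: "diff_set (b l) (tb l) \<subseteq> P" by (auto simp: P_def)
      show "indicat_real (freq_set (M l)) \<omega> *\<^sub>R
            (conj_transpose (fourier (b l) \<xi>) ** fourier (tb l) (\<xi> + (2 * pi) *\<^sub>R \<omega>))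
         = (\<Sum>p\<in>P. cscale (fourier_char p \<xi>) (indicat_real (freq_set (M l)) \<omega> *\<^sub>R freq_kernel (b l) (tb l) p \<omega>))"
        unfolding fourier_mixed_product[OF high_l0(1)[OF l] high_l0(2)[OF l] finP sub]
        by (simp add: scaleR_sum_right cscale_scaleR)
    qed
    also have "\<dots> = (\<Sum>p\<in>P. cscale (fourier_char p \<xi>) (\<Sum>l=1..s. indicat_real (freq_set (M l)) \<omega> *\<^sub>R freq_kernel (b l) (tb l) p \<omega>))"
      unfolding cscale_sum by (rule sum.swap)
    finally have high: "(\<Sum>l=1..s. indicat_real (freq_set (M l)) \<omega> *\<^sub>R
            (conj_transpose (fourier (b l) \<xi>) ** fourier (tb l) (\<xi> + (2 * pi) *\<^sub>R \<omega>))) = \<dots>" .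
    have sub: "diff_set b0 tb0 \<subseteq> P" by (auto simp: P_def)
    show ?thesis
      unfolding high fourier_mixed_product[OF low_l0 finP sub] total_freq_kernel_def
      by (simp add: scaleR_sum_right cscale_scaleR linear_add[OF linear_cscale] sum.distrib)
  qed
  have rhs: "(mat (delta \<omega>) :: complex^'r^'r) = (\<Sum>p\<in>P. cscale (fourier_char p \<xi>) (mat (delta p * delta \<omega>)))" for \<omega> :: "real^'d" and \<xi>
  proof -
    have "(\<Sum>p\<in>P. cscale (fourier_char p \<xi>) (mat (delta p * delta \<omega>) :: complex^'r^'r))
       = (\<Sum>p\<in>{0}. cscale (fourier_char p \<xi>) (mat (delta p * delta \<omega>)))"
      using finP by (intro sum.mono_neutral_right) (auto simp: delta_def P_def)
    also have "\<dots> = mat (delta \<omega>)" by (simp add: delta_def)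
    finally show ?thesis ..
  qed
  have dual: "dual_framelet_filter_bank s M b0 b tb0 tb \<longleftrightarrow>
    (AE \<xi> in lborel. \<forall>\<omega>\<in>\<Omega>. (\<Sum>p\<in>P. cscale (fourier_char p \<xi>) (total_freq_kernel p \<omega>)) = mat (delta \<omega>))"
    unfolding dual_framelet_filter_bank_def lhs \<Omega>_def ..
  show ?thesis
  proof
    assume "dual_framelet_filter_bank s M b0 b tb0 tb"
    then have AE: "AE \<xi> in lborel. \<forall>\<omega>\<in>\<Omega>. (\<Sum>p\<in>P. cscale (fourier_char p \<xi>) (total_freq_kernel p \<omega>)) = mat (delta \<omega>)"
      using dual by simp
    show "\<forall>p. \<forall>\<omega>\<in>\<Omega>. total_freq_kernel p \<omega> = mat (delta p * delta \<omega>)"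
    proof (intro allI ballI)
      fix p \<omega> assume \<omega>: "\<omega> \<in> \<Omega>"
      have AE\<omega>: "AE \<xi> in lborel. (\<Sum>p\<in>P. cscale (fourier_char p \<xi>) (total_freq_kernel p \<omega>)) = mat (delta \<omega>)"
        using AE by (rule eventually_mono) (use \<omega> in blast)
      \<comment> \<open>Both sides are continuous in \<xi>, so the identity passes from almost every
        \<xi> to every \<xi>.\<close>
      have all: "(\<Sum>p\<in>P. cscale (fourier_char p \<xi>) (total_freq_kernel p \<omega>)) = mat (delta \<omega>)" for \<xi>
        by (rule AE_lborel_continuous_imp_all[OF AE\<omega> continuous_on_trig_polynomial]) simp
      show "total_freq_kernel p \<omega> = mat (delta p * delta \<omega>)"
      proof (cases "p \<in> P")
        case True
        have "(\<Sum>p\<in>P. cscale (fourier_char p \<xi>) (total_freq_kernel p \<omega> - mat (delta p * delta \<omega>))) = 0" for \<xi>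
          using all[of \<xi>] rhs[of \<omega> \<xi>] by (simp add: linear_diff[OF linear_cscale] sum_subtractf)
        from trig_polynomial_eq_0[OF finP this True] show ?thesis by simp
      next
        case False
        then have "p \<noteq> 0" by (auto simp: P_def)
        then show ?thesis using out[OF False] by (simp add: delta_def)
      qed
    qed
  next
    assume "\<forall>p. \<forall>\<omega>\<in>\<Omega>. total_freq_kernel p \<omega> = mat (delta p * delta \<omega>)"
    then show "dual_framelet_filter_bank s M b0 b tb0 tb"
      unfolding dual by (intro AE_I2) (simp add: rhs[symmetric])
  qed
qed

lemma reconstruct_eq:
  fixes v :: "int^'d \<Rightarrow> complex^'r^'t"
  shows "\<exists>F. finite F \<and> (\<forall>F'. finite F' \<longrightarrow> F \<subseteq> F' \<longrightarrow> reconstruct v n = (\<Sum>m\<in>F'. v m ** total_time_kernel (n - m) n))"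
proof (intro exI conjI allI impI)
  let ?S = "\<lambda>b tb. (\<lambda>(i, j). n - j + i) ` (seq_support b \<times> seq_support tb)"
  let ?F = "?S b0 tb0 \<union> (\<Union>l\<in>{1..s}. ?S (b l) (tb l))"
  show "finite ?F" using low_l0 high_l0 by simp
  fix F' assume F': "finite F'" "?F \<subseteq> F'"
  have "synthesis tb0 (M 0) (analysis b0 (M 0) v) n = (\<Sum>m\<in>F'. v m ** time_kernel b0 tb0 (M 0) (n - m) n)"
    using F' inj_M by (intro synthesis_analysis) force+
  moreover have "synthesis (tb l) (M l) (analysis (b l) (M l) v) n = (\<Sum>m\<in>F'. v m ** time_kernel (b l) (tb l) (M l) (n - m) n)"
    if l: "l \<in> {1..s}" for l
  proof (rule synthesis_analysis[OF inj_M(2)[OF l] F'(1)])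
    fix i j assume "i \<in> seq_support (b l)" "j \<in> seq_support (tb l)"
    then have "n - j + i \<in> ?S (b l) (tb l)" by force
    then show "n - j + i \<in> F'" using F'(2) l by blast
  qed
  ultimately have "reconstruct v n = real_of_int \<bar>det (M 0)\<bar> *\<^sub>R (\<Sum>m\<in>F'. v m ** time_kernel b0 tb0 (M 0) (n - m) n)
      + (\<Sum>l=1..s. \<Sum>m\<in>F'. v m ** (real_of_int \<bar>det (M l)\<bar> *\<^sub>R time_kernel (b l) (tb l) (M l) (n - m) n))"
    by (simp add: reconstruct_def scaleR_sum_right mm.scaleR_right)
  also have "(\<Sum>l=1..s. \<Sum>m\<in>F'. v m ** (real_of_int \<bar>det (M l)\<bar> *\<^sub>R time_kernel (b l) (tb l) (M l) (n - m) n))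
     = (\<Sum>m\<in>F'. v m ** (\<Sum>l=1..s. real_of_int \<bar>det (M l)\<bar> *\<^sub>R time_kernel (b l) (tb l) (M l) (n - m) n))"
    unfolding mm.sum_right by (rule sum.swap)
  finally show "reconstruct v n = (\<Sum>m\<in>F'. v m ** total_time_kernel (n - m) n)"
    by (simp add: total_time_kernel_def mm.add_right mm.scaleR_right scaleR_sum_right sum.distrib)
qed

lemma reconstruct_iff_time:
  "(\<forall>v \<in> l2_rows. reconstruct v = v) \<longleftrightarrow> (\<forall>p n. total_time_kernel p n = mat (delta p))"
proof
  assume time: "\<forall>p n. total_time_kernel p n = mat (delta p)"
  have "reconstruct v n = v n" for v :: "int^'d \<Rightarrow> complex^'r^1" and n
  proof -
    obtain F where F: "finite F" "\<And>F'. finite F' \<Longrightarrow> F \<subseteq> F' \<Longrightarrow> reconstruct v n = (\<Sum>m\<in>F'. v m ** total_time_kernel (n - m) n)"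
      using reconstruct_eq by blast
    have "reconstruct v n = (\<Sum>m\<in>insert n F. v m ** mat (delta (n - m)))"
      using F(2)[of "insert n F"] F(1) time by auto
    also have "\<dots> = (\<Sum>m\<in>{n}. v m ** mat (delta (n - m)))"
      using F(1) by (intro sum.mono_neutral_right) (auto simp: delta_def)
    finally show ?thesis by (simp add: delta_def)
  qed
  then show "\<forall>v \<in> l2_rows. reconstruct v = v" by blast
next
  assume rec: "\<forall>v \<in> l2_rows. reconstruct v = v"
  show "\<forall>p n. total_time_kernel p n = mat (delta p)"
  proof (intro allI)
    fix p n
    have row: "X ** total_time_kernel p n = X ** mat (delta p)" for X :: "complex^'r^1"
    proof -
      \<comment> \<open>An impulse at n - p picks the single kernel matrix with arguments p and
        n.\<close>
      let ?v = "\<lambda>k. if k = n - p then X else 0"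
      have "?v \<in> l0_seqs" unfolding l0_seqs_def by (auto intro: finite_subset[of _ "{n - p}"])
      then have "?v \<in> l2_seqs" by (rule l0_subset_l2)
      then have "reconstruct ?v = ?v" using rec by blast
      then have eq: "reconstruct ?v n = ?v n" by (rule fun_cong)
      obtain F where F: "finite F" "\<And>F'. finite F' \<Longrightarrow> F \<subseteq> F' \<Longrightarrow> reconstruct ?v n = (\<Sum>m\<in>F'. ?v m ** total_time_kernel (n - m) n)"
        using reconstruct_eq by blast
      have "reconstruct ?v n = (\<Sum>m\<in>insert (n - p) F. ?v m ** total_time_kernel (n - m) n)"
        using F(1) by (intro F(2)) auto
      also have "\<dots> = (\<Sum>m\<in>{n - p}. ?v m ** total_time_kernel (n - m) n)"
        using F(1) by (intro sum.mono_neutral_right) auto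
      finally have "reconstruct ?v n = X ** total_time_kernel p n" by simp
      then show ?thesis using eq by (auto simp: delta_def)
    qed
    have "total_time_kernel p n $ i $ j = mat (delta p) $ i $ j" for i j
    proof -
      \<comment> \<open>The signals are rows, so the kernel is only known after multiplication by a
        row X; unit rows recover its entries.\<close>
      have "((\<chi> a c. if c = i then 1 else 0) ** A :: complex^'r^1) $ 1 $ j = A $ i $ j" for A :: "complex^'r^'r"
        by (simp add: matrix_matrix_mult_def mult_delta_left)
      from this[of "total_time_kernel p n"] this[of "mat (delta p)"] show ?thesis by (simp add: row)
    qed
    then show "total_time_kernel p n = mat (delta p)" by (simp add: vec_eq_iff)
  qed
qed

lemma dual_iff_reconstruct:
  "dual_framelet_filter_bank s M b0 b tb0 tb \<longleftrightarrow> (\<forall>v \<in> l2_rows. reconstruct v = v)"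
  unfolding dual_iff_freq reconstruct_iff_time using time_iff_freq by blast

end

subsection \<open>Series of shifted filters\<close>

lemma tendsto_l2_tail:
  assumes "c \<in> l2_seqs"
  shows "((\<lambda>K. l2_normsq (\<lambda>k. if k \<in> K then 0 else c k)) \<longlongrightarrow> 0) (finite_subsets_at_top UNIV)"
proof -
  have summ: "(\<lambda>k. (norm (c k))\<^sup>2) summable_on UNIV" using assms by (simp add: l2_seqs_def)
  have tail: "l2_normsq (\<lambda>k. if k \<in> K then 0 else c k) = l2_normsq c - (\<Sum>k\<in>K. (norm (c k))\<^sup>2)" if "finite K" for K
  proof -
    have "l2_normsq (\<lambda>k. if k \<in> K then 0 else c k) = (\<Sum>\<^sub>\<infinity>k\<in>- K. (norm (c k))\<^sup>2)"
      unfolding l2_normsq_def by (intro infsum_cong_neutral) auto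
    moreover have "l2_normsq c = (\<Sum>\<^sub>\<infinity>k\<in>K \<union> - K. (norm (c k))\<^sup>2)" by (simp add: l2_normsq_def)
    moreover have "\<dots> = (\<Sum>\<^sub>\<infinity>k\<in>K. (norm (c k))\<^sup>2) + (\<Sum>\<^sub>\<infinity>k\<in>- K. (norm (c k))\<^sup>2)"
      by (rule infsum_Un_disjoint) (auto intro: summable_on_subset_banach[OF summ])
    ultimately show ?thesis using that by simp
  qed
  have "((\<lambda>K. \<Sum>k\<in>K. (norm (c k))\<^sup>2) \<longlongrightarrow> l2_normsq c) (finite_subsets_at_top UNIV)"
    using has_sum_infsum[OF summ] by (simp add: has_sum_def l2_normsq_def)
  then have "((\<lambda>K. l2_normsq c - (\<Sum>k\<in>K. (norm (c k))\<^sup>2)) \<longlongrightarrow> l2_normsq c - l2_normsq c) (finite_subsets_at_top UNIV)"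
    by (intro tendsto_diff tendsto_const)
  then show ?thesis
    by (subst tendsto_cong[where g = "\<lambda>K. l2_normsq c - (\<Sum>k\<in>K. (norm (c k))\<^sup>2)"])
      (auto intro: eventually_finite_subsets_at_top_weakI tail)
qed

text \<open>The error left by a finite set K of terms is again a synthesis, namely of c with its
  entries in K set to 0. The uniform bound reduces convergence to that of the tails of c, which
  gives unconditional convergence.\<close>

lemma l2_has_sum_synthesis:
  fixes c :: "int^'d \<Rightarrow> complex^'p^'t" and g :: "int^'d \<Rightarrow> complex^'r^'p"
  assumes N: "inj ((*v) N)" and g: "g \<in> l0_seqs" and c: "c \<in> l2_seqs"
  shows "l2_has_sum (\<lambda>k n. c k ** g (n - N *v k)) (synthesis g N c)"
  unfolding l2_has_sum_def
proof (intro conjI allI)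
  show "(\<lambda>n. c k ** g (n - N *v k)) \<in> l2_seqs" for k
  proof (rule l2_seqsI_bounded_linear[OF _ mm.bounded_linear_right])
    have "inj (\<lambda>n. n - N *v k)" by (simp add: inj_def)
    then show "(\<lambda>n. g (n - N *v k)) \<in> l2_seqs" by (rule l2_reindex[OF l0_subset_l2[OF g]])
  qed
  show "synthesis g N c \<in> l2_seqs" by (rule synthesis_l2[OF c N])
  obtain C where C: "\<And>c :: int^'d \<Rightarrow> complex^'p^'t. c \<in> l2_seqs \<Longrightarrow> l2_normsq (synthesis g N c) \<le> C * l2_normsq c"
    using synthesis_bound[OF g N] by blast
  let ?off = "\<lambda>K k. if k \<in> K then 0 else c k"
  have off: "?off K \<in> l2_seqs" for K
    by (rule l2_normsq_reindex_le[OF c, of id "- K"]) auto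
  have eq: "(\<lambda>n. synthesis g N c n - (\<Sum>k\<in>K. c k ** g (n - N *v k))) = synthesis g N (?off K)" if K: "finite K" for K
  proof
    fix n
    let ?I = "K \<union> {k. n - N *v k \<in> seq_support g}"
    have fin: "finite ?I" using K finite_synthesis_index[OF N g] by simp
    have "synthesis g N h n = (\<Sum>k\<in>?I. h k ** g (n - N *v k))" for h :: "int^'d \<Rightarrow> complex^'p^'t"
      by (rule synthesis_eq_sum[OF N fin _ g]) simp
    moreover have "(\<Sum>k\<in>K. c k ** g (n - N *v k)) = (\<Sum>k\<in>?I. if k \<in> K then c k ** g (n - N *v k) else 0)"
      using fin by (simp add: sum.If_cases Int_absorb1)
    ultimately show "synthesis g N c n - (\<Sum>k\<in>K. c k ** g (n - N *v k)) = synthesis g N (?off K) n"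
      by (simp flip: sum_subtractf) (intro sum.cong; simp)
  qed
  show "((\<lambda>K. l2_normsq (\<lambda>n. synthesis g N c n - (\<Sum>k\<in>K. c k ** g (n - N *v k)))) \<longlongrightarrow> 0)
      (finite_subsets_at_top UNIV)"
  proof (rule tendsto_sandwich[OF _ _ tendsto_const])
    show "((\<lambda>K. C * l2_normsq (?off K)) \<longlongrightarrow> 0) (finite_subsets_at_top UNIV)"
      using tendsto_mult_right_zero[OF tendsto_l2_tail[OF c]] .
    show "\<forall>\<^sub>F K in finite_subsets_at_top UNIV.
        l2_normsq (\<lambda>n. synthesis g N c n - (\<Sum>k\<in>K. c k ** g (n - N *v k))) \<le> C * l2_normsq (?off K)"
      by (intro eventually_finite_subsets_at_top_weakI) (simp add: eq C off)
  qed simp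
qed

lemma l2_has_sum_imp_pointwise:
  assumes "l2_has_sum f x" shows "((\<lambda>k. f k n) has_sum x n) UNIV"
proof -
  have l2: "\<And>k. f k \<in> l2_seqs" "x \<in> l2_seqs"
    and lim: "((\<lambda>K. l2_normsq (\<lambda>n. x n - (\<Sum>k\<in>K. f k n))) \<longlongrightarrow> 0) (finite_subsets_at_top UNIV)"
    using assms by (auto simp: l2_has_sum_def)
  have le: "(norm (x n - (\<Sum>k\<in>K. f k n)))\<^sup>2 \<le> l2_normsq (\<lambda>n. x n - (\<Sum>k\<in>K. f k n))" for K
    by (rule norm_sq_le_l2_normsq) (intro l2_diff l2_sum l2)
  have "((\<lambda>K. (norm (x n - (\<Sum>k\<in>K. f k n)))\<^sup>2) \<longlongrightarrow> 0) (finite_subsets_at_top UNIV)"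
    by (rule tendsto_sandwich[OF _ _ tendsto_const lim]) (simp_all add: le)
  from tendsto_real_sqrt[OF this] have "((\<lambda>K. norm (x n - (\<Sum>k\<in>K. f k n))) \<longlongrightarrow> 0) (finite_subsets_at_top UNIV)"
    by simp
  from tendsto_diff[OF tendsto_const[of "x n"] tendsto_norm_zero_cancel[OF this]] show ?thesis by (simp add: has_sum_def)
qed

text \<open>Convergence in l_2 implies convergence at every point, where the series has only
  finitely many nonzero terms. So a limit that is merely assumed to exist is identified.\<close>

lemma l2_has_sum_synthesis_unique:
  assumes "inj ((*v) N)" "g \<in> l0_seqs" "l2_has_sum (\<lambda>k n. c k ** g (n - N *v k)) x"
  shows "x = synthesis g N c"
proof
  fix n show "x n = synthesis g N c n"
    using has_sum_unique[OF l2_has_sum_imp_pointwise[OF assms(3)] synthesis_has_sum[OF assms(1,2)]] .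
qed

lemma transition_op_l2:
  assumes "b \<in> l0_seqs" "inj ((*v) M)" "v \<in> l2_seqs" shows "transition_op b M v \<in> l2_seqs"
proof -
  have "transition_op b M v = (\<lambda>n. sqrt (real_of_int \<bar>det M\<bar>) *\<^sub>R analysis b M v n)"
    using transition_op_eq_analysis[OF assms(1)] by (rule ext)
  then show ?thesis using l2_scaleR[OF analysis_l2[OF assms(3,2)]] by simp
qed

lemma low_coeffs_l2:
  assumes "b0 \<in> l0_seqs" "inj ((*v) M0)" "v \<in> l2_seqs" shows "low_coeffs b0 M0 v j \<in> l2_seqs"
  by (induction j) (simp_all add: assms transition_op_l2)

text \<open>The two square roots combine to |det M|, and the dual analysis moves to the left as a
  synthesis. The sum of these terms over the bank is \<open>reconstruct\<close>.\<close>

lemma seq_inner_transition_op: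
  assumes "b \<in> l0_seqs" "tb \<in> l0_seqs" "inj ((*v) M)" "v \<in> l2_seqs" "w \<in> l2_seqs"
  shows "seq_inner (transition_op b M v) (transition_op tb M w)
    = seq_inner (\<lambda>n. real_of_int \<bar>det M\<bar> *\<^sub>R synthesis tb M (analysis b M v) n) w"
proof -
  have "transition_op b M v = (\<lambda>n. sqrt (real_of_int \<bar>det M\<bar>) *\<^sub>R analysis b M v n)"
    "transition_op tb M w = (\<lambda>n. sqrt (real_of_int \<bar>det M\<bar>) *\<^sub>R analysis tb M w n)"
    using transition_op_eq_analysis assms(1,2) by blast+
  then show ?thesis
    by (simp add: seq_inner_scaleR seq_inner_scaleR_left seq_inner_analysis[OF assms(3,2) analysis_l2[OF assms(4,3)] assms(5)]
        del: of_int_abs)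
qed

definition level_sum where
  "level_sum b0 M0 bl Ml j c = synthesis (level_generator b0 M0 bl Ml j) (matpow M0 (j - 1) ** Ml) c"

context
  fixes b0 :: "int^'d \<Rightarrow> complex^'r^'r" and M0 :: "int^'d^'d"
    and bl :: "int^'d \<Rightarrow> complex^'r^'p" and Ml :: "int^'d^'d" and c :: "int^'d \<Rightarrow> complex^'p^'t"
  assumes l0: "b0 \<in> l0_seqs" "bl \<in> l0_seqs" and det: "det M0 \<noteq> 0" "det Ml \<noteq> 0"
begin

lemma inj_level: "inj ((*v) (matpow M0 (j - 1) ** Ml))"
  by (rule inj_mult_int_matrix) (simp add: det_mul det_matpow det)

lemma l2_has_sum_level_elem_unique:
  assumes "l2_has_sum (\<lambda>k n. c k ** level_elem b0 M0 bl Ml j k n) x"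
  shows "x = level_sum b0 M0 bl Ml j c"
  using l2_has_sum_synthesis_unique[OF inj_level level_generator_l0[OF l0]] assms
  by (simp add: level_elem_eq[OF l0] level_sum_def)

lemma l2_has_sum_level_elem:
  assumes "c \<in> l2_seqs"
  shows "l2_has_sum (\<lambda>k n. c k ** level_elem b0 M0 bl Ml j k n) (level_sum b0 M0 bl Ml j c)"
  using l2_has_sum_synthesis[OF inj_level level_generator_l0[OF l0] assms]
  by (simp add: level_elem_eq[OF l0] level_sum_def)

text \<open>Adjointness of synthesis and analysis; analysing with the generator is the iterated
  transition operator, as both compute the inner products with the elements
  \<open>level_elem\<close>.\<close>

lemma seq_inner_level_sum:
  assumes "c \<in> l2_seqs" "w \<in> l2_seqs" "j \<ge> 1"
  shows "seq_inner (level_sum b0 M0 bl Ml j c) w = seq_inner c (transition_op bl Ml (low_coeffs b0 M0 w (j - 1)))"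
proof -
  have "analysis (level_generator b0 M0 bl Ml j) (matpow M0 (j - 1) ** Ml) w k
      = transition_op bl Ml (low_coeffs b0 M0 w (j - 1)) k" for k
    unfolding seq_inner_level_elem[OF l0 det(1) assms(3), symmetric] level_elem_eq[OF l0]
    by (rule seq_inner_shift[OF level_generator_l0[OF l0], symmetric])
  then have "analysis (level_generator b0 M0 bl Ml j) (matpow M0 (j - 1) ** Ml) w
      = transition_op bl Ml (low_coeffs b0 M0 w (j - 1))" by (rule ext)
  then show ?thesis
    unfolding level_sum_def
    using seq_inner_analysis[OF inj_level level_generator_l0[OF l0] assms(1,2)] by metis
qed

end

section \<open>Statements (ii), (iii) and (iv) through transition operators\<close>

context filter_bank
begin

abbreviation low_of where "low_of v j \<equiv> low_coeffs b0 (M 0) v j"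
abbreviation tlow_of where "tlow_of v j \<equiv> low_coeffs tb0 (M 0) v j"
abbreviation high_of where "high_of v j l \<equiv> transition_op (b l) (M l) (low_of v (j - 1))"
abbreviation thigh_of where "thigh_of v j l \<equiv> transition_op (tb l) (M l) (tlow_of v (j - 1))"

text \<open>The second factor is the conjugate transpose of the inner product of w with the dual
  element, so the series is literally that of a \<open>seq_inner\<close>.\<close>

lemma low_pairing:
  "(\<Sum>\<^sub>\<infinity>k. seq_inner v (low_elem b0 (M 0) j k) ** seq_inner (low_elem tb0 (M 0) j k) w)
    = seq_inner (low_of v j) (tlow_of w j)"
  unfolding seq_inner_def[of "low_of v j"]
  by (subst conj_transpose_seq_inner[symmetric, of _ w])
    (simp only: seq_inner_low_elem[OF low_l0(1) det_M(1)] seq_inner_low_elem[OF low_l0(2) det_M(1)])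

lemma high_pairing:
  assumes "j \<ge> 1" "l \<in> {1..s}"
  shows "(\<Sum>\<^sub>\<infinity>k. seq_inner v (level_elem b0 (M 0) (b l) (M l) j k)
      ** seq_inner (level_elem tb0 (M 0) (tb l) (M l) j k) w) = seq_inner (high_of v j l) (thigh_of w j l)"
  unfolding seq_inner_def[of "high_of v j l"]
  by (subst conj_transpose_seq_inner[symmetric, of _ w])
    (simp only: seq_inner_level_elem[OF low_l0(1) high_l0(1)[OF assms(2)] det_M(1) assms(1)]
      seq_inner_level_elem[OF low_l0(2) high_l0(2)[OF assms(2)] det_M(1) assms(1)])

lemma low_of_l2: "v \<in> l2_seqs \<Longrightarrow> low_of v j \<in> l2_seqs"
  by (rule low_coeffs_l2[OF low_l0(1) inj_M(1)])

lemma tlow_of_l2: "v \<in> l2_seqs \<Longrightarrow> tlow_of v j \<in> l2_seqs"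
  by (rule low_coeffs_l2[OF low_l0(2) inj_M(1)])

lemma high_of_l2: "v \<in> l2_seqs \<Longrightarrow> l \<in> {1..s} \<Longrightarrow> high_of v j l \<in> l2_seqs"
  by (intro transition_op_l2 high_l0 inj_M low_of_l2)

text \<open>(ii) without the elements b_{l,1;k}. As it quantifies over all pairs, it can be applied
  again to the low-pass coefficients of v and w, which is the step of the cascade.\<close>

definition one_level_identity :: bool where
  "one_level_identity \<longleftrightarrow> (\<forall>v\<in>l2_rows. \<forall>w\<in>l2_rows. seq_inner v w =
    seq_inner (transition_op b0 (M 0) v) (transition_op tb0 (M 0) w)
    + (\<Sum>l=1..s. seq_inner (transition_op (b l) (M l) v) (transition_op (tb l) (M l) w)))"

lemma reconstruct_l2:
  assumes "v \<in> l2_seqs" shows "reconstruct v \<in> l2_seqs"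
proof -
  have "(\<lambda>n. real_of_int \<bar>det (M 0)\<bar> *\<^sub>R synthesis tb0 (M 0) (analysis b0 (M 0) v) n) \<in> l2_seqs"
    by (intro l2_scaleR synthesis_l2 analysis_l2 assms inj_M)
  moreover have "(\<lambda>n. \<Sum>l=1..s. real_of_int \<bar>det (M l)\<bar> *\<^sub>R synthesis (tb l) (M l) (analysis (b l) (M l) v) n) \<in> l2_seqs"
    by (intro l2_sum l2_scaleR synthesis_l2 analysis_l2 assms inj_M)
  ultimately show ?thesis unfolding reconstruct_def[abs_def] by (rule l2_add(1))
qed

lemma seq_inner_reconstruct:
  assumes v: "v \<in> l2_seqs" and w: "w \<in> l2_seqs"
  shows "seq_inner (reconstruct v) w =
    seq_inner (transition_op b0 (M 0) v) (transition_op tb0 (M 0) w)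
    + (\<Sum>l=1..s. seq_inner (transition_op (b l) (M l) v) (transition_op (tb l) (M l) w))"
proof -
  have low: "(\<lambda>n. real_of_int \<bar>det (M 0)\<bar> *\<^sub>R synthesis tb0 (M 0) (analysis b0 (M 0) v) n) \<in> l2_seqs"
    by (intro l2_scaleR synthesis_l2 analysis_l2 v inj_M)
  have high: "(\<lambda>n. real_of_int \<bar>det (M l)\<bar> *\<^sub>R synthesis (tb l) (M l) (analysis (b l) (M l) v) n) \<in> l2_seqs"
    if "l \<in> {1..s}" for l
    using that by (intro l2_scaleR synthesis_l2 analysis_l2 v inj_M)
  have "(\<Sum>l=1..s. seq_inner (transition_op (b l) (M l) v) (transition_op (tb l) (M l) w))
     = (\<Sum>l=1..s. seq_inner (\<lambda>n. real_of_int \<bar>det (M l)\<bar> *\<^sub>R synthesis (tb l) (M l) (analysis (b l) (M l) v) n) w)"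
    by (intro sum.cong seq_inner_transition_op high_l0 inj_M v w refl)
  moreover have "seq_inner (reconstruct v) w =
      seq_inner (\<lambda>n. real_of_int \<bar>det (M 0)\<bar> *\<^sub>R synthesis tb0 (M 0) (analysis b0 (M 0) v) n) w
      + seq_inner (\<lambda>n. \<Sum>l=1..s. real_of_int \<bar>det (M l)\<bar> *\<^sub>R synthesis (tb l) (M l) (analysis (b l) (M l) v) n) w"
    unfolding reconstruct_def[abs_def] by (rule seq_inner_add_left[OF low l2_sum[OF high] w])
  moreover have "seq_inner (\<lambda>n. \<Sum>l=1..s. real_of_int \<bar>det (M l)\<bar> *\<^sub>R synthesis (tb l) (M l) (analysis (b l) (M l) v) n) w
      = (\<Sum>l=1..s. seq_inner (\<lambda>n. real_of_int \<bar>det (M l)\<bar> *\<^sub>R synthesis (tb l) (M l) (analysis (b l) (M l) v) n) w)"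
    by (rule seq_inner_sum_left[OF high w])
  ultimately show ?thesis
    by (simp only: seq_inner_transition_op[OF low_l0 inj_M(1) v w])
qed

text \<open>The identity is the weak form of \<open>reconstruct v = v\<close>, and
  \<open>l2_eqI\<close> turns weak into strong.\<close>

lemma dual_iff_one_level: "dual_framelet_filter_bank s M b0 b tb0 tb \<longleftrightarrow> one_level_identity"
  unfolding dual_iff_reconstruct
proof
  assume rec: "\<forall>v\<in>l2_rows. reconstruct v = v"
  show one_level_identity
    unfolding one_level_identity_def
  proof (intro ballI)
    fix v w :: "int^'d \<Rightarrow> complex^'r^1" assume v: "v \<in> l2_rows" and w: "w \<in> l2_rows"
    have "reconstruct v = v" using rec v by blast
    then show "seq_inner v w = seq_inner (transition_op b0 (M 0) v) (transition_op tb0 (M 0) w)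
      + (\<Sum>l=1..s. seq_inner (transition_op (b l) (M l) v) (transition_op (tb l) (M l) w))"
      using seq_inner_reconstruct[OF v w] by (simp only:)
  qed
next
  assume id: one_level_identity
  show "\<forall>v\<in>l2_rows. reconstruct v = v"
  proof
    fix v :: "int^'d \<Rightarrow> complex^'r^1" assume v: "v \<in> l2_rows"
    show "reconstruct v = v"
      by (rule l2_eqI[OF reconstruct_l2[OF v] v])
        (use id v in \<open>simp add: one_level_identity_def seq_inner_reconstruct\<close>)
  qed
qed

lemma dual_iff_single_level:
  "dual_framelet_filter_bank s M b0 b tb0 tb \<longleftrightarrow>
     (\<forall>v\<in>l2_rows. \<forall>w\<in>l2_rows.
        seq_inner v w =
          (\<Sum>\<^sub>\<infinity>k. seq_inner v (low_elem b0 (M 0) 1 k) ** seq_inner (low_elem tb0 (M 0) 1 k) w)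
          + (\<Sum>l=1..s. \<Sum>\<^sub>\<infinity>k. seq_inner v (level_elem b0 (M 0) (b l) (M l) 1 k)
                              ** seq_inner (level_elem tb0 (M 0) (tb l) (M l) 1 k) w))"
  unfolding dual_iff_one_level one_level_identity_def low_pairing by (simp add: high_pairing)

lemma one_level_imp_cascade:
  assumes "one_level_identity" "v \<in> l2_rows" "w \<in> l2_rows" "j \<ge> 1"
  shows "seq_inner (low_of v (j - 1)) (tlow_of w (j - 1)) =
    seq_inner (low_of v j) (tlow_of w j) + (\<Sum>l=1..s. seq_inner (high_of v j l) (thigh_of w j l))"
proof -
  obtain i where "j = Suc i" using assms(4) by (cases j) auto
  then show ?thesis
    using assms(1) low_of_l2[OF assms(2)] tlow_of_l2[OF assms(3)] by (simp add: one_level_identity_def)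
qed

lemma one_level_imp_multilevel:
  assumes "one_level_identity" "v \<in> l2_rows" "w \<in> l2_rows"
  shows "seq_inner v w = seq_inner (low_of v J) (tlow_of w J)
    + (\<Sum>j=1..J. \<Sum>l=1..s. seq_inner (high_of v j l) (thigh_of w j l))"
proof (induction J)
  case (Suc J)
  then show ?case using one_level_imp_cascade[OF assms, of "Suc J"] by simp
qed simp

lemma dual_iff_multilevel:
  "dual_framelet_filter_bank s M b0 b tb0 tb \<longleftrightarrow>
     (\<forall>J\<ge>1. \<forall>v\<in>l2_rows. \<forall>w\<in>l2_rows.
        seq_inner v w =
          (\<Sum>\<^sub>\<infinity>k. seq_inner v (low_elem b0 (M 0) J k) ** seq_inner (low_elem tb0 (M 0) J k) w)
          + (\<Sum>j=1..J. \<Sum>l=1..s. \<Sum>\<^sub>\<infinity>k. seq_inner v (level_elem b0 (M 0) (b l) (M l) j k)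
                              ** seq_inner (level_elem tb0 (M 0) (tb l) (M l) j k) w))"
    (is "_ \<longleftrightarrow> ?rhs")
proof
  assume "dual_framelet_filter_bank s M b0 b tb0 tb"
  then show ?rhs
    unfolding dual_iff_one_level low_pairing using one_level_imp_multilevel by (simp add: high_pairing)
next
  assume rhs: ?rhs
  show "dual_framelet_filter_bank s M b0 b tb0 tb"
    \<comment> \<open>For J = 1 the sum over j consists of j = 1 alone, which is (ii).\<close>
    unfolding dual_iff_single_level using spec[OF rhs, of 1] by simp
qed

lemma dual_iff_cascade:
  "dual_framelet_filter_bank s M b0 b tb0 tb \<longleftrightarrow>
     (\<forall>j\<ge>1. \<forall>v\<in>l2_rows. \<forall>w\<in>l2_rows.
        (\<Sum>\<^sub>\<infinity>k. seq_inner v (low_elem b0 (M 0) (j - 1) k)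
               ** seq_inner (low_elem tb0 (M 0) (j - 1) k) w) =
          (\<Sum>\<^sub>\<infinity>k. seq_inner v (low_elem b0 (M 0) j k) ** seq_inner (low_elem tb0 (M 0) j k) w)
          + (\<Sum>l=1..s. \<Sum>\<^sub>\<infinity>k. seq_inner v (level_elem b0 (M 0) (b l) (M l) j k)
                              ** seq_inner (level_elem tb0 (M 0) (tb l) (M l) j k) w))"
    (is "_ \<longleftrightarrow> ?rhs")
proof
  assume "dual_framelet_filter_bank s M b0 b tb0 tb"
  then show ?rhs
    unfolding dual_iff_one_level low_pairing using one_level_imp_cascade by (simp add: high_pairing)
next
  assume rhs: ?rhs
  \<comment> \<open>At j = 1 the left-hand side lives on level 0, where the low-pass coefficients of
    v and w are v and w themselves.\<close>
  show "dual_framelet_filter_bank s M b0 b tb0 tb"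
    unfolding dual_iff_one_level one_level_identity_def
    using spec[OF rhs, of 1] unfolding low_pairing by (simp add: high_pairing)
qed

section \<open>The expansion (v)\<close>

lemma low_elem_pos: "J \<ge> 1 \<Longrightarrow> low_elem c0 (M 0) J = level_elem c0 (M 0) c0 (M 0) J"
  by (simp add: low_elem_def fun_eq_iff)

lemma low_of_pos: "J \<ge> 1 \<Longrightarrow> transition_op c0 (M 0) (low_coeffs c0 (M 0) v (J - 1)) = low_coeffs c0 (M 0) v J"
  by (cases J) auto

text \<open>Serves both directions of (v): arbitrary limits x and y are identified as syntheses by
  uniqueness, and pairing with w then gives the right-hand side of (iii).\<close>

lemma seq_inner_expansion:
  assumes v: "v \<in> l2_rows" and w: "w \<in> l2_rows" and J: "J \<ge> 1"
    and x: "l2_has_sum (\<lambda>k n. seq_inner v (low_elem b0 (M 0) J k) ** low_elem tb0 (M 0) J k n) x"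
    and y: "\<And>j l. j \<in> {1..J} \<Longrightarrow> l \<in> {1..s} \<Longrightarrow>
      l2_has_sum (\<lambda>k n. seq_inner v (level_elem b0 (M 0) (b l) (M l) j k) ** level_elem tb0 (M 0) (tb l) (M l) j k n) (y j l)"
  shows "seq_inner (\<lambda>n. x n + (\<Sum>j=1..J. \<Sum>l=1..s. y j l n)) w =
    seq_inner (low_of v J) (tlow_of w J) + (\<Sum>j=1..J. \<Sum>l=1..s. seq_inner (high_of v j l) (thigh_of w j l))"
proof -
  have x': "x = level_sum tb0 (M 0) tb0 (M 0) J (low_of v J)"
    by (rule l2_has_sum_level_elem_unique[OF low_l0(2,2) det_M(1,1)])
      (use x J in \<open>simp add: seq_inner_low_elem[OF low_l0(1) det_M(1)] low_elem_pos[of _ tb0]\<close>)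
  have y': "y j l = level_sum tb0 (M 0) (tb l) (M l) j (high_of v j l)" if j: "j \<in> {1..J}" and l: "l \<in> {1..s}" for j l
    by (rule l2_has_sum_level_elem_unique[OF low_l0(2) high_l0(2)[OF l] det_M(1) det_M(2)[OF l]])
      (use y[OF j l] j in \<open>simp add: seq_inner_level_elem[OF low_l0(1) high_l0(1)[OF l] det_M(1)]\<close>)
  have xi: "seq_inner x w = seq_inner (low_of v J) (tlow_of w J)"
    unfolding x' using seq_inner_level_sum[OF low_l0(2,2) det_M(1,1) low_of_l2[OF v] w J]
    by (simp only: low_of_pos[OF J])
  have yi: "seq_inner (y j l) w = seq_inner (high_of v j l) (thigh_of w j l)" if j: "j \<in> {1..J}" and l: "l \<in> {1..s}" for j l
    unfolding y'[OF j l]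
    using seq_inner_level_sum[OF low_l0(2) high_l0(2)[OF l] det_M(1) det_M(2)[OF l] high_of_l2[OF v l] w, of j j] j by simp
  have xl: "x \<in> l2_seqs" using x by (simp add: l2_has_sum_def)
  have yl: "y j l \<in> l2_seqs" if "j \<in> {1..J}" "l \<in> {1..s}" for j l using y[OF that] by (simp add: l2_has_sum_def)
  have yjl: "(\<lambda>n. \<Sum>l=1..s. y j l n) \<in> l2_seqs" if "j \<in> {1..J}" for j
    by (rule l2_sum) (rule yl[OF that])
  have "seq_inner (\<lambda>n. x n + (\<Sum>j=1..J. \<Sum>l=1..s. y j l n)) w
      = seq_inner x w + seq_inner (\<lambda>n. \<Sum>j=1..J. \<Sum>l=1..s. y j l n) w"
    by (rule seq_inner_add_left[OF xl l2_sum[OF yjl] w])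
  also have "seq_inner (\<lambda>n. \<Sum>j=1..J. \<Sum>l=1..s. y j l n) w = (\<Sum>j=1..J. seq_inner (\<lambda>n. \<Sum>l=1..s. y j l n) w)"
    by (rule seq_inner_sum_left[OF yjl w])
  also have "\<dots> = (\<Sum>j=1..J. \<Sum>l=1..s. seq_inner (y j l) w)"
    by (rule sum.cong[OF refl]) (rule seq_inner_sum_left[OF yl w])
  finally have "seq_inner (\<lambda>n. x n + (\<Sum>j=1..J. \<Sum>l=1..s. y j l n)) w = seq_inner x w + (\<Sum>j=1..J. \<Sum>l=1..s. seq_inner (y j l) w)" .
  then show ?thesis by (simp add: xi yi)
qed

text \<open>The series converge to their syntheses. Their sum lies in l_2 and has the same inner
  products as v by (iii), hence equals v.\<close>

lemma dual_imp_expansion: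
  assumes dual: "dual_framelet_filter_bank s M b0 b tb0 tb" and J: "J \<ge> 1" and v: "v \<in> l2_rows"
  shows "\<exists>x y.
      l2_has_sum (\<lambda>k n. seq_inner v (low_elem b0 (M 0) J k) ** low_elem tb0 (M 0) J k n) x \<and>
      (\<forall>j\<in>{1..J}. \<forall>l\<in>{1..s}.
         l2_has_sum (\<lambda>k n. seq_inner v (level_elem b0 (M 0) (b l) (M l) j k)
                           ** level_elem tb0 (M 0) (tb l) (M l) j k n) (y j l)) \<and>
      v = (\<lambda>n. x n + (\<Sum>j=1..J. \<Sum>l=1..s. y j l n))"
proof -
  let ?x = "level_sum tb0 (M 0) tb0 (M 0) J (low_of v J)"
    and ?y = "\<lambda>j l. level_sum tb0 (M 0) (tb l) (M l) j (high_of v j l)"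
  have x: "l2_has_sum (\<lambda>k n. seq_inner v (low_elem b0 (M 0) J k) ** low_elem tb0 (M 0) J k n) ?x"
    unfolding seq_inner_low_elem[OF low_l0(1) det_M(1)] unfolding low_elem_pos[OF J]
    by (rule l2_has_sum_level_elem[OF low_l0(2,2) det_M(1,1) low_of_l2[OF v]])
  have y: "l2_has_sum (\<lambda>k n. seq_inner v (level_elem b0 (M 0) (b l) (M l) j k) ** level_elem tb0 (M 0) (tb l) (M l) j k n) (?y j l)"
    if j: "j \<in> {1..J}" and l: "l \<in> {1..s}" for j l
  proof -
    have "j \<ge> 1" using j by simp
    show ?thesis
      unfolding seq_inner_level_elem[OF low_l0(1) high_l0(1)[OF l] det_M(1) \<open>j \<ge> 1\<close>]
      by (rule l2_has_sum_level_elem[OF low_l0(2) high_l0(2)[OF l] det_M(1) det_M(2)[OF l] high_of_l2[OF v l]])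
  qed
  have "?x \<in> l2_seqs" using x by (simp add: l2_has_sum_def)
  moreover have "?y j l \<in> l2_seqs" if "j \<in> {1..J}" "l \<in> {1..s}" for j l
    using y[OF that] by (simp add: l2_has_sum_def)
  ultimately have l2: "(\<lambda>n. ?x n + (\<Sum>j=1..J. \<Sum>l=1..s. ?y j l n)) \<in> l2_seqs"
    by (intro l2_add(1) l2_sum)
  have "v = (\<lambda>n. ?x n + (\<Sum>j=1..J. \<Sum>l=1..s. ?y j l n))"
  proof (rule l2_eqI[OF v l2])
    fix w :: "int^'d \<Rightarrow> complex^'r^1" assume w: "w \<in> l2_seqs"
    show "seq_inner v w = seq_inner (\<lambda>n. ?x n + (\<Sum>j=1..J. \<Sum>l=1..s. ?y j l n)) w"
    proof (rule trans[OF _ sym])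
      show "seq_inner (\<lambda>n. ?x n + (\<Sum>j=1..J. \<Sum>l=1..s. ?y j l n)) w = seq_inner (low_of v J) (tlow_of w J)
          + (\<Sum>j=1..J. \<Sum>l=1..s. seq_inner (high_of v j l) (thigh_of w j l))"
        by (rule seq_inner_expansion[where y = ?y, OF v w J x y])
    qed (use one_level_imp_multilevel[OF _ v w] dual in \<open>simp add: dual_iff_one_level\<close>)
  qed
  with x y show ?thesis by (intro exI[of _ ?x] exI[of _ ?y]) blast
qed

text \<open>Pairing the expansion for J = 1 with an arbitrary w returns the one-level
  identity.\<close>

lemma expansion_imp_dual:
  assumes "\<forall>v\<in>l2_rows. \<exists>x y.
      l2_has_sum (\<lambda>k n. seq_inner v (low_elem b0 (M 0) 1 k) ** low_elem tb0 (M 0) 1 k n) x \<and>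
      (\<forall>j\<in>{1..1}. \<forall>l\<in>{1..s}.
         l2_has_sum (\<lambda>k n. seq_inner v (level_elem b0 (M 0) (b l) (M l) j k)
                           ** level_elem tb0 (M 0) (tb l) (M l) j k n) (y j l)) \<and>
      v = (\<lambda>n. x n + (\<Sum>j=1..1. \<Sum>l=1..s. y j l n))"
  shows "dual_framelet_filter_bank s M b0 b tb0 tb"
  unfolding dual_iff_one_level one_level_identity_def
proof (intro ballI)
  fix v w :: "int^'d \<Rightarrow> complex^'r^1" assume v: "v \<in> l2_rows" and w: "w \<in> l2_rows"
  obtain x y where x: "l2_has_sum (\<lambda>k n. seq_inner v (low_elem b0 (M 0) 1 k) ** low_elem tb0 (M 0) 1 k n) x"
    and y: "\<And>j l. j \<in> {1..1} \<Longrightarrow> l \<in> {1..s} \<Longrightarrow> l2_has_sum (\<lambda>k n. seq_inner v (level_elem b0 (M 0) (b l) (M l) j k)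
                           ** level_elem tb0 (M 0) (tb l) (M l) j k n) (y j l)"
    and eq: "v = (\<lambda>n. x n + (\<Sum>j=1..1. \<Sum>l=1..s. y j l n))"
    using bspec[OF assms v] by blast
  have "seq_inner v w = seq_inner (\<lambda>n. x n + (\<Sum>j=1..1. \<Sum>l=1..s. y j l n)) w"
    using eq by (rule arg_cong)
  also have "\<dots> = seq_inner (low_of v 1) (tlow_of w 1) + (\<Sum>j=1..1. \<Sum>l=1..s. seq_inner (high_of v j l) (thigh_of w j l))"
    by (rule seq_inner_expansion[OF v w order_refl x y])
  finally show "seq_inner v w = seq_inner (transition_op b0 (M 0) v) (transition_op tb0 (M 0) w)
    + (\<Sum>l=1..s. seq_inner (transition_op (b l) (M l) v) (transition_op (tb l) (M l) w))"
    by simp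
qed

lemma coefficient_normsq:
  "(\<Sum>\<^sub>\<infinity>k. (norm (seq_inner v (low_elem b0 (M 0) J k)))\<^sup>2)
     + (\<Sum>j=1..J. \<Sum>l=1..s. \<Sum>\<^sub>\<infinity>k. (norm (seq_inner v (level_elem b0 (M 0) (b l) (M l) j k)))\<^sup>2)
   = decomposition_normsq s M b0 b J v"
proof -
  have "(\<Sum>\<^sub>\<infinity>k. (norm (seq_inner v (level_elem b0 (M 0) (b l) (M l) j k)))\<^sup>2) = l2_normsq (high_of v j l)"
    if "j \<in> {1..J}" "l \<in> {1..s}" for j l
    using that by (simp add: l2_normsq_def seq_inner_level_elem[OF low_l0(1) high_l0(1)[OF that(2)] det_M(1)])
  then show ?thesis
    by (simp add: decomposition_normsq_def seq_inner_low_elem[OF low_l0(1) det_M(1)] l2_normsq_def[of "low_of v J"])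
qed

end

theorem theorem4p5:
  fixes s :: nat
    and M :: "nat \<Rightarrow> int ^ 'd ^ 'd"
    and b0 tb0 :: "int ^ 'd \<Rightarrow> complex ^ 'r ^ 'r"
    and b tb :: "nat \<Rightarrow> int ^ 'd \<Rightarrow> complex ^ 'r ^ 1"
  assumes s_pos: "s \<ge> 1"
    and low_fin: "b0 \<in> l0_seqs" "tb0 \<in> l0_seqs"
    and high_fin: "\<And>l. l \<in> {1..s} \<Longrightarrow> b l \<in> l0_seqs" "\<And>l. l \<in> {1..s} \<Longrightarrow> tb l \<in> l0_seqs"
    and dil: "\<And>l. l \<in> {0..s} \<Longrightarrow> dilation_matrix (M l)"
  shows
    "(dual_framelet_filter_bank s M b0 b tb0 tb \<longleftrightarrow>
     (\<forall>v\<in>l2_rows. \<forall>w\<in>l2_rows.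
        seq_inner v w =
          (\<Sum>\<^sub>\<infinity>k. seq_inner v (low_elem b0 (M 0) 1 k) ** seq_inner (low_elem tb0 (M 0) 1 k) w)
          + (\<Sum>l=1..s. \<Sum>\<^sub>\<infinity>k. seq_inner v (level_elem b0 (M 0) (b l) (M l) 1 k)
                              ** seq_inner (level_elem tb0 (M 0) (tb l) (M l) 1 k) w)))
     \<and>
     (dual_framelet_filter_bank s M b0 b tb0 tb \<longleftrightarrow>
     (\<forall>J\<ge>1. \<forall>v\<in>l2_rows. \<forall>w\<in>l2_rows.
        seq_inner v w =
          (\<Sum>\<^sub>\<infinity>k. seq_inner v (low_elem b0 (M 0) J k) ** seq_inner (low_elem tb0 (M 0) J k) w)
          + (\<Sum>j=1..J. \<Sum>l=1..s. \<Sum>\<^sub>\<infinity>k. seq_inner v (level_elem b0 (M 0) (b l) (M l) j k)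
                              ** seq_inner (level_elem tb0 (M 0) (tb l) (M l) j k) w)))
     \<and>
     (dual_framelet_filter_bank s M b0 b tb0 tb \<longleftrightarrow>
     (\<forall>j\<ge>1. \<forall>v\<in>l2_rows. \<forall>w\<in>l2_rows.
        (\<Sum>\<^sub>\<infinity>k. seq_inner v (low_elem b0 (M 0) (j - 1) k)
               ** seq_inner (low_elem tb0 (M 0) (j - 1) k) w) =
          (\<Sum>\<^sub>\<infinity>k. seq_inner v (low_elem b0 (M 0) j k) ** seq_inner (low_elem tb0 (M 0) j k) w)
          + (\<Sum>l=1..s. \<Sum>\<^sub>\<infinity>k. seq_inner v (level_elem b0 (M 0) (b l) (M l) j k)
                              ** seq_inner (level_elem tb0 (M 0) (tb l) (M l) j k) w)))
     \<and>
     (l2_stable s M b0 b \<and> l2_stable s M tb0 tb \<longrightarrow>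
     (dual_framelet_filter_bank s M b0 b tb0 tb \<longleftrightarrow>
       (\<forall>J\<ge>1. \<forall>v\<in>l2_rows.
          \<exists>x y.
            l2_has_sum (\<lambda>k n. seq_inner v (low_elem b0 (M 0) J k) ** low_elem tb0 (M 0) J k n) x \<and>
            (\<forall>j\<in>{1..J}. \<forall>l\<in>{1..s}.
               l2_has_sum (\<lambda>k n. seq_inner v (level_elem b0 (M 0) (b l) (M l) j k)
                                 ** level_elem tb0 (M 0) (tb l) (M l) j k n) (y j l)) \<and>
            v = (\<lambda>n. x n + (\<Sum>j=1..J. \<Sum>l=1..s. y j l n))) \<and>
       (\<exists>C1>0. \<exists>C2>0. \<forall>J\<ge>1. \<forall>v\<in>l2_rows.
          (let S = (\<Sum>\<^sub>\<infinity>k. (norm (seq_inner v (low_elem b0 (M 0) J k)))\<^sup>2)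
                 + (\<Sum>j=1..J. \<Sum>l=1..s. \<Sum>\<^sub>\<infinity>k.
                      (norm (seq_inner v (level_elem b0 (M 0) (b l) (M l) j k)))\<^sup>2)
           in C1 * l2_normsq v \<le> S \<and> S \<le> C2 * l2_normsq v) \<and>
          (let S = (\<Sum>\<^sub>\<infinity>k. (norm (seq_inner v (low_elem tb0 (M 0) J k)))\<^sup>2)
                 + (\<Sum>j=1..J. \<Sum>l=1..s. \<Sum>\<^sub>\<infinity>k.
                      (norm (seq_inner v (level_elem tb0 (M 0) (tb l) (M l) j k)))\<^sup>2)
           in inverse C2 * l2_normsq v \<le> S \<and> S \<le> inverse C1 * l2_normsq v))))"
proof -
  have det: "det (M l) \<noteq> 0" if "l \<in> {0..s}" for l
    using dil[OF that] by (rule dilation_matrix_det)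
  interpret filter_bank s M b0 tb0 b tb
    by unfold_locales (use low_fin high_fin det in auto)
  \<comment> \<open>The locale is symmetric in the two families; exchanging them yields the
    coefficient sums of the dual bank.\<close>
  interpret dual: filter_bank s M tb0 b0 tb b
    by unfold_locales (use low_fin high_fin det in auto)
  show ?thesis
  proof (intro conjI impI, goal_cases)
    case 1
    show ?case by (rule dual_iff_single_level)
  next
    case 2
    show ?case by (rule dual_iff_multilevel)
  next
    case 3
    show ?case by (rule dual_iff_cascade)
  next
    case 4
    obtain c1 c2 where c: "c1 > 0" "c2 > 0" "\<And>J v. J \<ge> 1 \<Longrightarrow> v \<in> l2_rows \<Longrightarrow>
        c1 * l2_normsq v \<le> decomposition_normsq s M b0 b J v \<and> decomposition_normsq s M b0 b J v \<le> c2 * l2_normsq v"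
      using 4 unfolding l2_stable_def by blast
    obtain t1 t2 where t: "t1 > 0" "t2 > 0" "\<And>J v. J \<ge> 1 \<Longrightarrow> v \<in> l2_rows \<Longrightarrow>
        t1 * l2_normsq v \<le> decomposition_normsq s M tb0 tb J v \<and> decomposition_normsq s M tb0 tb J v \<le> t2 * l2_normsq v"
      using 4 unfolding l2_stable_def by blast
    \<comment> \<open>One pair of constants has to serve both banks, with inverted roles in the dual
      one. So \<open>C1\<close> must lie below c1 and 1/t2, and \<open>C2\<close> above c2 and
      1/t1.\<close>
    define C1 where "C1 = min c1 (inverse t2)"
    define C2 where "C2 = max c2 (inverse t1)"
    have pos: "C1 > 0" "C2 > 0" using c t by (auto simp: C1_def C2_def less_max_iff_disj)
    have "inverse C2 \<le> inverse (inverse t1)" "inverse (inverse t2) \<le> inverse C1"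
      using c t pos by (intro le_imp_inverse_le; simp add: C1_def C2_def)+
    then have cmp: "C1 \<le> c1" "c2 \<le> C2" "inverse C2 \<le> t1" "t2 \<le> inverse C1"
      by (simp_all add: C1_def C2_def)
    have bounds: "C1 * l2_normsq v \<le> decomposition_normsq s M b0 b J v"
      "decomposition_normsq s M b0 b J v \<le> C2 * l2_normsq v"
      "inverse C2 * l2_normsq v \<le> decomposition_normsq s M tb0 tb J v"
      "decomposition_normsq s M tb0 tb J v \<le> inverse C1 * l2_normsq v"
      if "J \<ge> 1" "v \<in> l2_rows" for J v
      using c(3)[OF that] t(3)[OF that] cmp[THEN mult_right_mono, OF l2_normsq_nonneg[of v]]
      by linarith+
    show ?case
      unfolding Let_def coefficient_normsq dual.coefficient_normsq
    proof (intro iffI conjI allI ballI impI)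
      fix J :: nat and v :: "int^'d \<Rightarrow> complex^'r^1"
      assume "dual_framelet_filter_bank s M b0 b tb0 tb" "J \<ge> 1" "v \<in> l2_rows"
      then show "\<exists>x y.
            l2_has_sum (\<lambda>k n. seq_inner v (low_elem b0 (M 0) J k) ** low_elem tb0 (M 0) J k n) x \<and>
            (\<forall>j\<in>{1..J}. \<forall>l\<in>{1..s}.
               l2_has_sum (\<lambda>k n. seq_inner v (level_elem b0 (M 0) (b l) (M l) j k)
                                 ** level_elem tb0 (M 0) (tb l) (M l) j k n) (y j l)) \<and>
            v = (\<lambda>n. x n + (\<Sum>j=1..J. \<Sum>l=1..s. y j l n))"
        by (rule dual_imp_expansion)
    next
      show "\<exists>C1>0. \<exists>C2>0. \<forall>J\<ge>1. \<forall>v\<in>l2_rows.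
          (C1 * l2_normsq v \<le> decomposition_normsq s M b0 b J v \<and> decomposition_normsq s M b0 b J v \<le> C2 * l2_normsq v) \<and>
          (inverse C2 * l2_normsq v \<le> decomposition_normsq s M tb0 tb J v \<and>
            decomposition_normsq s M tb0 tb J v \<le> inverse C1 * l2_normsq v)"
        using pos bounds by (intro exI[of _ C1] exI[of _ C2] conjI allI impI ballI)
    next
      assume "(\<forall>J\<ge>1. \<forall>v\<in>l2_rows. \<exists>x y.
            l2_has_sum (\<lambda>k n. seq_inner v (low_elem b0 (M 0) J k) ** low_elem tb0 (M 0) J k n) x \<and>
            (\<forall>j\<in>{1..J}. \<forall>l\<in>{1..s}.
               l2_has_sum (\<lambda>k n. seq_inner v (level_elem b0 (M 0) (b l) (M l) j k)
                                 ** level_elem tb0 (M 0) (tb l) (M l) j k n) (y j l)) \<and>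
            v = (\<lambda>n. x n + (\<Sum>j=1..J. \<Sum>l=1..s. y j l n))) \<and>
        (\<exists>C1>0. \<exists>C2>0. \<forall>J\<ge>1. \<forall>v\<in>l2_rows.
          (C1 * l2_normsq v \<le> decomposition_normsq s M b0 b J v \<and> decomposition_normsq s M b0 b J v \<le> C2 * l2_normsq v) \<and>
          (inverse C2 * l2_normsq v \<le> decomposition_normsq s M tb0 tb J v \<and>
            decomposition_normsq s M tb0 tb J v \<le> inverse C1 * l2_normsq v))"
      then show "dual_framelet_filter_bank s M b0 b tb0 tb"
        by (intro expansion_imp_dual) (drule conjunct1, drule spec[of _ 1], simp only: order_refl simp_thms)
    qed
  qed
qed

end
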